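(* Let $p\in\mathbb{N}$ and let $(X_i,Y_i)_{i=1}^n$ be independent copies of $(X,Y)$, where $X\in[0,1]^p$, $Y\in\mathbb{R}$ and $Y=m(X)+\varepsilon$ with $\mathbb{E}[\varepsilon\mid X]=0$; the joint distribution of $(X,\varepsilon)$ is fixed and only $m$ varies. Assume $X$ has a Lebesgue density $f_X$ with $0<c_X\le f_X(\cdot)\le C_X$ on $[0,1]^p$, and the conditional variance $\sigma^2(x)=\mathrm{Var}(\varepsilon\mid X=x)$ satisfies $0<c_{\sigma^2}\le\sigma^2(\cdot)\le C_{\sigma^2}$, for constants $c_X,C_X,c_{\sigma^2},C_{\sigma^2}>0$. Let $\alpha\in(0,1]$, $C_H>0$, and let $\delta=\delta_n\to0$ with $\delta^{-1}\in\mathbb{N}$ satisfy $$n\delta^{2\alpha+p}(\log n)^2\to0.$$ Let $4\le\nu\in\mathbb{N}$ be such that $\mathbb{E}[|\varepsilon|^\nu]<\infty$ and $$\frac{(\log n)^5}{\delta^p n^{1-2/\nu}}\to0,$$ and assume $\sup_{x\in[0,1]^p}\mathbb{E}[|\varepsilon|^3\mid X=x]<\infty$. For independent standard normal random variables $(Z_j)_{j\in\mathbb{N}}$ and $\beta\in(0,1)$ let $c_\delta(\beta)>0$ be given by $\mathbb{P}(\max_{j=1,\dots,\delta^{-p}}|Z_j|\le c_\delta(\beta))=1-\beta$. Define $$\tau_\delta(x)=\frac{\mathbb{P}(X\in A_\delta(x))^2}{\mathbb{E}[\sigma^2(X)\mathbb{I}_{A_\delta(x)}(X)]}$$ and the band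 $$\mathcal{C}_n(x)=\Big[\hat m(x)-c_\delta(\beta)(\tau_\delta(x)n)^{-1/2},\ \hat m(x)+c_\delta(\beta)(\tau_\delta(x)n)^{-1/2}\Big].$$ Then $$\liminf_{n\to\infty}\inf_{m\in\mathcal{H}^\alpha(C_H)}\mathbb{P}\big(m(x)\in\mathcal{C}_n(x)\ \forall x\in[0,1]^p\big)\ge1-\beta.$$
   Context: For $\delta^{-1}\in\mathbb{N}$, $[0,1]^p$ is partitioned by the equidistant grid of edge length $\delta$ into $\delta^{-p}$ hypercubes of volume $\delta^p$; $A_\delta(x)$ denotes the hypercube of this partition containing $x$. The histogram regression estimator is $\hat m(x)=\sum_{j=1}^n Y_j\,\mathbb{I}\{X_j\in A_\delta(x)\}/\sum_{i=1}^n\mathbb{I}\{X_i\in A_\delta(x)\}$, defined as $0$ on cells containing no observation. $\mathcal{H}^\alpha(C_H)$ is the set of all functions $m:[0,1]^p\to\mathbb{R}$ that are $\alpha$-Hölder continuous (w.r.t. the Euclidean norm) with Hölder constant at most $C_H$ and with $\sup_x|m(x)|\le C_H$. *)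

theory Defs
  imports "HOL-Probability.Probability"
begin

definition unit_cube :: "(real ^ 'p::finite) set" where
  "unit_cube = {x. \<forall>i. 0 \<le> x $ i \<and> x $ i \<le> 1}"

text \<open>Grid with N = delta^-1 cells per axis. Index of the cell containing x along axis i:
  cells are [k/N,(k+1)/N), except the last one which is closed [1-1/N,1].\<close>
definition cell_index :: "nat \<Rightarrow> real ^ 'p::finite \<Rightarrow> 'p \<Rightarrow> nat" where
  "cell_index N x i = min (nat \<lfloor>x $ i * real N\<rfloor>) (N - 1)"

definition cell :: "nat \<Rightarrow> real ^ 'p::finite \<Rightarrow> (real ^ 'p) set" where
  "cell N x = {y \<in> unit_cube. \<forall>i. cell_index N y i = cell_index N x i}"

text \<open>Hoelder class H^alpha(C_H) of functions on [0,1]^p (identified with their extension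
  by 0 outside the cube).\<close>
definition holder_class :: "real \<Rightarrow> real \<Rightarrow> (real ^ 'p::finite \<Rightarrow> real) set" where
  "holder_class \<alpha> CH = {m. (\<forall>x\<in>unit_cube. \<forall>y\<in>unit_cube. \<bar>m x - m y\<bar> \<le> CH * norm (x - y) powr \<alpha>)
      \<and> (\<forall>x\<in>unit_cube. \<bar>m x\<bar> \<le> CH) \<and> (\<forall>x. x \<notin> unit_cube \<longrightarrow> m x = 0)}"

definition hist_est :: "nat \<Rightarrow> nat \<Rightarrow> (nat \<Rightarrow> real ^ 'p::finite) \<Rightarrow> (nat \<Rightarrow> real) \<Rightarrow> real ^ 'p \<Rightarrow> real" where
  "hist_est N n Xs Ys x =
     (let cnt = card {i. i < n \<and> Xs i \<in> cell N x} in
      if cnt = 0 then 0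
      else (\<Sum>j<n. Ys j * indicator (cell N x) (Xs j)) / real cnt)"

definition gauss_max_cdf :: "nat \<Rightarrow> real \<Rightarrow> real" where
  "gauss_max_cdf K c =
     measure (PiM {..<K} (\<lambda>_. std_normal_distribution)) {z \<in> {..<K} \<rightarrow>\<^sub>E UNIV. \<forall>j<K. \<bar>z j\<bar> \<le> c}"

definition crit_val :: "nat \<Rightarrow> real \<Rightarrow> real" where
  "crit_val K \<beta> = (THE c. c > 0 \<and> gauss_max_cdf K c = 1 - \<beta>)"

end

theory Submission
  imports Defs "HOL-Real_Asymp.Real_Asymp"
begin

text \<open>Given the cells of all design points, the errors in different cells are independent, and within a
  cell they are i.i.d. with mean 0 and variance \<open>V / P\<close>, where \<open>P\<close> is the probability of the cell and
  \<open>V\<close> the integral of the conditional variance over it. Hence the conditional coverage probability is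
  a product over the \<open>K\<close> cells, and it suffices to compare the two tails of each normalized cell sum at
  the critical value \<open>c\<close> with the Gaussian ones, up to an error that is \<open>o(1 / K)\<close>. For this the
  Lindeberg replacement argument is run with a test function dominated by \<open>exp (c x)\<close>: every replacement
  then costs a third moment times \<open>exp (- c^2 / 2)\<close>, which is of order \<open>1 / K\<close> up to logarithms.
  Errors are truncated at \<open>1 / ln n\<close> times the standard deviation of their cell sum; by the moment of
  order \<open>\<nu>\<close> the truncation is inactive with probability tending to 1. The random cell counts, which
  concentrate by a Chernoff bound, and the bias shift the level only by \<open>o(1 / ln n)\<close>.\<close>

section \<open>Exponentially weighted Lindeberg replacement\<close>

text \<open>A uniform normal approximation is too weak. With M = n \<delta>^p observations per cell
  and K = \<delta>^(-p) cells, a Berry-Esseen error M^(-1/2) per cell adds up to K M^(-1/2), and the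
  second rate condition lets M be as small as n^(2/\<nu>) up to logarithms; for \<nu> = 4 this sum
  diverges. The error must be small relative to exp(-c^2/2), which suffices because the critical
  value keeps K exp(-c^2/2) of order at most c. The exponent c of the weight is the minimizer l of
  l^2/2 - l c. The errors have only polynomial moments, so exponential weights force truncation.
  Truncated errors are neither centred nor of full mass; instead of being recentred, they carry the
  truncation indicator as a weight, and the defects of mass, mean and variance are booked together
  with the Taylor remainder. The function m enters through the bias alone, whose bound depends only
  on the class, so every estimate is uniform in m.\<close>

definition walk_op :: "'a measure \<Rightarrow> ('a \<Rightarrow> real) \<Rightarrow> ('a \<Rightarrow> real) \<Rightarrow> (real \<Rightarrow> real) \<Rightarrow> real \<Rightarrow> real" where
  "walk_op \<mu> w \<xi> f x = (\<integral>s. w s * f (x + \<xi> s) \<partial>\<mu>)"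

text \<open>The bound is one-sided: it decays to the left, where the test function of an upper tail
  vanishes. The constant \<open>A\<close> will carry the factor \<open>exp (- l * a)\<close> of a
  tail at \<open>a\<close>.\<close>

definition exp_dominated :: "real \<Rightarrow> real \<Rightarrow> (real \<Rightarrow> real) \<Rightarrow> bool" where
  "exp_dominated l A f \<longleftrightarrow> f \<in> borel_measurable borel \<and> (\<forall>x. \<bar>f x\<bar> \<le> A * exp (l * x))"

text \<open>\<open>f1\<close> and \<open>f2\<close> play the part of derivatives, but only the
  Taylor bound is asked for, since this is what survives averaging. The factor
  \<open>exp (l * \<bar>y\<bar>)\<close> covers the case that \<open>x\<close> lies to the left of
  the support of \<open>f\<close> while \<open>x + y\<close> lies inside.\<close>

definition exp_smooth :: "real \<Rightarrow> real \<Rightarrow> (real \<Rightarrow> real) \<Rightarrow> (real \<Rightarrow> real) \<Rightarrow> (real \<Rightarrow> real) \<Rightarrow> bool" where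
  "exp_smooth l A f f1 f2 \<longleftrightarrow> exp_dominated l A f \<and> exp_dominated l A f1 \<and> exp_dominated l A f2 \<and>
     (\<forall>x y. \<bar>f (x + y) - f x - f1 x * y - f2 x * y\<^sup>2 / 2\<bar> \<le> A * exp (l * x) * (\<bar>y\<bar> ^ 3 * exp (l * \<bar>y\<bar>)))"

lemma integrable_of_abs_le:
  fixes f g :: "'a \<Rightarrow> real"
  assumes "integrable M g" "f \<in> borel_measurable M" "\<And>x. \<bar>f x\<bar> \<le> g x"
  shows "integrable M f"
  by (rule Bochner_Integration.integrable_bound[OF assms(1,2)]) (simp add: order_trans[OF assms(3) abs_ge_self])

lemma abs_power_le_one_plus:
  fixes y :: real
  assumes "j \<le> k" shows "\<bar>y\<bar> ^ j \<le> 1 + \<bar>y\<bar> ^ k"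
proof (cases "\<bar>y\<bar> \<le> 1")
  case True
  then show ?thesis using power_le_one[of "\<bar>y\<bar>" j] by (simp add: add_increasing2)
next
  case False
  then have "\<bar>y\<bar> ^ j \<le> \<bar>y\<bar> ^ k" using assms by (intro power_increasing) auto
  then show ?thesis by simp
qed

lemma exp_le_cubic_remainder:
  fixes u :: real
  shows "exp u \<le> 1 + u + u\<^sup>2 / 2 + \<bar>u\<bar> ^ 3 * exp \<bar>u\<bar> / 6"
proof -
  obtain t where t: "\<bar>t\<bar> \<le> \<bar>u\<bar>" "exp u = (\<Sum>m<3. u ^ m / fact m) + exp t / fact 3 * u ^ 3"
    using Maclaurin_exp_le[of u 3] by blast
  have "exp t * u ^ 3 \<le> exp \<bar>u\<bar> * \<bar>u\<bar> ^ 3"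
  proof -
    have "exp t * u ^ 3 \<le> \<bar>exp t * u ^ 3\<bar>" by simp
    also have "\<dots> = exp t * \<bar>u\<bar> ^ 3" by (simp add: abs_mult power_abs)
    also have "\<dots> \<le> exp \<bar>u\<bar> * \<bar>u\<bar> ^ 3"
      using t(1) by (intro mult_right_mono) auto
    finally show ?thesis .
  qed
  then show ?thesis unfolding t(2)
    by (simp add: eval_nat_numeral fact_numeral mult.commute)
qed

text \<open>The weight is 1 for the Gaussian walk. For the data it is the indicator of "in the cell
  with a small error" divided by the probability of the whole cell, so its mass falls short of 1. A
  single \<open>r\<close> bounds the defects of mass, mean and second moment and the weighted third
  moment, which lets both walks satisfy the same conditions.\<close>

locale walk_step = prob_space \<mu> for \<mu> :: "'a measure" +
  fixes w \<xi> :: "'a \<Rightarrow> real" and l v r :: real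
  assumes w_meas [measurable]: "w \<in> borel_measurable \<mu>" and \<xi>_meas [measurable]: "\<xi> \<in> borel_measurable \<mu>"
    and w_nonneg: "\<And>s. 0 \<le> w s"
    and l_nonneg: "0 \<le> l" and v_nonneg: "0 \<le> v"
    and int0: "integrable \<mu> w" and int1: "integrable \<mu> (\<lambda>s. w s * \<xi> s)"
    and int2: "integrable \<mu> (\<lambda>s. w s * (\<xi> s)\<^sup>2)"
    and int3: "integrable \<mu> (\<lambda>s. w s * (\<bar>\<xi> s\<bar> ^ 3 * exp (l * \<bar>\<xi> s\<bar>)))"
    and mom0: "\<bar>(\<integral>s. w s \<partial>\<mu>) - 1\<bar> \<le> r"
    and mom1: "\<bar>\<integral>s. w s * \<xi> s \<partial>\<mu>\<bar> \<le> r"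
    and mom2: "\<bar>(\<integral>s. w s * (\<xi> s)\<^sup>2 \<partial>\<mu>) - v\<bar> \<le> r"
    and mom3: "(\<integral>s. w s * (\<bar>\<xi> s\<bar> ^ 3 * exp (l * \<bar>\<xi> s\<bar>)) \<partial>\<mu>) \<le> r"
begin

definition L :: real where "L = exp (l\<^sup>2 * v / 2 + r * (1 + l) ^ 3)"

lemma r_nonneg: "0 \<le> r" using mom0 by linarith

lemma L_ge_1: "1 \<le> L"
  unfolding L_def using r_nonneg l_nonneg v_nonneg by simp

abbreviation "T \<equiv> walk_op \<mu> w \<xi>"

text \<open>A cubic expansion turns the four moment conditions into a bound for the moment
  generating function, and \<open>1 + u \<le> exp u\<close> makes it multiplicative. For
  \<open>v = 1 / m\<close> the m-th power of \<open>L\<close> is the Gaussian value exp(l^2/2) times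
  exp(m r (1 + l)^3).\<close>

lemma exp_moment:
  shows "integrable \<mu> (\<lambda>s. w s * exp (l * \<xi> s))" and "(\<integral>s. w s * exp (l * \<xi> s) \<partial>\<mu>) \<le> L"
proof -
  let ?g = "\<lambda>s. w s + l * (w s * \<xi> s) + l\<^sup>2 / 2 * (w s * (\<xi> s)\<^sup>2)
      + l ^ 3 / 6 * (w s * (\<bar>\<xi> s\<bar> ^ 3 * exp (l * \<bar>\<xi> s\<bar>)))"
  have g: "integrable \<mu> ?g" by (intro Bochner_Integration.integrable_add integrable_mult_right int0 int1 int2 int3)
  have le: "w s * exp (l * \<xi> s) \<le> ?g s" for s
  proof -
    have "w s * exp (l * \<xi> s) \<le> w s * (1 + l * \<xi> s + (l * \<xi> s)\<^sup>2 / 2 + \<bar>l * \<xi> s\<bar> ^ 3 * exp \<bar>l * \<xi> s\<bar> / 6)"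
      by (intro mult_left_mono exp_le_cubic_remainder w_nonneg)
    also have "\<dots> = ?g s"
      using l_nonneg by (simp add: abs_mult algebra_simps power_mult_distrib)
    finally show ?thesis .
  qed
  show i: "integrable \<mu> (\<lambda>s. w s * exp (l * \<xi> s))"
    by (rule integrable_of_abs_le[OF g]) (use le w_nonneg in \<open>simp_all add: abs_mult\<close>)
  have "(\<integral>s. w s * exp (l * \<xi> s) \<partial>\<mu>) \<le> (\<integral>s. ?g s \<partial>\<mu>)"
    by (intro integral_mono i g le)
  also have "\<dots> = (\<integral>s. w s \<partial>\<mu>) + l * (\<integral>s. w s * \<xi> s \<partial>\<mu>) + l\<^sup>2 / 2 * (\<integral>s. w s * (\<xi> s)\<^sup>2 \<partial>\<mu>)
      + l ^ 3 / 6 * (\<integral>s. w s * (\<bar>\<xi> s\<bar> ^ 3 * exp (l * \<bar>\<xi> s\<bar>)) \<partial>\<mu>)"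
    using int0 int1 int2 int3 by simp
  also have "\<dots> \<le> (1 + r) + l * r + l\<^sup>2 / 2 * (v + r) + l ^ 3 / 6 * r"
    using mom0 mom1 mom2 mom3 l_nonneg
    by (intro add_mono mult_left_mono) auto
  also have "\<dots> = 1 + (l\<^sup>2 * v / 2 + r * (1 + l + l\<^sup>2 / 2 + l ^ 3 / 6))"
    by (simp add: algebra_simps)
  also have "\<dots> \<le> 1 + (l\<^sup>2 * v / 2 + r * (1 + l) ^ 3)"
  proof -
    have "(1 + l) ^ 3 = 1 + 3 * l + 3 * l\<^sup>2 + l ^ 3" by (simp add: eval_nat_numeral algebra_simps)
    moreover have "0 \<le> l\<^sup>2" "0 \<le> l ^ 3" using l_nonneg by auto
    ultimately have "1 + l + l\<^sup>2 / 2 + l ^ 3 / 6 \<le> (1 + l) ^ 3" using l_nonneg by linarith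
    then show ?thesis using r_nonneg by (simp add: mult_left_mono)
  qed
  also have "\<dots> \<le> L" unfolding L_def by (rule exp_ge_add_one_self)
  finally show "(\<integral>s. w s * exp (l * \<xi> s) \<partial>\<mu>) \<le> L" .
qed

lemma walk_op_integrable:
  assumes "exp_dominated l A f"
  shows "integrable \<mu> (\<lambda>s. w s * f (x + \<xi> s))"
proof (rule integrable_of_abs_le)
  have [measurable]: "f \<in> borel_measurable borel" using assms by (simp add: exp_dominated_def)
  show "integrable \<mu> (\<lambda>s. (A * exp (l * x)) * (w s * exp (l * \<xi> s)))"
    by (intro integrable_mult_right exp_moment)
  show "(\<lambda>s. w s * f (x + \<xi> s)) \<in> borel_measurable \<mu>" by measurable
  fix s
  have "\<bar>f (x + \<xi> s)\<bar> \<le> A * exp (l * (x + \<xi> s))" using assms by (simp add: exp_dominated_def)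
  then have "\<bar>w s * f (x + \<xi> s)\<bar> \<le> w s * (A * exp (l * (x + \<xi> s)))"
    using w_nonneg[of s] by (simp add: abs_mult mult_left_mono)
  then show "\<bar>w s * f (x + \<xi> s)\<bar> \<le> (A * exp (l * x)) * (w s * exp (l * \<xi> s))"
    by (simp add: exp_add algebra_simps)
qed

lemma abs_walk_integral_le:
  assumes g: "\<And>s. \<bar>g s\<bar> \<le> A * exp (l * (x + \<xi> s))" and A: "0 \<le> A"
  shows "\<bar>\<integral>s. w s * g s \<partial>\<mu>\<bar> \<le> A * L * exp (l * x)"
proof -
  have i: "integrable \<mu> (\<lambda>s. (A * exp (l * x)) * (w s * exp (l * \<xi> s)))"
    by (intro integrable_mult_right exp_moment)
  have "\<bar>\<integral>s. w s * g s \<partial>\<mu>\<bar> \<le> (\<integral>s. \<bar>w s * g s\<bar> \<partial>\<mu>)" by (rule integral_abs_bound)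
  also have "\<dots> \<le> (\<integral>s. (A * exp (l * x)) * (w s * exp (l * \<xi> s)) \<partial>\<mu>)"
  proof (rule integral_mono'[OF i])
    fix s
    have "\<bar>w s * g s\<bar> \<le> w s * (A * exp (l * (x + \<xi> s)))"
      using w_nonneg[of s] g[of s] by (simp add: abs_mult mult_left_mono)
    then show "\<bar>w s * g s\<bar> \<le> (A * exp (l * x)) * (w s * exp (l * \<xi> s))"
      by (simp add: exp_add algebra_simps)
  qed (use A w_nonneg in auto)
  also have "\<dots> = (A * exp (l * x)) * (\<integral>s. w s * exp (l * \<xi> s) \<partial>\<mu>)" by simp
  also have "\<dots> \<le> (A * exp (l * x)) * L"
    using A by (intro mult_left_mono exp_moment) auto
  finally show ?thesis by (simp add: algebra_simps)
qed

lemma exp_dominated_nonneg: "exp_dominated l A f \<Longrightarrow> 0 \<le> A"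
proof -
  assume "exp_dominated l A f"
  then have "\<bar>f 0\<bar> \<le> A * exp (l * 0)" unfolding exp_dominated_def by blast
  then show "0 \<le> A" by simp
qed

lemma walk_op_measurable [measurable]:
  assumes [measurable]: "f \<in> borel_measurable borel"
  shows "T f \<in> borel_measurable borel"
  unfolding walk_op_def by measurable

lemma walk_op_dominated:
  assumes f: "exp_dominated l A f"
  shows "exp_dominated l (A * L) (T f)"
  unfolding exp_dominated_def
proof safe
  have [measurable]: "f \<in> borel_measurable borel" using f by (simp add: exp_dominated_def)
  show "T f \<in> borel_measurable borel" by measurable
  fix x show "\<bar>T f x\<bar> \<le> A * L * exp (l * x)" unfolding walk_op_def
    using f exp_dominated_nonneg[OF f] by (intro abs_walk_integral_le) (auto simp: exp_dominated_def)
qed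

lemma walk_pow_dominated:
  "exp_dominated l A f \<Longrightarrow> exp_dominated l (A * L ^ m) ((T ^^ m) f)"
proof (induction m)
  case (Suc m)
  then show ?case using walk_op_dominated[of "A * L ^ m" "(T ^^ m) f"] by (simp add: algebra_simps)
qed simp

lemma walk_pow_diff:
  assumes "exp_dominated l A f" "exp_dominated l B g"
  shows "(T ^^ m) (\<lambda>x. f x - g x) = (\<lambda>x. (T ^^ m) f x - (T ^^ m) g x)"
proof (induction m)
  case (Suc m)
  have "T (\<lambda>x. (T ^^ m) f x - (T ^^ m) g x) y = T ((T ^^ m) f) y - T ((T ^^ m) g) y" for y
    using walk_op_integrable[OF walk_pow_dominated[OF assms(1)]] walk_op_integrable[OF walk_pow_dominated[OF assms(2)]]
    by (simp add: walk_op_def[of _ _ _ _ y] right_diff_distrib)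
  then show ?case by (simp add: Suc fun_eq_iff)
qed simp

text \<open>Averaging commutes with translation, so the Taylor remainder of \<open>T f\<close> is
  the average of the remainders of \<open>f\<close>; averaging the exponential weight costs the
  factor \<open>L\<close>.\<close>

lemma walk_op_smooth:
  assumes "exp_smooth l A f f1 f2"
  shows "exp_smooth l (A * L) (T f) (T f1) (T f2)"
proof -
  have d: "exp_dominated l A f" "exp_dominated l A f1" "exp_dominated l A f2"
    and rem: "\<And>x y. \<bar>f (x + y) - f x - f1 x * y - f2 x * y\<^sup>2 / 2\<bar> \<le> A * exp (l * x) * (\<bar>y\<bar> ^ 3 * exp (l * \<bar>y\<bar>))"
    using assms by (auto simp: exp_smooth_def)
  have "\<bar>T f (x + y) - T f x - T f1 x * y - T f2 x * y\<^sup>2 / 2\<bar> \<le> A * L * exp (l * x) * (\<bar>y\<bar> ^ 3 * exp (l * \<bar>y\<bar>))" for x y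
  proof -
    let ?g = "\<lambda>s. f (x + y + \<xi> s) - f (x + \<xi> s) - f1 (x + \<xi> s) * y - f2 (x + \<xi> s) * y\<^sup>2 / 2"
    note i = walk_op_integrable[OF d(1), of "x + y"] walk_op_integrable[OF d(1), of x]
      integrable_mult_left[OF walk_op_integrable[OF d(2), of x], of y]
      integrable_mult_left[OF walk_op_integrable[OF d(3), of x], of "y\<^sup>2 / 2"]
    have "T f (x + y) - T f x - T f1 x * y - T f2 x * y\<^sup>2 / 2
      = (\<integral>s. w s * f (x + y + \<xi> s) - w s * f (x + \<xi> s) - w s * f1 (x + \<xi> s) * y - w s * f2 (x + \<xi> s) * (y\<^sup>2 / 2) \<partial>\<mu>)"
      unfolding walk_op_def using i by simp
    also have "\<dots> = (\<integral>s. w s * ?g s \<partial>\<mu>)" by (simp add: algebra_simps)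
    finally have eq: "T f (x + y) - T f x - T f1 x * y - T f2 x * y\<^sup>2 / 2 = (\<integral>s. w s * ?g s \<partial>\<mu>)" .
    have "\<bar>\<integral>s. w s * ?g s \<partial>\<mu>\<bar> \<le> (A * (\<bar>y\<bar> ^ 3 * exp (l * \<bar>y\<bar>))) * L * exp (l * x)"
    proof (rule abs_walk_integral_le)
      fix s show "\<bar>?g s\<bar> \<le> A * (\<bar>y\<bar> ^ 3 * exp (l * \<bar>y\<bar>)) * exp (l * (x + \<xi> s))"
        using rem[of "x + \<xi> s" y] by (simp add: algebra_simps)
    qed (use exp_dominated_nonneg[OF d(1)] in auto)
    then show ?thesis unfolding eq by (simp add: algebra_simps)
  qed
  with d show ?thesis unfolding exp_smooth_def by (auto intro: walk_op_dominated)
qed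

text \<open>The comparison value depends on the step only through \<open>v\<close>, so it is common
  to both walks. Mass, mean, second moment and remainder contribute one \<open>r\<close> each, hence
  the 4; comparing two walks doubles it.\<close>

lemma walk_op_taylor:
  assumes "exp_smooth l A f f1 f2"
  shows "\<bar>T f x - (f x + f2 x * v / 2)\<bar> \<le> 4 * r * A * exp (l * x)"
proof -
  have d: "exp_dominated l A f" "exp_dominated l A f1" "exp_dominated l A f2"
    and rem: "\<And>x y. \<bar>f (x + y) - f x - f1 x * y - f2 x * y\<^sup>2 / 2\<bar> \<le> A * exp (l * x) * (\<bar>y\<bar> ^ 3 * exp (l * \<bar>y\<bar>))"
    using assms by (auto simp: exp_smooth_def)
  have A: "0 \<le> A" by (rule exp_dominated_nonneg[OF d(1)])
  let ?g = "\<lambda>s. f (x + \<xi> s) - f x - f1 x * \<xi> s - f2 x * (\<xi> s)\<^sup>2 / 2"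
  let ?E = "A * exp (l * x)"
  note i = walk_op_integrable[OF d(1), of x] integrable_mult_left[OF int0, of "f x"]
    integrable_mult_left[OF int1, of "f1 x"] integrable_mult_left[OF int2, of "f2 x / 2"]
  have "(\<integral>s. w s * ?g s \<partial>\<mu>) = (\<integral>s. w s * f (x + \<xi> s) - w s * f x - w s * \<xi> s * f1 x - w s * (\<xi> s)\<^sup>2 * (f2 x / 2) \<partial>\<mu>)"
    by (simp add: algebra_simps)
  also have "\<dots> = T f x - (\<integral>s. w s \<partial>\<mu>) * f x - (\<integral>s. w s * \<xi> s \<partial>\<mu>) * f1 x
       - (\<integral>s. w s * (\<xi> s)\<^sup>2 \<partial>\<mu>) * (f2 x / 2)"
    unfolding walk_op_def using i by simp
  finally have eq: "T f x - (f x + f2 x * v / 2) = (\<integral>s. w s * ?g s \<partial>\<mu>) + ((\<integral>s. w s \<partial>\<mu>) - 1) * f x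
      + (\<integral>s. w s * \<xi> s \<partial>\<mu>) * f1 x + ((\<integral>s. w s * (\<xi> s)\<^sup>2 \<partial>\<mu>) - v) * (f2 x / 2)"
    by (simp add: algebra_simps)
  have "\<bar>\<integral>s. w s * ?g s \<partial>\<mu>\<bar> \<le> (\<integral>s. \<bar>w s * ?g s\<bar> \<partial>\<mu>)" by (rule integral_abs_bound)
  also have "\<dots> \<le> (\<integral>s. w s * (\<bar>\<xi> s\<bar> ^ 3 * exp (l * \<bar>\<xi> s\<bar>)) * ?E \<partial>\<mu>)"
  proof (rule integral_mono')
    show "integrable \<mu> (\<lambda>s. w s * (\<bar>\<xi> s\<bar> ^ 3 * exp (l * \<bar>\<xi> s\<bar>)) * ?E)"
      by (rule integrable_mult_left[OF int3])
    fix s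
    show "\<bar>w s * ?g s\<bar> \<le> w s * (\<bar>\<xi> s\<bar> ^ 3 * exp (l * \<bar>\<xi> s\<bar>)) * ?E"
      using mult_left_mono[OF rem[of x "\<xi> s"] w_nonneg[of s]] w_nonneg[of s]
      by (simp add: abs_mult mult_ac)
  qed (use A w_nonneg in auto)
  also have "\<dots> \<le> r * ?E" using mom3 A by (simp add: mult_right_mono)
  finally have 1: "\<bar>\<integral>s. w s * ?g s \<partial>\<mu>\<bar> \<le> r * ?E" .
  have E: "\<bar>f x\<bar> \<le> ?E" "\<bar>f1 x\<bar> \<le> ?E" "\<bar>f2 x\<bar> \<le> ?E"
    using d by (auto simp: exp_dominated_def)
  then have E2: "\<bar>f2 x / 2\<bar> \<le> ?E" by linarith
  have 2: "\<bar>((\<integral>s. w s \<partial>\<mu>) - 1) * f x\<bar> \<le> r * ?E"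
    "\<bar>(\<integral>s. w s * \<xi> s \<partial>\<mu>) * f1 x\<bar> \<le> r * ?E"
    "\<bar>((\<integral>s. w s * (\<xi> s)\<^sup>2 \<partial>\<mu>) - v) * (f2 x / 2)\<bar> \<le> r * ?E"
    unfolding abs_mult
    by (rule mult_mono[OF mom0 E(1)] mult_mono[OF mom1 E(2)] mult_mono[OF mom2 E2]; use r_nonneg in simp)+
  show ?thesis unfolding eq using 1 2 by linarith
qed

end

text \<open>Telescoping over the steps: the two operators agree to third order on smooth functions, and
  each replacement costs one Taylor remainder, weighted by \<open>exp (l x)\<close>.\<close>
lemma lindeberg_walk:
  assumes s: "walk_step \<mu> w \<xi> l v r" and t: "walk_step \<mu>' w' \<xi>' l v r"
    and f: "exp_smooth l A f f1 f2"
  shows "\<bar>(walk_op \<mu> w \<xi> ^^ m) f x - (walk_op \<mu>' w' \<xi>' ^^ m) f x\<bar>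
      \<le> real m * (8 * r * A) * exp (l\<^sup>2 * v / 2 + r * (1 + l) ^ 3) ^ m * exp (l * x)"
  using f
proof (induction m arbitrary: f f1 f2 A)
  case 0
  then show ?case by simp
next
  case (Suc m)
  interpret S: walk_step \<mu> w \<xi> l v r by (rule s)
  interpret T: walk_step \<mu>' w' \<xi>' l v r by (rule t)
  let ?L = "exp (l\<^sup>2 * v / 2 + r * (1 + l) ^ 3)"
  have L: "S.L = ?L" "T.L = ?L" by (simp_all add: S.L_def T.L_def)
  note SL = S.L_ge_1[unfolded L]
  have f: "exp_dominated l A f" using Suc.prems by (simp add: exp_smooth_def)
  have A: "0 \<le> A" by (rule S.exp_dominated_nonneg[OF f])
  have g: "exp_smooth l (A * ?L) (T.T f) (T.T f1) (T.T f2)"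
    using T.walk_op_smooth[OF Suc.prems] by (simp add: L)
  have d: "exp_dominated l (8 * r * A) (\<lambda>y. S.T f y - T.T f y)"
    unfolding exp_dominated_def
  proof safe
    have [measurable]: "f \<in> borel_measurable borel" using f by (simp add: exp_dominated_def)
    show "(\<lambda>y. S.T f y - T.T f y) \<in> borel_measurable borel" by measurable
    fix y show "\<bar>S.T f y - T.T f y\<bar> \<le> 8 * r * A * exp (l * y)"
      using S.walk_op_taylor[OF Suc.prems, of y] T.walk_op_taylor[OF Suc.prems, of y] by linarith
  qed
  \<comment> \<open>For operators S and T, S^(m+1) f - T^(m+1) f = S^m (S f - T f) + (S^m - T^m) (T
    f). The first term needs only domination; the second is the induction hypothesis at
    \<open>T f\<close>, which is smooth with constant \<open>A * ?L\<close>.\<close>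
  have "exp_dominated l (8 * r * A * ?L ^ m) ((S.T ^^ m) (\<lambda>y. S.T f y - T.T f y))"
    using S.walk_pow_dominated[OF d] by (simp add: L)
  then have "\<bar>(S.T ^^ m) (S.T f) x - (S.T ^^ m) (T.T f) x\<bar> \<le> 8 * r * A * ?L ^ m * exp (l * x)"
    unfolding S.walk_pow_diff[OF S.walk_op_dominated[OF f] T.walk_op_dominated[OF f]]
    by (simp add: exp_dominated_def)
  also have "\<dots> \<le> 8 * r * A * ?L ^ Suc m * exp (l * x)"
    using SL S.r_nonneg A by (intro mult_right_mono mult_left_mono power_increasing) auto
  finally have 1: "\<bar>(S.T ^^ m) (S.T f) x - (S.T ^^ m) (T.T f) x\<bar> \<le> 8 * r * A * ?L ^ Suc m * exp (l * x)" .
  have 2: "\<bar>(S.T ^^ m) (T.T f) x - (T.T ^^ m) (T.T f) x\<bar> \<le> real m * (8 * r * A) * ?L ^ Suc m * exp (l * x)"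
    using Suc.IH[OF g] by (simp add: mult_ac)
  have "real (Suc m) * (8 * r * A) * ?L ^ Suc m * exp (l * x) =
    8 * r * A * ?L ^ Suc m * exp (l * x) + real m * (8 * r * A) * ?L ^ Suc m * exp (l * x)"
    by (simp only: of_nat_Suc) (simp add: algebra_simps)
  then show ?case using 1 2 unfolding funpow_Suc_right o_def by linarith
qed

section \<open>Sums of independent variables and the Gaussian walk\<close>

text \<open>Fubini peels off one coordinate, which becomes a shift of the starting point; therefore
  \<open>x\<close> has to vary in the induction. The bounds \<open>C\<close> and \<open>D\<close>
  provide integrability.\<close>

lemma prod_sum_PiM_eq_walk_pow:
  fixes f w \<xi> :: "_ \<Rightarrow> real"
  assumes "prob_space \<mu>" and [measurable]: "w \<in> borel_measurable \<mu>" "\<xi> \<in> borel_measurable \<mu>" "f \<in> borel_measurable borel"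
    and w: "\<And>s. \<bar>w s\<bar> \<le> C" and f: "\<And>x. \<bar>f x\<bar> \<le> D" and "finite I"
  shows "(\<integral>z. (\<Prod>i\<in>I. w (z i)) * f (x + (\<Sum>i\<in>I. \<xi> (z i))) \<partial>PiM I (\<lambda>_. \<mu>)) = (walk_op \<mu> w \<xi> ^^ card I) f x"
  using \<open>finite I\<close>
proof (induction I arbitrary: x rule: finite_induct)
  interpret prob_space \<mu> by fact
  interpret P: product_prob_space "\<lambda>_. \<mu>" by unfold_locales
  case empty
  show ?case by (simp add: PiM_empty lebesgue_integral_count_space_finite)
next
  interpret prob_space \<mu> by fact
  interpret P: product_prob_space "\<lambda>_. \<mu>" by unfold_locales
  case (insert i I)
  interpret PI: prob_space "PiM I (\<lambda>_. \<mu>)" by (intro prob_space_PiM) unfold_locales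
  interpret PiI: prob_space "PiM (insert i I) (\<lambda>_. \<mu>)" by (intro prob_space_PiM) unfold_locales
  interpret PP: pair_prob_space \<mu> "PiM I (\<lambda>_. \<mu>)" ..
  have C: "0 \<le> C" using w[of undefined] by linarith
  have D: "0 \<le> D" using f[of 0] by linarith
  have bnd: "norm ((\<Prod>i\<in>J. w (z i)) * f y) \<le> C ^ card J * D" if "finite J" for J z y
  proof -
    have "(\<Prod>i\<in>J. \<bar>w (z i)\<bar>) \<le> (\<Prod>i\<in>J. C)" using w by (intro prod_mono) auto
    then show ?thesis using f[of y] C by (simp add: abs_mult abs_prod mult_mono)
  qed
  have i1: "integrable (PiM (insert i I) (\<lambda>_. \<mu>)) (\<lambda>z. (\<Prod>i\<in>insert i I. w (z i)) * f (x + (\<Sum>i\<in>insert i I. \<xi> (z i))))"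
  proof (rule PiI.integrable_const_bound)
    show "AE z in PiM (insert i I) (\<lambda>_. \<mu>). norm ((\<Prod>i\<in>insert i I. w (z i)) * f (x + (\<Sum>i\<in>insert i I. \<xi> (z i))))
        \<le> C ^ card (insert i I) * D"
      by (intro AE_I2 bnd) (use insert(1) in simp)
  qed measurable
  let ?h = "\<lambda>s z. w s * ((\<Prod>i\<in>I. w (z i)) * f (x + \<xi> s + (\<Sum>i\<in>I. \<xi> (z i))))"
  have i2: "integrable (\<mu> \<Otimes>\<^sub>M PiM I (\<lambda>_. \<mu>)) (\<lambda>(s, z). ?h s z)"
  proof (rule PP.integrable_const_bound[where B="C * (C ^ card I * D)"])
    show "AE x in \<mu> \<Otimes>\<^sub>M PiM I (\<lambda>_. \<mu>). norm ((\<lambda>(s, z). ?h s z) x) \<le> C * (C ^ card I * D)"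
    proof (rule AE_I2, clarify)
      fix s z
      have "norm (?h s z) = \<bar>w s\<bar> * norm ((\<Prod>i\<in>I. w (z i)) * f (x + \<xi> s + (\<Sum>i\<in>I. \<xi> (z i))))"
        by (simp add: abs_mult)
      also have "\<dots> \<le> C * (C ^ card I * D)"
        using C D by (intro mult_mono w bnd insert(1)) auto
      finally show "norm (?h s z) \<le> C * (C ^ card I * D)" .
    qed
  qed measurable
  have "(\<integral>z. (\<Prod>i\<in>insert i I. w (z i)) * f (x + (\<Sum>i\<in>insert i I. \<xi> (z i))) \<partial>PiM (insert i I) (\<lambda>_. \<mu>))
     = (\<integral>z. (\<integral>s. ?h s z \<partial>\<mu>) \<partial>PiM I (\<lambda>_. \<mu>))"
    unfolding P.product_integral_insert[OF insert(1,2) i1]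
  proof (intro Bochner_Integration.integral_cong refl)
    fix z s
    have "(\<Prod>j\<in>I. w ((z(i := s)) j)) = (\<Prod>j\<in>I. w (z j))" "(\<Sum>j\<in>I. \<xi> ((z(i := s)) j)) = (\<Sum>j\<in>I. \<xi> (z j))"
      using insert(2) by (auto intro!: prod.cong sum.cong)
    then show "(\<Prod>j\<in>insert i I. w ((z(i := s)) j)) * f (x + (\<Sum>j\<in>insert i I. \<xi> ((z(i := s)) j))) = ?h s z"
      using insert(1,2) by (simp add: algebra_simps)
  qed
  \<comment> \<open>The insertion rule puts the new coordinate innermost, but it has to be outermost
    here: its value is the shift seen by all other coordinates.\<close>
  also have "\<dots> = (\<integral>s. (\<integral>z. ?h s z \<partial>PiM I (\<lambda>_. \<mu>)) \<partial>\<mu>)"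
    by (rule PP.Fubini_integral[OF i2])
  also have "\<dots> = (\<integral>s. w s * (walk_op \<mu> w \<xi> ^^ card I) f (x + \<xi> s) \<partial>\<mu>)"
    by (simp add: insert.IH)
  also have "\<dots> = (walk_op \<mu> w \<xi> ^^ card (insert i I)) f x"
    using insert(1,2) by (simp add: walk_op_def[of _ _ _ _ x])
  finally show ?case .
qed

section \<open>Exponential moments of the normal law and the Gaussian walk\<close>

abbreviation "stdN \<equiv> std_normal_distribution"

definition normal_tail :: "real \<Rightarrow> real" where
  "normal_tail a = measure stdN {a<..}"

lemma prob_space_std_normal: "prob_space stdN"
  by (rule prob_space_normal_density) simp

lemma std_normal_exp_moment:
  shows "integrable stdN (\<lambda>z. exp (l * z))"
    and "(\<integral>z. exp (l * z) \<partial>stdN) = exp (l\<^sup>2 / 2)"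
proof -
  have eq: "std_normal_density z * exp (l * z) = exp (l\<^sup>2 / 2) * normal_density l 1 z" for z
  proof -
    have "- z\<^sup>2 / 2 + l * z = l\<^sup>2 / 2 + - (z - l)\<^sup>2 / 2" by (simp add: power2_eq_square field_simps)
    then have "exp (- z\<^sup>2 / 2) * exp (l * z) = exp (l\<^sup>2 / 2) * exp (- (z - l)\<^sup>2 / 2)"
      by (simp only: exp_add[symmetric])
    then show ?thesis by (simp add: normal_density_def)
  qed
  show "integrable stdN (\<lambda>z. exp (l * z))"
    by (subst integrable_density) (auto simp: eq)
  show "(\<integral>z. exp (l * z) \<partial>stdN) = exp (l\<^sup>2 / 2)"
    by (subst integral_density) (auto simp: eq)
qed

text \<open>From |z|^3 / 6 \<le> exp |z| the integrand is at most 6 exp(2 |z|) \<le> 6 (exp(2 z) +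
  exp(-2 z)), and each exponential has mean exp 2.\<close>

lemma std_normal_cubic_exp_moment:
  shows "integrable stdN (\<lambda>z. \<bar>z\<bar> ^ 3 * exp \<bar>z\<bar>)"
    and "(\<integral>z. \<bar>z\<bar> ^ 3 * exp \<bar>z\<bar> \<partial>stdN) \<le> 12 * exp 2"
proof -
  let ?g = "\<lambda>z::real. 6 * (exp (2 * z) + exp ((-2) * z))"
  have i: "integrable stdN ?g"
    by (intro integrable_mult_right Bochner_Integration.integrable_add std_normal_exp_moment)
  have le: "\<bar>z\<bar> ^ 3 * exp \<bar>z\<bar> \<le> ?g z" for z :: real
  proof -
    obtain t where "exp \<bar>z\<bar> = (\<Sum>m<4. \<bar>z\<bar> ^ m / fact m) + exp t / fact 4 * \<bar>z\<bar> ^ 4"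
      using Maclaurin_exp_le[of "\<bar>z\<bar>" 4] by blast
    moreover have "0 \<le> exp t / fact 4 * \<bar>z\<bar> ^ 4" by simp
    moreover have "(\<Sum>m<4. \<bar>z\<bar> ^ m / fact m) = 1 + \<bar>z\<bar> + \<bar>z\<bar>\<^sup>2 / 2 + \<bar>z\<bar> ^ 3 / 6"
      by (simp add: eval_nat_numeral fact_numeral)
    moreover have "0 \<le> \<bar>z\<bar>" "0 \<le> \<bar>z\<bar>\<^sup>2" by simp_all
    ultimately have "\<bar>z\<bar> ^ 3 / 6 \<le> exp \<bar>z\<bar>" by linarith
    then have "\<bar>z\<bar> ^ 3 * exp \<bar>z\<bar> \<le> 6 * exp \<bar>z\<bar> * exp \<bar>z\<bar>" by (intro mult_right_mono) auto
    also have "\<dots> = 6 * exp (2 * \<bar>z\<bar>)" by (simp add: exp_add[symmetric])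
    also have "\<dots> \<le> ?g z" by (cases "0 \<le> z") auto
    finally show ?thesis .
  qed
  show 1: "integrable stdN (\<lambda>z. \<bar>z\<bar> ^ 3 * exp \<bar>z\<bar>)"
    by (rule integrable_of_abs_le[OF i]) (use le in \<open>auto simp: abs_mult\<close>)
  have "(\<integral>z. \<bar>z\<bar> ^ 3 * exp \<bar>z\<bar> \<partial>stdN) \<le> (\<integral>z. ?g z \<partial>stdN)"
    by (intro integral_mono 1 i le)
  also have "\<dots> = 12 * exp 2"
    using std_normal_exp_moment[of 2] std_normal_exp_moment[of "-2"] by simp
  finally show "(\<integral>z. \<bar>z\<bar> ^ 3 * exp \<bar>z\<bar> \<partial>stdN) \<le> 12 * exp 2" .
qed

text \<open>The first three moment defects vanish. The condition \<open>l \<le> sqrt m\<close>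
  reduces the exponential factor of the third moment to \<open>exp \<bar>z\<bar>\<close>, whatever
  \<open>m\<close> is.\<close>

lemma walk_step_normal:
  assumes m: "0 < m" and l: "0 \<le> l" "l \<le> sqrt (real m)" and r: "12 * exp 2 / sqrt (real m) ^ 3 \<le> r"
  shows "walk_step stdN (\<lambda>_. 1) (\<lambda>z. z / sqrt (real m)) l (1 / real m) r"
proof -
  interpret prob_space stdN by (rule prob_space_std_normal)
  let ?N = stdN
  have le: "\<bar>z / sqrt m\<bar> ^ 3 * exp (l * \<bar>z / sqrt m\<bar>) \<le> 1 / sqrt m ^ 3 * (\<bar>z\<bar> ^ 3 * exp \<bar>z\<bar>)" for z :: real
  proof -
    have "l * \<bar>z / sqrt m\<bar> = l / sqrt m * \<bar>z\<bar>" by simp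
    also have "\<dots> \<le> 1 * \<bar>z\<bar>" using l m by (intro mult_right_mono) auto
    finally show ?thesis by (simp add: power_divide divide_right_mono mult_left_mono)
  qed
  have i: "integrable ?N (\<lambda>z. 1 / sqrt m ^ 3 * (\<bar>z\<bar> ^ 3 * exp \<bar>z\<bar>))"
    by (intro integrable_mult_right std_normal_cubic_exp_moment)
  have i3: "integrable ?N (\<lambda>z. \<bar>z / sqrt m\<bar> ^ 3 * exp (l * \<bar>z / sqrt m\<bar>))"
    by (rule integrable_of_abs_le[OF i]) (use le in \<open>simp_all add: abs_mult power_abs\<close>)
  have "(\<integral>z. \<bar>z / sqrt m\<bar> ^ 3 * exp (l * \<bar>z / sqrt m\<bar>) \<partial>?N) \<le> (\<integral>z. 1 / sqrt m ^ 3 * (\<bar>z\<bar> ^ 3 * exp \<bar>z\<bar>) \<partial>?N)"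
    by (intro integral_mono i3 i le)
  also have "\<dots> \<le> 1 / sqrt m ^ 3 * (12 * exp 2)"
    unfolding Bochner_Integration.integral_mult_right_zero
    by (intro mult_left_mono std_normal_cubic_exp_moment) auto
  also have "\<dots> \<le> r" using r by simp
  finally have m3: "(\<integral>z. \<bar>z / sqrt m\<bar> ^ 3 * exp (l * \<bar>z / sqrt m\<bar>) \<partial>?N) \<le> r" .
  have r0: "0 \<le> r" using r by (rule order_trans[rotated]) auto
  have q: "integrable ?N (\<lambda>z. z)" "(\<integral>z. z \<partial>?N) = 0" "integrable ?N (\<lambda>z. z\<^sup>2)" "(\<integral>z. z\<^sup>2 \<partial>?N) = 1"
    using integrable_std_normal_distribution_moment[of 1] integral_std_normal_distribution_moment_odd[of 1]
      integrable_std_normal_distribution_moment[of 2] std_normal_distribution_even_moments(1)[of 1]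
    by (simp_all add: fact_numeral)
  show ?thesis
  proof unfold_locales
    show "integrable ?N (\<lambda>z. 1 * (\<bar>z / sqrt m\<bar> ^ 3 * exp (l * \<bar>z / sqrt m\<bar>)))" using i3 by simp
    show "(\<integral>z. 1 * (\<bar>z / sqrt m\<bar> ^ 3 * exp (l * \<bar>z / sqrt m\<bar>)) \<partial>?N) \<le> r" using m3 by simp
    show "\<bar>(\<integral>z. 1 \<partial>?N) - 1\<bar> \<le> r" using r0 prob_space by simp
    show "integrable ?N (\<lambda>z. 1 * (z / sqrt m))" "\<bar>\<integral>z. 1 * (z / sqrt m) \<partial>?N\<bar> \<le> r"
      using q(1) r0 by (simp_all add: q(2))
    have e: "1 * (z / sqrt m)\<^sup>2 = z\<^sup>2 / m" for z :: real by (simp add: power_divide)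
    show "integrable ?N (\<lambda>z. 1 * (z / sqrt m)\<^sup>2)" "\<bar>(\<integral>z. 1 * (z / sqrt m)\<^sup>2 \<partial>?N) - 1 / m\<bar> \<le> r"
      unfolding e using q(3) r0 by (simp_all add: q(4))
    show "integrable ?N (\<lambda>_. 1::real)" by (rule integrable_const)
    show "(\<lambda>_. 1::real) \<in> borel_measurable ?N" "(\<lambda>z. z / sqrt m) \<in> borel_measurable ?N" by measurable
  qed (use l in auto)
qed

text \<open>Normal laws are stable under convolution: \<open>m\<close> independent steps of variance
  \<open>1 / m\<close> add up to the standard normal law exactly, so this side of the comparison has
  no error.\<close>

lemma walk_pow_normal:
  assumes m: "0 < m" and [measurable]: "f \<in> borel_measurable borel" and f: "\<And>x. \<bar>f x\<bar> \<le> D"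
  shows "(walk_op stdN (\<lambda>_. 1) (\<lambda>z. z / sqrt (real m)) ^^ m) f 0 = (\<integral>z. f z \<partial>stdN)"
proof -
  interpret N: prob_space stdN by (rule prob_space_std_normal)
  interpret P: product_prob_space "\<lambda>_::nat. stdN" by unfold_locales
  let ?P = "PiM {..<m} (\<lambda>_. stdN)"
  interpret PM: prob_space ?P by (intro prob_space_PiM) unfold_locales
  have s: "0 < 1 / sqrt (real m)" using m by simp
  have comp: "distr ?P stdN (\<lambda>z. z i) = stdN" if "i \<in> {..<m}" for i
    using that by (intro distr_PiM_component prob_space_std_normal) auto
  have ind: "PM.indep_vars (\<lambda>_. stdN) (\<lambda>i z. z i) {..<m}"
  proof -
    have "distr ?P ?P (\<lambda>z. \<lambda>i\<in>{..<m}. z i) = distr ?P ?P (\<lambda>z. z)"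
      by (intro distr_cong) (auto simp: space_PiM)
    also have "\<dots> = (\<Pi>\<^sub>M i\<in>{..<m}. distr ?P stdN (\<lambda>z. z i))"
      unfolding distr_id by (intro PiM_cong refl) (simp only: comp)
    finally show ?thesis using m by (subst PM.indep_vars_iff_distr_eq_PiM') auto
  qed
  have ind2: "PM.indep_vars (\<lambda>_. borel) (\<lambda>i z. z i / sqrt (real m)) {..<m}"
    by (rule PM.indep_vars_compose2[OF ind]) simp
  have d: "distributed ?P lborel (\<lambda>z. z i / sqrt (real m)) (normal_density 0 (1 / sqrt (real m)))" if "i \<in> {..<m}" for i
  proof -
    have "distributed ?P lborel (\<lambda>z. z i) (normal_density 0 1)"
      unfolding distributed_def
    proof safe
      have "distr ?P lborel (\<lambda>z. z i) = distr ?P stdN (\<lambda>z. z i)"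
        by (rule distr_cong) auto
      also have "\<dots> = stdN" using that by (rule comp)
      finally show "distr ?P lborel (\<lambda>z. z i) = stdN" .
      have "(\<lambda>z. z i) \<in> measurable ?P stdN" using that by measurable
      then show "(\<lambda>z. z i) \<in> measurable ?P lborel" by simp
    qed auto
    from PM.normal_density_affine[OF this, of "1 / sqrt (real m)" 0] show ?thesis using m by simp
  qed
  have "distributed ?P lborel (\<lambda>z. \<Sum>i\<in>{..<m}. z i / sqrt (real m)) (normal_density (\<Sum>i\<in>{..<m}. 0) (sqrt (\<Sum>i\<in>{..<m}. (1 / sqrt (real m))\<^sup>2)))"
  proof (rule PM.sum_indep_normal)
    show "{..<m} \<noteq> {}" using m by auto
  qed (fact ind2 s d | simp)+
  then have "distributed ?P lborel (\<lambda>z. \<Sum>i\<in>{..<m}. z i / sqrt (real m)) std_normal_density"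
    using m by (simp add: power_divide)
  then have "(\<integral>z. f (\<Sum>i\<in>{..<m}. z i / sqrt (real m)) \<partial>?P) = (\<integral>z. std_normal_density z * f z \<partial>lborel)"
    using distributed_integral[where f=std_normal_density and g=f] by force
  also have "\<dots> = (\<integral>z. f z \<partial>stdN)" by (subst integral_density) auto
  finally have eq: "(\<integral>z. f (\<Sum>i\<in>{..<m}. z i / sqrt (real m)) \<partial>?P) = (\<integral>z. f z \<partial>stdN)" .
  have "(\<integral>z. (\<Prod>i\<in>{..<m}. 1) * f (0 + (\<Sum>i\<in>{..<m}. z i / sqrt (real m))) \<partial>?P)
      = (walk_op stdN (\<lambda>_. 1) (\<lambda>z. z / sqrt (real m)) ^^ card {..<m}) f 0"
    by (rule prod_sum_PiM_eq_walk_pow[OF prob_space_std_normal, where C=1 and D=D]) (use f in auto)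
  then show ?thesis unfolding eq[symmetric] by simp
qed

section \<open>Tails of truncated sums\<close>

text \<open>The integrated cubic B-spline: a twice differentiable transition from 0 to 1 on \<open>[0, 3]\<close>
  with Lipschitz second derivative; \<open>ramp1\<close> and \<open>ramp2\<close> are its derivatives.\<close>

definition ramp :: "real \<Rightarrow> real" where
  "ramp u = (max 0 u ^ 3 - 3 * max 0 (u - 1) ^ 3 + 3 * max 0 (u - 2) ^ 3 - max 0 (u - 3) ^ 3) / 6"

definition ramp1 :: "real \<Rightarrow> real" where
  "ramp1 u = ((max 0 u)\<^sup>2 - 3 * (max 0 (u - 1))\<^sup>2 + 3 * (max 0 (u - 2))\<^sup>2 - (max 0 (u - 3))\<^sup>2) / 2"

definition ramp2 :: "real \<Rightarrow> real" where
  "ramp2 u = max 0 u - 3 * max 0 (u - 1) + 3 * max 0 (u - 2) - max 0 (u - 3)"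

text \<open>The cube of the positive part has second derivative 6 max(0, u), with Lipschitz constant
  6, hence remainder at most 6 |y|^3 / 6. The case distinction on the signs replaces
  calculus.\<close>

lemma trunc_cube_taylor:
  fixes u y :: real
  shows "\<bar>max 0 (u + y) ^ 3 - max 0 u ^ 3 - 3 * (max 0 u)\<^sup>2 * y - 3 * max 0 u * y\<^sup>2\<bar> \<le> \<bar>y\<bar> ^ 3"
proof (cases "0 \<le> u")
  case u: True
  show ?thesis
  proof (cases "0 \<le> u + y")
    case True
    then have "max 0 (u + y) ^ 3 - max 0 u ^ 3 - 3 * (max 0 u)\<^sup>2 * y - 3 * max 0 u * y\<^sup>2 = y ^ 3"
      using u by (simp add: power2_eq_square power3_eq_cube algebra_simps)
    then show ?thesis by (simp add: power_abs)
  next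
    case False
    then have "max 0 (u + y) ^ 3 - max 0 u ^ 3 - 3 * (max 0 u)\<^sup>2 * y - 3 * max 0 u * y\<^sup>2 = (- (u + y)) ^ 3 - (- y) ^ 3"
      using u by (simp add: power2_eq_square power3_eq_cube algebra_simps)
    moreover have "0 \<le> (- (u + y)) ^ 3" by (rule zero_le_power) (use False in simp)
    moreover have "(- (u + y)) ^ 3 \<le> (- y) ^ 3" by (rule power_mono) (use u False in simp_all)
    ultimately show ?thesis using u False by (simp add: power_abs[symmetric])
  qed
next
  case u: False
  show ?thesis
  proof (cases "0 \<le> u + y")
    case True
    have "(u + y) ^ 3 \<le> y ^ 3" using u True by (intro power_mono) auto
    then show ?thesis using u True by (simp add: power_abs)
  qed (use u in simp)
qed

text \<open>The coefficients 1, 3, 3, 1 of the four truncated cubes have absolute sum 8, and 8 / 6 =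
  4 / 3.\<close>

lemma ramp_taylor:
  "\<bar>ramp (u + y) - ramp u - ramp1 u * y - ramp2 u * y\<^sup>2 / 2\<bar> \<le> 4 / 3 * \<bar>y\<bar> ^ 3"
proof -
  let ?R = "\<lambda>u. max 0 (u + y) ^ 3 - max 0 u ^ 3 - 3 * (max 0 u)\<^sup>2 * y - 3 * max 0 u * y\<^sup>2"
  have id: "(a0 - 3 * a1 + 3 * a2 - a3) / 6 - (c0 - 3 * c1 + 3 * c2 - c3) / 6
      - (d0 - 3 * d1 + 3 * d2 - d3) / 2 * y - (e0 - 3 * e1 + 3 * e2 - e3) * z / 2
    = ((a0 - c0 - 3 * d0 * y - 3 * e0 * z) - 3 * (a1 - c1 - 3 * d1 * y - 3 * e1 * z)
      + 3 * (a2 - c2 - 3 * d2 * y - 3 * e2 * z) - (a3 - c3 - 3 * d3 * y - 3 * e3 * z)) / 6"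
    for a0 a1 a2 a3 c0 c1 c2 c3 d0 d1 d2 d3 e0 e1 e2 e3 z :: real
    by (simp add: field_simps)
  have sh: "u + y - 1 = u - 1 + y" "u + y - 2 = u - 2 + y" "u + y - 3 = u - 3 + y" by simp_all
  have eq: "ramp (u + y) - ramp u - ramp1 u * y - ramp2 u * y\<^sup>2 / 2
      = (?R u - 3 * ?R (u - 1) + 3 * ?R (u - 2) - ?R (u - 3)) / 6"
    unfolding ramp_def ramp1_def ramp2_def sh by (rule id)
  have le: "\<bar>(r0 - 3 * r1 + 3 * r2 - r3) / 6\<bar> \<le> 4 / 3 * z"
    if "\<bar>r0\<bar> \<le> z" "\<bar>r1\<bar> \<le> z" "\<bar>r2\<bar> \<le> z" "\<bar>r3\<bar> \<le> z" for r0 r1 r2 r3 z :: real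
    using that by (auto simp: abs_le_iff field_simps)
  show ?thesis unfolding eq by (intro le trunc_cube_taylor)
qed

lemma ramp_left: "u \<le> 0 \<Longrightarrow> ramp u = 0" "u \<le> 0 \<Longrightarrow> ramp1 u = 0" "u \<le> 0 \<Longrightarrow> ramp2 u = 0"
  by (simp_all add: ramp_def ramp1_def ramp2_def)

lemma ramp_right: "3 \<le> u \<Longrightarrow> ramp u = 1" "3 \<le> u \<Longrightarrow> ramp1 u = 0" "3 \<le> u \<Longrightarrow> ramp2 u = 0"
  by (simp_all add: ramp_def ramp1_def ramp2_def power2_eq_square power3_eq_cube algebra_simps)

lemma ramp_bounds: "0 \<le> ramp u" "ramp u \<le> 1"
proof -
  consider "u \<le> 0" | "0 \<le> u" "u \<le> 1" | "1 \<le> u" "u \<le> 2" | "2 \<le> u" "u \<le> 3" | "3 \<le> u" by linarith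
  then have "0 \<le> ramp u \<and> ramp u \<le> 1"
  proof cases
    case 2
    then have "u ^ 3 \<le> 1" "0 \<le> u ^ 3" by (auto intro!: power_le_one zero_le_power)
    then show ?thesis using 2 by (simp add: ramp_def)
  next
    case 3
    define s where "s = u - 1"
    have s: "0 \<le> s" "s \<le> 1" "u = s + 1" using 3 by (auto simp: s_def)
    have eq: "ramp u = (1 + 3 * s + 3 * s\<^sup>2 - 2 * s ^ 3) / 6"
      using s by (simp add: ramp_def power2_eq_square power3_eq_cube algebra_simps)
    have "0 \<le> (1 - s)\<^sup>2 * (1 + 2 * s)" using s by simp
    then have 1: "3 * s\<^sup>2 - 2 * s ^ 3 \<le> 1" by (simp add: power2_eq_square power3_eq_cube algebra_simps)
    have "0 \<le> s\<^sup>2 * (3 - 2 * s)" using s by simp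
    then have 2: "0 \<le> 3 * s\<^sup>2 - 2 * s ^ 3" by (simp add: power2_eq_square power3_eq_cube algebra_simps)
    show ?thesis unfolding eq using 1 2 s by simp
  next
    case 4
    have eq: "ramp u = 1 - (3 - u) ^ 3 / 6"
      using 4 by (simp add: ramp_def power2_eq_square power3_eq_cube field_simps)
    have "(3 - u) ^ 3 \<le> 1" "0 \<le> (3 - u) ^ 3" using 4 by (auto intro!: power_le_one zero_le_power)
    then show ?thesis unfolding eq by simp
  qed (simp_all add: ramp_left ramp_right)
  then show "0 \<le> ramp u" "ramp u \<le> 1" by auto
qed

lemma ramp_derivative_bounds: "\<bar>ramp1 u\<bar> \<le> 12" "\<bar>ramp2 u\<bar> \<le> 12"
proof -
  have "\<bar>ramp1 u\<bar> \<le> 12 \<and> \<bar>ramp2 u\<bar> \<le> 12"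
  proof (cases "0 \<le> u \<and> u \<le> 3")
    case True
    then have b: "0 \<le> max 0 u" "max 0 u \<le> 3" "0 \<le> max 0 (u - 1)" "max 0 (u - 1) \<le> 2"
      "0 \<le> max 0 (u - 2)" "max 0 (u - 2) \<le> 1" "max 0 (u - 3) = 0" by auto
    have "(max 0 u)\<^sup>2 \<le> 9" "(max 0 (u - 1))\<^sup>2 \<le> 4" "(max 0 (u - 2))\<^sup>2 \<le> 1"
      using power_mono[OF b(2,1), of 2] power_mono[OF b(4,3), of 2] power_mono[OF b(6,5), of 2] by simp_all
    moreover have "0 \<le> (max 0 u)\<^sup>2" "0 \<le> (max 0 (u - 1))\<^sup>2" "0 \<le> (max 0 (u - 2))\<^sup>2" by simp_all
    moreover have "ramp1 u = ((max 0 u)\<^sup>2 - 3 * (max 0 (u - 1))\<^sup>2 + 3 * (max 0 (u - 2))\<^sup>2) / 2"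
      "ramp2 u = max 0 u - 3 * max 0 (u - 1) + 3 * max 0 (u - 2)"
      unfolding ramp1_def ramp2_def b(7) by simp_all
    moreover have "\<bar>(p - 3 * q + 3 * t) / 2\<bar> \<le> 12" if "0 \<le> p" "p \<le> 9" "0 \<le> q" "q \<le> 4" "0 \<le> t" "t \<le> 1" for p q t :: real
      using that by (auto simp: abs_le_iff field_simps)
    moreover have "\<bar>p - 3 * q + 3 * t\<bar> \<le> 12" if "0 \<le> p" "p \<le> 3" "0 \<le> q" "q \<le> 2" "0 \<le> t" "t \<le> 1" for p q t :: real
      using that by (auto simp: abs_le_iff field_simps)
    ultimately show ?thesis using b(1-6) by metis
  next
    case False
    then consider "u \<le> 0" | "3 \<le> u" by linarith
    then show ?thesis by cases (simp_all add: ramp_left ramp_right)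
  qed
  then show "\<bar>ramp1 u\<bar> \<le> 12" "\<bar>ramp2 u\<bar> \<le> 12" by auto
qed

lemma ramp_measurable [measurable]:
  "ramp \<in> borel_measurable borel" "ramp1 \<in> borel_measurable borel" "ramp2 \<in> borel_measurable borel"
  unfolding ramp_def[abs_def] ramp1_def[abs_def] ramp2_def[abs_def] by measurable

text \<open>A bounded function that vanishes to the left of \<open>a\<close> is dominated by a
  multiple of exp(l (x - a)); this is the source of the decisive factor
  \<open>exp (- l * a)\<close>. Third order smoothness at scale \<open>1 / k\<close> costs
  \<open>k ^ 3\<close>, and 12 covers all numerical constants.\<close>

lemma exp_smooth_ramp:
  assumes k: "1 \<le> k" and l: "0 \<le> l"
  shows "exp_smooth l (12 * k ^ 3 * exp (- l * a)) (\<lambda>x. ramp (k * (x - a)))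
     (\<lambda>x. k * ramp1 (k * (x - a))) (\<lambda>x. k\<^sup>2 * ramp2 (k * (x - a)))"
proof -
  have k3: "k \<le> k ^ 3" "k\<^sup>2 \<le> k ^ 3" "1 \<le> k ^ 3"
    using k by (auto intro!: power_increasing[of 1 3 k, simplified] power_increasing one_le_power)
  have E: "12 * k ^ 3 * exp (- l * a) * exp (l * x) = 12 * k ^ 3 * exp (l * (x - a))" for x
    by (simp add: exp_add[symmetric] algebra_simps)
  have B: "12 * k ^ 3 \<le> 12 * k ^ 3 * exp (l * (x - a))" if "a \<le> x" for x
    using that l k by simp
  have dom: "\<bar>h (k * (x - a))\<bar> \<le> 12 * k ^ 3 * exp (l * (x - a))"
    if "\<And>u. u \<le> 0 \<Longrightarrow> h u = 0" "\<And>u. \<bar>h u\<bar> \<le> 12 * k ^ 3" for h :: "real \<Rightarrow> real" and x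
  proof (cases "a \<le> x")
    case True
    then show ?thesis using that(2)[of "k * (x - a)"] B[OF True] by linarith
  next
    case False
    then have "k * (x - a) \<le> 0" using k by (simp add: mult_nonneg_nonpos)
    then show ?thesis using that(1) k by simp
  qed
  have d0: "\<bar>ramp (k * (x - a))\<bar> \<le> 12 * k ^ 3 * exp (l * (x - a))" for x
    by (rule dom) (use ramp_left ramp_bounds k3 in \<open>auto intro: order_trans[of _ 1]\<close>)
  have d1: "\<bar>k * ramp1 (k * (x - a))\<bar> \<le> 12 * k ^ 3 * exp (l * (x - a))" for x
  proof (rule dom[where h="\<lambda>u. k * ramp1 u"])
    fix u show "\<bar>k * ramp1 u\<bar> \<le> 12 * k ^ 3"
      using mult_mono[OF k3(1) ramp_derivative_bounds(1)[of u]] k by (simp add: abs_mult mult.commute)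
  qed (simp add: ramp_left)
  have d2: "\<bar>k\<^sup>2 * ramp2 (k * (x - a))\<bar> \<le> 12 * k ^ 3 * exp (l * (x - a))" for x
  proof (rule dom[where h="\<lambda>u. k\<^sup>2 * ramp2 u"])
    fix u show "\<bar>k\<^sup>2 * ramp2 u\<bar> \<le> 12 * k ^ 3"
      using mult_mono[OF k3(2) ramp_derivative_bounds(2)[of u]] k by (simp add: abs_mult mult.commute)
  qed (simp add: ramp_left)
  have rem: "\<bar>ramp (k * (x + y - a)) - ramp (k * (x - a)) - k * ramp1 (k * (x - a)) * y - k\<^sup>2 * ramp2 (k * (x - a)) * y\<^sup>2 / 2\<bar>
      \<le> 12 * k ^ 3 * exp (l * (x - a)) * (\<bar>y\<bar> ^ 3 * exp (l * \<bar>y\<bar>))" (is "\<bar>?lhs\<bar> \<le> _") for x y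
  proof (cases "x \<le> a \<and> x + y \<le> a")
    case True
    then have "k * (x - a) \<le> 0" "k * (x + y - a) \<le> 0" using k by (auto simp: mult_nonneg_nonpos)
    then show ?thesis using k by (simp add: ramp_left)
  next
    case False
    \<comment> \<open>At least one of \<open>x\<close> and \<open>x + y\<close> is to the right of
      \<open>a\<close>, so \<open>x - a + \<bar>y\<bar>\<close> is nonnegative: the factor
      \<open>exp (l * \<bar>y\<bar>)\<close> makes up for an \<open>x\<close> to the left of
      \<open>a\<close>.\<close>
    then have "0 \<le> l * (x - a + \<bar>y\<bar>)" using l by (intro mult_nonneg_nonneg) auto
    then have e: "1 \<le> exp (l * (x - a)) * exp (l * \<bar>y\<bar>)" by (simp add: exp_add[symmetric] algebra_simps)
    have lhs: "?lhs = ramp (k * (x - a) + k * y) - ramp (k * (x - a)) - ramp1 (k * (x - a)) * (k * y) - ramp2 (k * (x - a)) * (k * y)\<^sup>2 / 2"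
      by (simp add: algebra_simps power_mult_distrib)
    have "\<bar>?lhs\<bar> \<le> 4 / 3 * \<bar>k * y\<bar> ^ 3" unfolding lhs by (rule ramp_taylor)
    also have "\<dots> \<le> 12 * k ^ 3 * \<bar>y\<bar> ^ 3 * 1"
      using k by (simp add: abs_mult power_mult_distrib)
    also have "\<dots> \<le> 12 * k ^ 3 * \<bar>y\<bar> ^ 3 * (exp (l * (x - a)) * exp (l * \<bar>y\<bar>))"
      using e k by (intro mult_left_mono) auto
    finally show ?thesis by (simp add: algebra_simps)
  qed
  show ?thesis unfolding exp_smooth_def exp_dominated_def E using d0 d1 d2 rem by simp
qed

text \<open>The ramp climbs from 0 at \<open>a\<close> to 1 at \<open>a + \<eta>\<close>. Below the
  indicator of the points beyond \<open>a\<close>, it has Gaussian mean at most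
  \<open>normal_tail a\<close>; being 1 from \<open>a + \<eta>\<close> on, it will dominate the tail
  of the sum. The constant 96 is 8 from \<open>lindeberg_walk\<close> times 12 from
  \<open>exp_smooth_ramp\<close>.\<close>

lemma walk_tail:
  assumes s: "walk_step \<mu> w \<xi> l (1 / real m) r" and m: "0 < m"
    and l: "l \<le> sqrt (real m)" and r: "12 * exp 2 / sqrt (real m) ^ 3 \<le> r" and \<eta>: "0 < \<eta>" "\<eta> \<le> 3"
  shows "(walk_op \<mu> w \<xi> ^^ m) (\<lambda>x. ramp (3 / \<eta> * (x - a))) 0
     \<le> normal_tail a + real m * r * (96 * (3 / \<eta>) ^ 3) * exp (l\<^sup>2 / 2 - l * a + real m * r * (1 + l) ^ 3)"
proof -
  interpret walk_step \<mu> w \<xi> l "1 / real m" r by (rule s)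
  interpret N: prob_space stdN by (rule prob_space_std_normal)
  let ?f = "\<lambda>x. ramp (3 / \<eta> * (x - a))"
  let ?A = "12 * (3 / \<eta>) ^ 3 * exp (- l * a)"
  have k: "1 \<le> 3 / \<eta>" using \<eta> by simp
  have "(walk_op stdN (\<lambda>_. 1) (\<lambda>z. z / sqrt (real m)) ^^ m) ?f 0 = (\<integral>z. ?f z \<partial>stdN)"
    by (rule walk_pow_normal[OF m, where D=1]) (use ramp_bounds in auto)
  also have "\<dots> \<le> (\<integral>z. indicator {a<..} z \<partial>stdN)"
  proof (rule integral_mono)
    show "integrable stdN ?f"
      by (rule N.integrable_const_bound[where B=1]) (use ramp_bounds in auto)
    show "integrable stdN (indicator {a<..} :: real \<Rightarrow> real)"
      by (rule N.integrable_const_bound[where B=1]) auto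
    fix z
    show "?f z \<le> indicator {a<..} z"
    proof (cases "a < z")
      case False
      then have "3 / \<eta> * (z - a) \<le> 0" using \<eta> by (intro mult_nonneg_nonpos) auto
      then show ?thesis using False ramp_left by simp
    qed (use ramp_bounds in simp)
  qed
  also have "\<dots> = normal_tail a" by (simp add: normal_tail_def)
  finally have 1: "(walk_op stdN (\<lambda>_. 1) (\<lambda>z. z / sqrt (real m)) ^^ m) ?f 0 \<le> normal_tail a" .
  have "\<bar>(T ^^ m) ?f 0 - (walk_op stdN (\<lambda>_. 1) (\<lambda>z. z / sqrt (real m)) ^^ m) ?f 0\<bar>
      \<le> real m * (8 * r * ?A) * exp (l\<^sup>2 * (1 / real m) / 2 + r * (1 + l) ^ 3) ^ m * exp (l * 0)"
    by (rule lindeberg_walk[OF s walk_step_normal[OF m l_nonneg l r] exp_smooth_ramp[OF k l_nonneg]])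
  also have "exp (l\<^sup>2 * (1 / real m) / 2 + r * (1 + l) ^ 3) ^ m = exp (l\<^sup>2 / 2 + real m * r * (1 + l) ^ 3)"
    using m by (simp add: exp_of_nat_mult[symmetric] field_simps)
  also have "real m * (8 * r * ?A) * exp (l\<^sup>2 / 2 + real m * r * (1 + l) ^ 3) * exp (l * 0)
     = real m * r * (96 * (3 / \<eta>) ^ 3) * (exp (- l * a) * exp (l\<^sup>2 / 2 + real m * r * (1 + l) ^ 3))"
    by simp
  also have "exp (- l * a) * exp (l\<^sup>2 / 2 + real m * r * (1 + l) ^ 3) = exp (l\<^sup>2 / 2 - l * a + real m * r * (1 + l) ^ 3)"
    by (simp add: exp_add[symmetric] algebra_simps)
  finally show ?thesis using 1 by linarith
qed

text \<open>On the event all weights equal \<open>1 / P\<close>, so their product is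
  \<open>P ^ (- m)\<close> in effect. Undoing this normalization leaves \<open>P ^ m\<close>, the
  probability that all points fall into the cell, in front of an almost Gaussian conditional
  tail.\<close>

lemma block_tail:
  assumes s: "walk_step \<mu> (\<lambda>s. indicator G s / P) \<xi> l (1 / real m) r" and I: "finite I" "card I = m" and m: "0 < m"
    and G: "G \<in> sets \<mu>" and P: "0 < P"
    and l: "l \<le> sqrt (real m)" and r: "12 * exp 2 / sqrt (real m) ^ 3 \<le> r" and \<eta>: "0 < \<eta>" "\<eta> \<le> 3"
  shows "measure (PiM I (\<lambda>_. \<mu>)) {z \<in> space (PiM I (\<lambda>_. \<mu>)). (\<forall>i\<in>I. z i \<in> G) \<and> a + \<eta> \<le> (\<Sum>i\<in>I. \<xi> (z i))}
     \<le> P ^ m * (normal_tail a + real m * r * (96 * (3 / \<eta>) ^ 3) * exp (l\<^sup>2 / 2 - l * a + real m * r * (1 + l) ^ 3))"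
    (is "measure ?P ?S \<le> _ * ?R")
proof -
  interpret walk_step \<mu> "\<lambda>s. indicator G s / P" \<xi> l "1 / real m" r by (rule s)
  interpret PI: prob_space ?P by (intro prob_space_PiM) unfold_locales
  note [measurable] = G
  let ?f = "\<lambda>x. ramp (3 / \<eta> * (x - a))"
  let ?h = "\<lambda>z. (\<Prod>i\<in>I. indicator G (z i) / P) * ?f (0 + (\<Sum>i\<in>I. \<xi> (z i)))"
  have bnd: "\<bar>indicator G s / P\<bar> \<le> 1 / P" for s using P by (simp add: indicator_def)
  have S: "?S \<in> sets ?P" using I by measurable
  have hb: "\<bar>?h z\<bar> \<le> (1 / P) ^ card I" for z
  proof -
    have "\<bar>\<Prod>i\<in>I. indicator G (z i) / P\<bar> \<le> (\<Prod>i\<in>I. 1 / P)"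
      unfolding abs_prod by (intro prod_mono) (use bnd in auto)
    then have "\<bar>\<Prod>i\<in>I. indicator G (z i) / P\<bar> * \<bar>?f (0 + (\<Sum>i\<in>I. \<xi> (z i)))\<bar> \<le> (1 / P) ^ card I * 1"
      using P ramp_bounds[of "3 / \<eta> * (0 + (\<Sum>i\<in>I. \<xi> (z i)) - a)"] by (intro mult_mono) auto
    then show ?thesis by (simp add: abs_mult)
  qed
  have ih: "integrable ?P ?h"
  proof (rule PI.integrable_const_bound)
    show "AE z in ?P. norm (?h z) \<le> (1 / P) ^ card I" using hb by (intro AE_I2) simp
  qed measurable
  have "measure ?P ?S = (\<integral>z. indicator ?S z \<partial>?P)" using sets.sets_into_space[OF S] by (simp add: Int_absorb2)
  also have "\<dots> \<le> (\<integral>z. P ^ m * ?h z \<partial>?P)"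
  proof (rule integral_mono)
    show "integrable ?P (indicator ?S :: _ \<Rightarrow> real)" by (rule PI.integrable_const_bound[where B=1]) (use S in auto)
    show "integrable ?P (\<lambda>z. P ^ m * ?h z)" by (intro integrable_mult_right ih)
    fix z
    show "indicator ?S z \<le> P ^ m * ?h z"
    proof (cases "z \<in> ?S")
      case True
      then have "(\<Prod>i\<in>I. indicator G (z i) / P) = (1 / P) ^ m" using I by (simp cong: prod.cong)
      moreover have "3 / \<eta> * \<eta> \<le> 3 / \<eta> * (0 + (\<Sum>i\<in>I. \<xi> (z i)) - a)"
        using True \<eta> by (intro mult_left_mono) auto
      then have "?f (0 + (\<Sum>i\<in>I. \<xi> (z i))) = 1" using \<eta> by (intro ramp_right) simp
      ultimately show ?thesis using True P by (simp add: power_divide)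
    next
      case False
      have "0 \<le> ?h z" using P ramp_bounds by (intro mult_nonneg_nonneg prod_nonneg) auto
      then show ?thesis using False P by simp
    qed
  qed
  also have "\<dots> = P ^ m * (T ^^ m) ?f 0"
  proof -
    have "(\<integral>z. ?h z \<partial>?P) = (T ^^ card I) ?f 0"
      by (rule prod_sum_PiM_eq_walk_pow[where C="1 / P" and D=1])
         (use bnd I ramp_bounds prob_space_axioms in \<open>auto simp del: abs_divide\<close>)
    then show ?thesis using I by simp
  qed
  also have "\<dots> \<le> P ^ m * ?R"
    using P by (intro mult_left_mono walk_tail[OF s m l r \<eta>]) auto
  finally show ?thesis .
qed

text \<open>Before truncation, mean and variance on the cell are exact. Where |y| > b, with b \<le>
  1, a power |y|^j with j \<le> 2 is at most |y|^3 / b^3, so truncation changes each of these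
  moments by at most \<rho> / b^3 after division by P. Where |y| \<le> b, the exponential is at most
  \<open>exp 1\<close> because \<open>l * b \<le> 1\<close>. These are the two terms in the bound on
  \<open>r\<close>.\<close>

lemma walk_step_truncated:
  fixes y :: "'a \<Rightarrow> real"
  assumes "prob_space \<mu>" and A [measurable]: "A \<in> sets \<mu>" and y [measurable]: "y \<in> borel_measurable \<mu>"
    and P: "P = measure \<mu> A" "0 < P"
    and i3: "integrable \<mu> (\<lambda>s. \<bar>y s\<bar> ^ 3)"
    and e1: "(\<integral>s. indicator A s * y s \<partial>\<mu>) = 0" and e2: "(\<integral>s. indicator A s * (y s)\<^sup>2 \<partial>\<mu>) = v * P"
    and e3: "(\<integral>s. indicator A s * \<bar>y s\<bar> ^ 3 \<partial>\<mu>) \<le> \<rho> * P"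
    and b: "0 < b" "b \<le> 1" and l: "0 \<le> l" "l * b \<le> 1" and v: "0 \<le> v" and r: "\<rho> * (1 / b ^ 3 + exp 1) \<le> r"
  shows "walk_step \<mu> (\<lambda>s. indicator (A \<inter> {s \<in> space \<mu>. \<bar>y s\<bar> \<le> b}) s / P) y l v r"
proof -
  interpret prob_space \<mu> by fact
  define G where "G = A \<inter> {s \<in> space \<mu>. \<bar>y s\<bar> \<le> b}"
  have G [measurable]: "G \<in> sets \<mu>" unfolding G_def by measurable
  have "0 \<le> (\<integral>s. indicator A s * \<bar>y s\<bar> ^ 3 \<partial>\<mu>)" by (intro integral_nonneg_AE AE_I2) auto
  then have "0 \<le> \<rho> * P" using e3 by linarith
  then have \<rho>: "0 \<le> \<rho>" using P(2) by (simp add: zero_le_mult_iff)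
  have iA3: "integrable \<mu> (\<lambda>s. indicator A s * \<bar>y s\<bar> ^ 3)"
    using integrable_mult_indicator[OF A i3] by simp
  have iG: "integrable \<mu> (\<lambda>s. indicator G s * y s ^ j)" for j
  proof (rule integrable_const_bound)
    show "AE s in \<mu>. norm (indicator G s * y s ^ j) \<le> b ^ j"
      by (intro AE_I2) (use b in \<open>auto simp: G_def indicator_def power_abs intro!: power_mono\<close>)
  qed measurable
  have iA: "integrable \<mu> (\<lambda>s. indicator A s * y s ^ j)" if "j \<le> 2" for j
  proof (rule integrable_of_abs_le)
    show "integrable \<mu> (\<lambda>s. 1 + \<bar>y s\<bar> ^ 3)" using i3 by simp
    fix s show "\<bar>indicator A s * y s ^ j\<bar> \<le> 1 + \<bar>y s\<bar> ^ 3"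
      using abs_power_le_one_plus[of j 3 "y s"] that by (simp add: indicator_def power_abs)
  qed measurable
  have trunc: "\<bar>(\<integral>s. indicator G s * y s ^ j \<partial>\<mu>) - (\<integral>s. indicator A s * y s ^ j \<partial>\<mu>)\<bar> \<le> \<rho> * P / b ^ 3" if j: "j \<le> 2" for j
  proof -
    have "(\<integral>s. indicator G s * y s ^ j \<partial>\<mu>) - (\<integral>s. indicator A s * y s ^ j \<partial>\<mu>)
        = (\<integral>s. indicator G s * y s ^ j - indicator A s * y s ^ j \<partial>\<mu>)"
      by (rule Bochner_Integration.integral_diff[symmetric, OF iG iA[OF j]])
    also have "\<bar>\<dots>\<bar> \<le> (\<integral>s. \<bar>indicator G s * y s ^ j - indicator A s * y s ^ j\<bar> \<partial>\<mu>)" by (rule integral_abs_bound)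
    also have "\<dots> \<le> (\<integral>s. (1 / b ^ 3) * (indicator A s * \<bar>y s\<bar> ^ 3) \<partial>\<mu>)"
    proof (rule integral_mono)
      show "integrable \<mu> (\<lambda>s. \<bar>indicator G s * y s ^ j - indicator A s * y s ^ j\<bar>)"
        by (intro integrable_abs Bochner_Integration.integrable_diff iG iA j)
      show "integrable \<mu> (\<lambda>s. (1 / b ^ 3) * (indicator A s * \<bar>y s\<bar> ^ 3))" by (intro integrable_mult_right iA3)
      fix s assume s: "s \<in> space \<mu>"
      show "\<bar>indicator G s * y s ^ j - indicator A s * y s ^ j\<bar> \<le> (1 / b ^ 3) * (indicator A s * \<bar>y s\<bar> ^ 3)"
      proof (cases "s \<in> A \<and> \<not> \<bar>y s\<bar> \<le> b")
        case True
        have "b ^ 3 \<le> b ^ (3 - j)" using b by (intro power_decreasing) auto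
        also have "\<dots> \<le> \<bar>y s\<bar> ^ (3 - j)" using True b by (intro power_mono) auto
        finally have "\<bar>y s\<bar> ^ j * b ^ 3 \<le> \<bar>y s\<bar> ^ j * \<bar>y s\<bar> ^ (3 - j)" by (intro mult_left_mono) auto
        also have "\<dots> = \<bar>y s\<bar> ^ 3" using j by (simp add: power_add[symmetric])
        finally have "\<bar>y s\<bar> ^ j \<le> \<bar>y s\<bar> ^ 3 / b ^ 3" using b by (simp add: pos_le_divide_eq)
        then show ?thesis using True by (simp add: G_def power_abs)
      next
        case False
        then have "(indicator G s :: real) = indicator A s" using s by (auto simp: G_def indicator_def)
        then show ?thesis using b by simp
      qed
    qed
    also have "\<dots> = (1 / b ^ 3) * (\<integral>s. indicator A s * \<bar>y s\<bar> ^ 3 \<partial>\<mu>)" by simp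
    also have "\<dots> \<le> (1 / b ^ 3) * (\<rho> * P)" using b e3 by (intro mult_left_mono) auto
    finally show ?thesis by simp
  qed
  have r1: "\<rho> / b ^ 3 \<le> r" "\<rho> * exp 1 \<le> r"
  proof -
    have "\<rho> * (1 / b ^ 3 + exp 1) = \<rho> / b ^ 3 + \<rho> * exp 1" by (simp add: algebra_simps)
    moreover have "0 \<le> \<rho> / b ^ 3" "0 \<le> \<rho> * exp 1" using \<rho> b by auto
    ultimately show "\<rho> / b ^ 3 \<le> r" "\<rho> * exp 1 \<le> r" using r by linarith+
  qed
  have tr: "\<bar>(\<integral>s. indicator G s * y s ^ j \<partial>\<mu>) / P - (\<integral>s. indicator A s * y s ^ j \<partial>\<mu>) / P\<bar> \<le> r" if "j \<le> 2" for j
  proof -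
    have "\<bar>(\<integral>s. indicator G s * y s ^ j \<partial>\<mu>) / P - (\<integral>s. indicator A s * y s ^ j \<partial>\<mu>) / P\<bar>
       = \<bar>(\<integral>s. indicator G s * y s ^ j \<partial>\<mu>) - (\<integral>s. indicator A s * y s ^ j \<partial>\<mu>)\<bar> / P"
      using P by (simp add: diff_divide_distrib[symmetric])
    also have "\<dots> \<le> (\<rho> * P / b ^ 3) / P" using trunc[OF that] P by (intro divide_right_mono) auto
    also have "\<dots> = \<rho> / b ^ 3" using P by simp
    finally show ?thesis using r1 by linarith
  qed
  have le3: "indicator G s * (\<bar>y s\<bar> ^ 3 * exp (l * \<bar>y s\<bar>)) \<le> exp 1 * (indicator A s * \<bar>y s\<bar> ^ 3)" for s
  proof (cases "s \<in> G")
    case True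
    then have "l * \<bar>y s\<bar> \<le> l * b" using l by (intro mult_left_mono) (auto simp: G_def)
    then have "exp (l * \<bar>y s\<bar>) \<le> exp 1" using l by simp
    then show ?thesis using True mult_left_mono[of "exp (l * \<bar>y s\<bar>)" "exp 1" "\<bar>y s\<bar> ^ 3"]
      by (simp add: G_def mult.commute)
  qed simp
  have iG3: "integrable \<mu> (\<lambda>s. indicator G s * (\<bar>y s\<bar> ^ 3 * exp (l * \<bar>y s\<bar>)))"
    by (rule integrable_of_abs_le[OF integrable_mult_right[OF iA3, of "exp 1"]])
       (use le3 in \<open>simp_all add: abs_mult\<close>)
  have "(\<integral>s. indicator G s * (\<bar>y s\<bar> ^ 3 * exp (l * \<bar>y s\<bar>)) \<partial>\<mu>) \<le> (\<integral>s. exp 1 * (indicator A s * \<bar>y s\<bar> ^ 3) \<partial>\<mu>)"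
    by (intro integral_mono iG3 integrable_mult_right iA3 le3)
  also have "\<dots> = exp 1 * (\<integral>s. indicator A s * \<bar>y s\<bar> ^ 3 \<partial>\<mu>)" by simp
  also have "\<dots> \<le> exp 1 * (\<rho> * P)" by (intro mult_left_mono e3) auto
  also have "\<dots> \<le> r * P" using r1(2) P by (simp add: mult.commute mult_right_mono mult.left_commute)
  finally have m3: "(\<integral>s. indicator G s * (\<bar>y s\<bar> ^ 3 * exp (l * \<bar>y s\<bar>)) \<partial>\<mu>) / P \<le> r"
    using P by (simp add: pos_divide_le_eq)
  have q: "indicator G s / P * z = indicator G s * z / P" for s and z :: real by simp
  have j0: "(\<integral>s. indicator A s * y s ^ 0 \<partial>\<mu>) = P" using P by simp
  show ?thesis unfolding G_def[symmetric]
  proof unfold_locales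
    show "(\<lambda>s. indicator G s / P) \<in> borel_measurable \<mu>" "y \<in> borel_measurable \<mu>" by measurable
    show "0 \<le> indicator G s / P" for s using P by simp
    show "0 \<le> l" "0 \<le> v" by fact+
    show "integrable \<mu> (\<lambda>s. indicator G s / P)" using iG[of 0] by simp
    show "integrable \<mu> (\<lambda>s. indicator G s / P * y s)" unfolding q using iG[of 1] by simp
    show "integrable \<mu> (\<lambda>s. indicator G s / P * (y s)\<^sup>2)" unfolding q using iG[of 2] by simp
    show "integrable \<mu> (\<lambda>s. indicator G s / P * (\<bar>y s\<bar> ^ 3 * exp (l * \<bar>y s\<bar>)))" unfolding q using iG3 by simp
    show "\<bar>(\<integral>s. indicator G s / P \<partial>\<mu>) - 1\<bar> \<le> r" using tr[of 0] P unfolding j0 by simp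
    show "\<bar>\<integral>s. indicator G s / P * y s \<partial>\<mu>\<bar> \<le> r" using tr[of 1] unfolding q by (simp add: e1)
    show "\<bar>(\<integral>s. indicator G s / P * (y s)\<^sup>2 \<partial>\<mu>) - v\<bar> \<le> r" using tr[of 2] P(2) unfolding q by (simp add: e2)
    show "(\<integral>s. indicator G s / P * (\<bar>y s\<bar> ^ 3 * exp (l * \<bar>y s\<bar>)) \<partial>\<mu>) \<le> r" unfolding q using m3 by simp
  qed
qed

section \<open>Gaussian tails and the critical value\<close>

lemma normal_tail_diff:
  assumes "a \<le> b"
  shows "normal_tail a - normal_tail b = measure stdN {a<..b}"
proof -
  interpret N: prob_space stdN by (rule prob_space_std_normal)
  have "{a<..} = {a<..b} \<union> {b<..}" using assms by auto
  moreover have "measure stdN ({a<..b} \<union> {b<..}) = measure stdN {a<..b} + measure stdN {b<..}"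
    by (rule N.finite_measure_Union) auto
  ultimately show ?thesis by (simp add: normal_tail_def)
qed

lemma std_normal_interval_le:
  assumes "a \<le> b" and "\<And>z. a < z \<Longrightarrow> z \<le> b \<Longrightarrow> std_normal_density z \<le> h"
  shows "measure stdN {a<..b} \<le> h * (b - a)"
proof (cases "a = b")
  case False
  interpret N: prob_space stdN by (rule prob_space_std_normal)
  have "0 \<le> std_normal_density b" by simp
  then have h: "0 \<le> h" using assms(2)[of b] assms(1) False by linarith
  have "emeasure stdN {a<..b} = (\<integral>\<^sup>+z. ennreal (std_normal_density z) * indicator {a<..b} z \<partial>lborel)"
    by (rule emeasure_density) auto
  also have "\<dots> \<le> (\<integral>\<^sup>+z. ennreal h * indicator {a<..b} z \<partial>lborel)"
    by (intro nn_integral_mono) (use assms(2) in \<open>auto simp: indicator_def intro!: ennreal_leI\<close>)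
  also have "\<dots> = ennreal (h * (b - a))"
    using assms(1) h by (subst nn_integral_cmult_indicator) (auto simp: ennreal_mult)
  finally show ?thesis using h assms(1) by (simp add: N.emeasure_eq_measure)
qed simp

lemma std_normal_interval_ge:
  assumes "a \<le> b" "0 \<le> h" and "\<And>z. a < z \<Longrightarrow> z \<le> b \<Longrightarrow> h \<le> std_normal_density z"
  shows "h * (b - a) \<le> measure stdN {a<..b}"
proof -
  interpret N: prob_space stdN by (rule prob_space_std_normal)
  have "ennreal (h * (b - a)) = (\<integral>\<^sup>+z. ennreal h * indicator {a<..b} z \<partial>lborel)"
    using assms(1,2) by (subst nn_integral_cmult_indicator) (auto simp: ennreal_mult)
  also have "\<dots> \<le> (\<integral>\<^sup>+z. ennreal (std_normal_density z) * indicator {a<..b} z \<partial>lborel)"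
    by (intro nn_integral_mono) (use assms(3) in \<open>auto simp: indicator_def intro!: ennreal_leI\<close>)
  also have "\<dots> = emeasure stdN {a<..b}"
    by (rule emeasure_density[symmetric]) auto
  finally show ?thesis by (simp add: N.emeasure_eq_measure)
qed

lemma std_normal_density_shift:
  "std_normal_density (c + s) = std_normal_density c * exp (- (c * s) - s\<^sup>2 / 2)"
proof -
  have "- (c + s)\<^sup>2 / 2 = - c\<^sup>2 / 2 + (- (c * s) - s\<^sup>2 / 2)" by (simp add: power2_eq_square field_simps)
  then show ?thesis by (simp add: std_normal_density_def exp_add[symmetric])
qed

lemma normal_tail_nonneg: "0 \<le> normal_tail a" by (simp add: normal_tail_def)

text \<open>On the interval from \<open>c - u\<close> to \<open>c\<close> the density exceeds its
  value at \<open>c\<close> by a factor of at most exp(c u). The increase is thus measured in units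
  of the density at \<open>c\<close>, which at the critical value is of order at most c / K.\<close>

lemma normal_tail_shift_le:
  assumes "0 \<le> u" "0 \<le> c"
  shows "normal_tail (c - u) \<le> normal_tail c + u * (std_normal_density c * exp (c * u))"
proof -
  have "measure stdN {c - u<..c} \<le> (std_normal_density c * exp (c * u)) * (c - (c - u))"
  proof (rule std_normal_interval_le)
    fix z assume z: "c - u < z" "z \<le> c"
    have "std_normal_density z = std_normal_density c * exp (- (c * (z - c)) - (z - c)\<^sup>2 / 2)"
      using std_normal_density_shift[of c "z - c"] by simp
    also have "\<dots> \<le> std_normal_density c * exp (c * u)"
    proof (intro mult_left_mono)
      have "c * (c - z) \<le> c * u" using z assms by (intro mult_left_mono) auto
      moreover have "0 \<le> (z - c)\<^sup>2" by simp
      moreover have "- (c * (z - c)) = c * (c - z)" by (simp add: algebra_simps)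
      ultimately have "- (c * (z - c)) - (z - c)\<^sup>2 / 2 \<le> c * u" by linarith
      then show "exp (- (c * (z - c)) - (z - c)\<^sup>2 / 2) \<le> exp (c * u)" by simp
    qed simp
    finally show "std_normal_density z \<le> std_normal_density c * exp (c * u)" .
  qed (use assms in simp)
  then show ?thesis using normal_tail_diff[of "c - u" c] assms by (simp add: mult_ac)
qed

text \<open>A weak form of the lower Mills bound, needed to pass from the tail at the critical
  value, which is known, to the density there.\<close>

lemma normal_tail_ge:
  assumes c: "0 \<le> c"
  shows "std_normal_density c * exp (- 3 / 2) \<le> (1 + c) * normal_tail c"
proof -
  \<comment> \<open>Within distance \<open>1 / (1 + c)\<close> to the right of \<open>c\<close> the
    exponent of the density drops by at most c h + h^2 / 2 \<le> 3 / 2.\<close>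
  define h where "h = 1 / (1 + c)"
  have h: "0 < h" "h \<le> 1" "c * h \<le> 1" using c by (auto simp: h_def)
  have "(std_normal_density c * exp (- 3 / 2)) * ((c + h) - c) \<le> measure stdN {c<..c + h}"
  proof (rule std_normal_interval_ge)
    fix z assume z: "c < z" "z \<le> c + h"
    have "c * (z - c) \<le> c * h" using z c by (intro mult_left_mono) auto
    moreover have "(z - c)\<^sup>2 \<le> 1" using z h by (intro power_le_one) auto
    ultimately have "exp (- 3 / 2) \<le> exp (- (c * (z - c)) - (z - c)\<^sup>2 / 2)" using h by simp
    then have "std_normal_density c * exp (- 3 / 2) \<le> std_normal_density c * exp (- (c * (z - c)) - (z - c)\<^sup>2 / 2)"
      by (intro mult_left_mono) auto
    then show "std_normal_density c * exp (- 3 / 2) \<le> std_normal_density z"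
      using std_normal_density_shift[of c "z - c"] by simp
  qed (use h in auto)
  also have "\<dots> \<le> normal_tail c"
    using normal_tail_diff[of c "c + h"] normal_tail_nonneg[of "c + h"] h by simp
  finally have "std_normal_density c * exp (- 3 / 2) * h \<le> normal_tail c" by simp
  then show ?thesis using c by (simp add: h_def field_simps)
qed

lemma normal_tail_le_exp:
  assumes c: "0 \<le> c"
  shows "normal_tail c \<le> exp (- c\<^sup>2 / 2)"
proof -
  interpret N: prob_space stdN by (rule prob_space_std_normal)
  have "normal_tail c = (\<integral>z. indicator {c<..} z \<partial>stdN)" by (simp add: normal_tail_def)
  also have "\<dots> \<le> (\<integral>z. exp (- c\<^sup>2) * exp (c * z) \<partial>stdN)"
  proof (rule integral_mono)
    show "integrable stdN (indicator {c<..} :: real \<Rightarrow> real)"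
      by (rule N.integrable_const_bound[where B=1]) auto
    show "integrable stdN (\<lambda>z. exp (- c\<^sup>2) * exp (c * z))"
      by (intro integrable_mult_right std_normal_exp_moment)
    fix z show "indicator {c<..} z \<le> exp (- c\<^sup>2) * exp (c * z)"
    proof (cases "c < z")
      case True
      then have "c * c \<le> c * z" using c by (intro mult_left_mono) auto
      then show ?thesis using True by (simp add: exp_add[symmetric] power2_eq_square)
    qed simp
  qed
  also have "\<dots> = exp (- c\<^sup>2) * exp (c\<^sup>2 / 2)" by (simp add: std_normal_exp_moment)
  also have "\<dots> = exp (- c\<^sup>2 / 2)" by (simp add: exp_add[symmetric])
  finally show ?thesis .
qed

lemma normal_lower_tail: "measure stdN {..<- c} = normal_tail c"
proof -
  interpret N: prob_space stdN by (rule prob_space_std_normal)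
  have "measure stdN {..<- c} = (\<integral>z. indicator {..<- c} z \<partial>stdN)" by simp
  also have "\<dots> = (\<integral>z. std_normal_density z * indicator {..<- c} z \<partial>lborel)" by (subst integral_density) auto
  also have "\<dots> = (\<integral>z. std_normal_density (0 + (-1) * z) * indicator {..<- c} (0 + (-1) * z) \<partial>lborel)"
    using lborel_integral_real_affine[of "-1" "\<lambda>z. std_normal_density z * indicator {..<- c} z" 0] by simp
  also have "\<dots> = (\<integral>z. std_normal_density z * indicator {c<..} z \<partial>lborel)"
    by (intro Bochner_Integration.integral_cong refl) (auto simp: std_normal_density_def indicator_def)
  also have "\<dots> = (\<integral>z. indicator {c<..} z \<partial>stdN)" by (subst integral_density) auto
  also have "\<dots> = normal_tail c" by (simp add: normal_tail_def)
  finally show ?thesis .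
qed

lemma std_normal_symmetric_interval:
  assumes "0 \<le> c"
  shows "measure stdN {- c..c} = 1 - 2 * normal_tail c"
proof -
  interpret N: prob_space stdN by (rule prob_space_std_normal)
  have "measure stdN (({..<- c} \<union> {- c..c}) \<union> {c<..})
      = (measure stdN {..<- c} + measure stdN {- c..c}) + measure stdN {c<..}"
    using assms by (subst N.finite_measure_Union; (subst N.finite_measure_Union)?) auto
  moreover have "({..<- c} \<union> {- c..c}) \<union> {c<..} = UNIV" using assms by auto
  moreover have "measure stdN UNIV = 1" using N.prob_space by simp
  ultimately show ?thesis unfolding normal_lower_tail normal_tail_def[symmetric] by simp
qed

lemma std_normal_density_le_half: "std_normal_density z \<le> 1 / 2"
proof -
  have "2 \<le> sqrt (2 * pi)" using pi_gt3 by (intro real_le_rsqrt) simp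
  then have "1 / sqrt (2 * pi) \<le> 1 / 2" by (intro divide_left_mono) auto
  then have "1 / sqrt (2 * pi) * exp (- z\<^sup>2 / 2) \<le> 1 / 2 * 1" by (intro mult_mono) auto
  then show ?thesis by (simp add: std_normal_density_def)
qed

lemma normal_tail_lipschitz:
  assumes "a \<le> b" shows "normal_tail b \<le> normal_tail a" "normal_tail a - normal_tail b \<le> 1 / 2 * (b - a)"
  unfolding normal_tail_diff[OF assms]
  using std_normal_interval_le[OF assms std_normal_density_le_half] normal_tail_diff[OF assms]
    measure_nonneg[of stdN "{a<..b}"] by linarith+

lemma normal_tail_strict:
  assumes "a < b" shows "normal_tail b < normal_tail a"
proof -
  define h where "h = min (std_normal_density a) (std_normal_density b)"
  have h: "0 < h" by (simp add: h_def normal_density_pos)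
  have conv: "h \<le> std_normal_density z" if "a < z" "z \<le> b" for z
  proof -
    have "z\<^sup>2 \<le> a\<^sup>2 \<or> z\<^sup>2 \<le> b\<^sup>2"
    proof (cases "0 \<le> z")
      case True
      then have "z\<^sup>2 \<le> b\<^sup>2" using that by (intro power_mono) auto
      then show ?thesis ..
    next
      case False
      then have "(- z)\<^sup>2 \<le> (- a)\<^sup>2" using that by (intro power_mono) auto
      then show ?thesis by simp
    qed
    then have "std_normal_density a \<le> std_normal_density z \<or> std_normal_density b \<le> std_normal_density z"
      unfolding std_normal_density_def by (auto simp: divide_right_mono)
    then show ?thesis by (auto simp: h_def)
  qed
  have "0 < h * (b - a)" using h assms by simp
  also have "\<dots> \<le> measure stdN {a<..b}"
    using assms h conv by (intro std_normal_interval_ge) auto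
  finally show ?thesis using normal_tail_diff[of a b] assms by simp
qed

lemma continuous_normal_tail: "continuous_on S normal_tail"
proof (rule lipschitz_on_continuous_on[where L="1 / 2"], rule lipschitz_onI)
  fix x y :: real
  show "dist (normal_tail x) (normal_tail y) \<le> 1 / 2 * dist x y"
    using normal_tail_lipschitz[of x y] normal_tail_lipschitz[of y x] by (cases "x \<le> y") (auto simp: dist_real_def)
qed simp

lemma normal_tail_0: "normal_tail 0 = 1 / 2"
proof -
  have "measure stdN {- 0..0::real} = 0"
    by (simp add: measure_def emeasure_density nn_integral_null_set)
  then show ?thesis using std_normal_symmetric_interval[of 0] by simp
qed

lemma normal_tail_le_half: "0 \<le> c \<Longrightarrow> normal_tail c \<le> 1 / 2"
  using normal_tail_lipschitz(1)[of 0 c] by (simp add: normal_tail_0)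

section \<open>The critical value of the Gaussian maximum\<close>

lemma gauss_max_cdf_eq:
  assumes "0 \<le> c"
  shows "gauss_max_cdf K c = (1 - 2 * normal_tail c) ^ K"
proof -
  interpret N: prob_space stdN by (rule prob_space_std_normal)
  interpret P: product_sigma_finite "\<lambda>_::nat. stdN" by unfold_locales
  interpret PP: prob_space "PiM {..<K} (\<lambda>_. stdN)" by (intro prob_space_PiM) unfold_locales
  have "{z \<in> {..<K} \<rightarrow>\<^sub>E UNIV. \<forall>j<K. \<bar>z j\<bar> \<le> c} = PiE {..<K} (\<lambda>_. {- c..c})"
    by (auto simp: PiE_def Pi_def abs_le_iff minus_le_iff)
  moreover have "emeasure (PiM {..<K} (\<lambda>_. stdN)) (PiE {..<K} (\<lambda>_. {- c..c}))
      = (\<Prod>i\<in>{..<K}. emeasure stdN {- c..c})"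
    by (rule P.emeasure_PiM) auto
  moreover have "0 \<le> 1 - 2 * normal_tail c" using normal_tail_le_half[OF assms] by simp
  ultimately show ?thesis
    by (simp add: gauss_max_cdf_def PP.emeasure_eq_measure N.emeasure_eq_measure std_normal_symmetric_interval[OF assms] ennreal_power)
qed

lemma crit_val_eq:
  assumes K: "1 \<le> K" and \<beta>: "0 < \<beta>" "\<beta> < 1"
  shows "0 < crit_val K \<beta>" and "(1 - 2 * normal_tail (crit_val K \<beta>)) ^ K = 1 - \<beta>"
proof -
  let ?F = "\<lambda>c. (1 - 2 * normal_tail c) ^ K"
  have ex: "\<exists>c. 0 < c \<and> ?F c = 1 - \<beta>"
  proof -
    \<comment> \<open>Chosen such that the Chernoff bound for the tail is
      \<open>\<beta> / (2 * K)\<close>; the union bound, here as Bernoulli's inequality, then places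
      the value at \<open>C\<close> above the target. At 0 the value is 0, and continuity does the
      rest.\<close>
    define C where "C = sqrt (2 * ln (2 * real K / \<beta>))"
    have "1 < 2 * real K / \<beta>" using K \<beta> by (simp add: field_simps)
    then have C: "0 \<le> C" "exp (- C\<^sup>2 / 2) = \<beta> / (2 * real K)"
      using K \<beta> by (auto simp: C_def exp_minus)
    have "normal_tail C \<le> \<beta> / (2 * real K)" using normal_tail_le_exp[OF C(1)] C(2) by simp
    then have "2 * normal_tail C * real K \<le> \<beta>" using K by (simp add: field_simps)
    then have "1 - \<beta> \<le> 1 + real K * (- 2 * normal_tail C)" by (simp add: algebra_simps)
    also have "\<dots> \<le> (1 + (- 2 * normal_tail C)) ^ K"
      by (rule Bernoulli_inequality) (use normal_tail_le_half[OF C(1)] in simp)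
    finally have "1 - \<beta> \<le> ?F C" by simp
    moreover have "?F 0 \<le> 1 - \<beta>" using K \<beta> by (simp add: normal_tail_0 power_0_left)
    moreover have "continuous_on {0..C} ?F" by (intro continuous_intros continuous_normal_tail)
    ultimately obtain c where c: "0 \<le> c" "c \<le> C" "?F c = 1 - \<beta>"
      using IVT'[of ?F 0 "1 - \<beta>" C] C by auto
    have "c \<noteq> 0" using c \<beta> K by (auto simp: normal_tail_0 power_0_left)
    then show ?thesis using c by (intro exI[of _ c]) auto
  qed
  have uniq: "c = d" if "0 < c" "?F c = 1 - \<beta>" "0 < d" "?F d = 1 - \<beta>" for c d
  proof -
    have "1 - 2 * normal_tail c = 1 - 2 * normal_tail d"
    proof (rule power_eq_imp_eq_base)
      show "?F c = ?F d" using that by simp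
    qed (use K normal_tail_le_half[of c] normal_tail_le_half[of d] that in auto)
    then have eq: "normal_tail c = normal_tail d" by simp
    show ?thesis using normal_tail_strict[of c d] normal_tail_strict[of d c] eq by (cases c d rule: linorder_cases) auto
  qed
  have "\<exists>!c. c > 0 \<and> gauss_max_cdf K c = 1 - \<beta>"
    using ex uniq by (auto simp: gauss_max_cdf_eq)
  then have "crit_val K \<beta> > 0 \<and> gauss_max_cdf K (crit_val K \<beta>) = 1 - \<beta>"
    unfolding crit_val_def by (rule theI')
  then show "0 < crit_val K \<beta>" "?F (crit_val K \<beta>) = 1 - \<beta>" by (auto simp: gauss_max_cdf_eq)
qed

text \<open>The first bound keeps \<open>c\<close> away from 0, so that a vanishing bias is
  eventually below it; the second makes \<open>c\<close> of order sqrt(log K). The third converts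
  errors relative to the normal density into errors relative to 1 / K: from 1 - \<beta> = (1 - 2
  t)^K \<le> exp(-2 K t), with t the tail at \<open>c\<close>, the product K t is bounded, and
  Mills' bound passes from the tail to the density.\<close>

lemma crit_val_bounds:
  assumes K: "1 \<le> K" and \<beta>: "0 < \<beta>" "\<beta> < 1"
  defines "c \<equiv> crit_val K \<beta>"
  shows "1 - \<beta> \<le> c" and "c\<^sup>2 \<le> 2 * ln (2 * real K / \<beta>)"
    and "real K * std_normal_density c \<le> exp (3 / 2) * ln (1 / (1 - \<beta>)) * (1 + c)"
proof -
  have c: "0 < c" "(1 - 2 * normal_tail c) ^ K = 1 - \<beta>"
    unfolding c_def by (rule crit_val_eq[OF K \<beta>])+
  have q: "0 \<le> 1 - 2 * normal_tail c" "1 - 2 * normal_tail c \<le> 1"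
    using normal_tail_le_half[of c] normal_tail_nonneg[of c] c by auto
  have "1 - \<beta> \<le> 1 - 2 * normal_tail c"
    using power_decreasing[OF K q] c(2) by simp
  also have "\<dots> \<le> c"
    using normal_tail_lipschitz(2)[of 0 c] c by (simp add: normal_tail_0)
  finally show "1 - \<beta> \<le> c" .
  have "1 + real K * (- 2 * normal_tail c) \<le> (1 + (- 2 * normal_tail c)) ^ K"
    by (rule Bernoulli_inequality) (use q in simp)
  then have "\<beta> \<le> 2 * real K * normal_tail c" using c(2) by (simp add: mult_ac)
  also have "\<dots> \<le> 2 * real K * exp (- c\<^sup>2 / 2)"
    using c by (intro mult_left_mono normal_tail_le_exp) auto
  finally have "exp (c\<^sup>2 / 2) \<le> 2 * real K / \<beta>" using \<beta> by (simp add: exp_minus field_simps)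
  then have "c\<^sup>2 / 2 \<le> ln (2 * real K / \<beta>)"
    by (metis exp_gt_zero ln_exp ln_le_cancel_iff order_less_le_trans)
  then show "c\<^sup>2 \<le> 2 * ln (2 * real K / \<beta>)" by simp
  have "1 - \<beta> \<le> exp (- 2 * normal_tail c) ^ K"
    unfolding c(2)[symmetric] using exp_ge_add_one_self[of "- 2 * normal_tail c"] q by (intro power_mono) auto
  also have "\<dots> = exp (- (2 * real K * normal_tail c))" by (simp add: exp_of_nat_mult[symmetric])
  finally have "ln (1 - \<beta>) \<le> ln (exp (- (2 * real K * normal_tail c)))"
    using \<beta> by (subst ln_le_cancel_iff) auto
  then have "ln (1 - \<beta>) \<le> - (2 * real K * normal_tail c)" by simp
  then have K2: "real K * normal_tail c \<le> ln (1 / (1 - \<beta>))"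
  proof -
    have "0 \<le> real K * normal_tail c" using normal_tail_nonneg[of c] by simp
    moreover have "ln (1 / (1 - \<beta>)) = - ln (1 - \<beta>)" using \<beta> by (simp add: ln_div)
    ultimately show ?thesis using \<open>ln (1 - \<beta>) \<le> - (2 * real K * normal_tail c)\<close> by linarith
  qed
  have "std_normal_density c * exp (- 3 / 2) \<le> (1 + c) * normal_tail c" using c by (intro normal_tail_ge) auto
  then have "std_normal_density c \<le> exp (3 / 2) * ((1 + c) * normal_tail c)"
    by (simp add: exp_minus field_simps)
  then have "real K * std_normal_density c \<le> real K * (exp (3 / 2) * ((1 + c) * normal_tail c))"
    by (intro mult_left_mono) auto
  also have "\<dots> = exp (3 / 2) * (1 + c) * (real K * normal_tail c)" by simp
  also have "\<dots> \<le> exp (3 / 2) * (1 + c) * ln (1 / (1 - \<beta>))" using c by (intro mult_left_mono K2) auto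
  finally show "real K * std_normal_density c \<le> exp (3 / 2) * ln (1 / (1 - \<beta>)) * (1 + c)" by (simp add: mult_ac)
qed

section \<open>Simultaneous control of all cells\<close>

text \<open>Given the cell of every observation, the blocks of observations belonging to different cells are
  independent; summing over all assignments of observations to cells therefore turns a
  conditional bound for single blocks into a bound for all cells simultaneously.\<close>
lemma (in prob_space) all_blocks_prob_ge:
  fixes W :: "nat \<Rightarrow> 'a \<Rightarrow> 'b" and A :: "'k \<Rightarrow> 'b set"
  assumes indep: "indep_vars (\<lambda>_. S) W {..<n}"
    and L: "finite L" "L \<noteq> {}" and A: "\<And>k. k \<in> L \<Longrightarrow> A k \<in> sets S" and disj: "disjoint_family_on A L"
    and cover: "AE t in M. \<forall>i<n. \<exists>k\<in>L. W i t \<in> A k"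
    and E: "\<And>k I. k \<in> L \<Longrightarrow> E k I \<in> sets (PiM I (\<lambda>_. S))"
    and q: "0 \<le> q" "q \<le> 1"
    and block: "\<And>k I. k \<in> L \<Longrightarrow> I \<subseteq> {..<n} \<Longrightarrow> m0 k \<le> real (card I) \<Longrightarrow>
       (1 - q) * prob {t \<in> space M. \<forall>i\<in>I. W i t \<in> A k}
         \<le> prob {t \<in> space M. (\<forall>i\<in>I. W i t \<in> A k) \<and> (\<lambda>i\<in>I. W i t) \<in> E k I}"
    and T: "T \<in> events"
    and T_ge: "\<And>t. t \<in> space M \<Longrightarrow> (\<And>k. k \<in> L \<Longrightarrow> m0 k \<le> real (card {i. i < n \<and> W i t \<in> A k})) \<Longrightarrow>
       (\<And>k. k \<in> L \<Longrightarrow> (\<lambda>i\<in>{i. i < n \<and> W i t \<in> A k}. W i t) \<in> E k {i. i < n \<and> W i t \<in> A k}) \<Longrightarrow> t \<in> T"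
  shows "(1 - q) ^ card L * prob {t \<in> space M. \<forall>k\<in>L. m0 k \<le> real (card {i. i < n \<and> W i t \<in> A k})} \<le> prob T"
proof -
  have W [measurable]: "W i \<in> measurable M S" if "i < n" for i
    using indep that by (auto simp: indep_vars_def)
  \<comment> \<open>\<open>B J k\<close> is the block of observations which the assignment
    \<open>J\<close> sends to cell \<open>k\<close>. \<open>D J\<close> states that the actual
    assignment is \<open>J\<close>, and \<open>F J\<close> adds the block event of every cell. Both
    are intersections over disjoint blocks, hence their probabilities factor and can be compared
    cell by cell.\<close>
  define B where "B J k = {i. i < n \<and> J i = k}" for J :: "nat \<Rightarrow> 'k" and k
  define good where "good = {J \<in> {..<n} \<rightarrow>\<^sub>E L. \<forall>k\<in>L. m0 k \<le> real (card (B J k))}"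
  define C where "C J k = {z \<in> space (PiM (B J k) (\<lambda>_. S)). \<forall>i\<in>B J k. z i \<in> A k}" for J k
  define R where "R J k t = (\<lambda>i\<in>B J k. W i t)" for J k t
  define D where "D J = (\<Inter>k\<in>L. R J k -` C J k \<inter> space M)" for J
  define F where "F J = (\<Inter>k\<in>L. R J k -` (C J k \<inter> E k (B J k)) \<inter> space M)" for J
  have finB: "finite (B J k)" for J k by (auto simp: B_def)
  have C: "C J k \<in> sets (PiM (B J k) (\<lambda>_. S))" if "k \<in> L" for J k
    unfolding C_def using finB A[OF that] by measurable
  have fin: "finite good" unfolding good_def using L(1) by (auto intro!: finite_subset[OF _ finite_PiE[of "{..<n}" "\<lambda>_. L"]])
  have indR: "indep_vars (\<lambda>k. PiM (B J k) (\<lambda>_. S)) (R J) L" for J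
    unfolding R_def[abs_def]
    by (rule indep_vars_restrict[OF indep]) (auto simp: B_def disjoint_family_on_def)
  have Rm: "R J k \<in> measurable M (PiM (B J k) (\<lambda>_. S))" if "k \<in> L" for J k
    using indR[of J] that by (simp add: indep_vars_def)
  have R_C: "R J k -` C J k \<inter> space M = {t \<in> space M. \<forall>i\<in>B J k. W i t \<in> A k}" for J k
    using W[THEN measurable_space] by (auto simp: R_def C_def B_def space_PiM)
  have R_CE: "R J k -` (C J k \<inter> E k (B J k)) \<inter> space M = {t \<in> space M. (\<forall>i\<in>B J k. W i t \<in> A k) \<and> (\<lambda>i\<in>B J k. W i t) \<in> E k (B J k)}" for J k
    using W[THEN measurable_space] by (auto simp: R_def C_def B_def space_PiM)
  have D_ev: "D J \<in> events" and F_ev: "F J \<in> events" for J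
    unfolding D_def F_def using L Rm C E by (auto intro!: sets.finite_INT measurable_sets sets.Int)
  have FD: "(1 - q) ^ card L * prob (D J) \<le> prob (F J)" if J: "J \<in> good" for J
  proof -
    have pD: "prob (D J) = (\<Prod>k\<in>L. prob (R J k -` C J k \<inter> space M))"
      unfolding D_def by (rule indep_varsD_finite[OF indR L(2,1) C])
    have pF: "prob (F J) = (\<Prod>k\<in>L. prob (R J k -` (C J k \<inter> E k (B J k)) \<inter> space M))"
      unfolding F_def by (rule indep_varsD_finite[OF indR L(2,1)]) (auto intro: C E)
    have "(1 - q) ^ card L * prob (D J) = (\<Prod>k\<in>L. (1 - q) * prob (R J k -` C J k \<inter> space M))"
      unfolding pD by (simp add: prod.distrib)
    also have "\<dots> \<le> (\<Prod>k\<in>L. prob (R J k -` (C J k \<inter> E k (B J k)) \<inter> space M))"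
      unfolding R_C R_CE
      by (intro prod_mono conjI block mult_nonneg_nonneg) (use q J in \<open>auto simp: good_def B_def\<close>)
    finally show ?thesis unfolding pF .
  qed
  have uniq: "B J k = {i. i < n \<and> W i t \<in> A k}" if "J \<in> {..<n} \<rightarrow>\<^sub>E L" "t \<in> D J" "k \<in> L" for J t k
  proof safe
    fix i assume i: "i \<in> B J k"
    then show "i < n" "W i t \<in> A k" using that by (auto simp: D_def R_C B_def)
  next
    fix i assume i: "i < n" "W i t \<in> A k"
    have Ji: "J i \<in> L" using that(1) i(1) by auto
    then have "W i t \<in> A (J i)" using that(2) i by (auto simp: D_def R_C B_def)
    then have "J i = k" using disj Ji that(3) i(2) by (auto simp: disjoint_family_on_def)
    then show "i \<in> B J k" using i by (simp add: B_def)
  qed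
  have FsubD: "F J \<subseteq> D J" for J unfolding F_def D_def by auto
  have disjD: "disjoint_family_on D good"
  proof (unfold disjoint_family_on_def, intro ballI impI)
    fix J J' assume JJ: "J \<in> good" "J' \<in> good" "J \<noteq> J'"
    show "D J \<inter> D J' = {}"
    proof (rule ccontr)
      assume "D J \<inter> D J' \<noteq> {}"
      then obtain t where t: "t \<in> D J" "t \<in> D J'" by auto
      have J: "J \<in> {..<n} \<rightarrow>\<^sub>E L" "J' \<in> {..<n} \<rightarrow>\<^sub>E L" using JJ by (auto simp: good_def)
      have "J = J'"
      proof (rule PiE_ext[OF J])
        fix i assume i: "i \<in> {..<n}"
        then have "J i \<in> L" using J by auto
        then have "B J (J i) = B J' (J i)" using uniq[OF J(1) t(1)] uniq[OF J(2) t(2)] by simp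
        then have "i \<in> B J' (J i)" using i by (auto simp: B_def)
        then show "J i = J' i" by (simp add: B_def)
      qed
      then show False using JJ by simp
    qed
  qed
  then have disjF: "disjoint_family_on F good" using FsubD unfolding disjoint_family_on_def by blast
  let ?G = "{t \<in> space M. \<forall>k\<in>L. m0 k \<le> real (card {i. i < n \<and> W i t \<in> A k})}"
  have "?G \<in> events"
  proof -
    have "real (card {i. i < n \<and> W i t \<in> A k}) = (\<Sum>i<n. indicator (A k) (W i t))" for k t
      by (simp add: indicator_def sum.If_cases Int_def)
    moreover have "{t \<in> space M. m0 k \<le> (\<Sum>i<n. indicator (A k) (W i t))} \<in> events" if "k \<in> L" for k
      using A[OF that] by measurable
    ultimately show ?thesis using L by (auto intro!: sets.sets_Collect_finite_All)
  qed
  \<comment> \<open>An outcome has an actual assignment only if every observation lies in some cell,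
    which holds almost surely.\<close>
  moreover have "AE t in M. t \<in> ?G \<longrightarrow> t \<in> (\<Union>J\<in>good. D J)"
    using cover AE_space
  proof eventually_elim
    case (elim t)
    show ?case
    proof
      assume G: "t \<in> ?G"
      obtain f where f: "\<And>i. i < n \<Longrightarrow> f i \<in> L \<and> W i t \<in> A (f i)" using elim(1) by metis
      define J where "J = (\<lambda>i\<in>{..<n}. f i)"
      have J: "J \<in> {..<n} \<rightarrow>\<^sub>E L" using f by (auto simp: J_def)
      have D: "t \<in> D J" using f elim(2) by (auto simp: D_def R_C B_def J_def)
      then have "J \<in> good" using J G uniq[OF J D] by (auto simp: good_def)
      with D show "t \<in> (\<Union>J\<in>good. D J)" by auto
    qed
  qed
  ultimately have "prob ?G \<le> prob (\<Union>J\<in>good. D J)"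
    using fin D_ev by (intro finite_measure_mono_AE) auto
  also have "\<dots> = (\<Sum>J\<in>good. prob (D J))"
    using fin D_ev disjD by (intro finite_measure_finite_Union) auto
  finally have "(1 - q) ^ card L * prob ?G \<le> (1 - q) ^ card L * (\<Sum>J\<in>good. prob (D J))"
    using q by (intro mult_left_mono) auto
  also have "\<dots> \<le> (\<Sum>J\<in>good. prob (F J))"
    unfolding sum_distrib_left by (intro sum_mono FD)
  also have "\<dots> = prob (\<Union>J\<in>good. F J)"
    using fin F_ev disjF by (intro finite_measure_finite_Union[symmetric]) auto
  also have "\<dots> \<le> prob T"
  proof (rule finite_measure_mono[OF _ T], safe)
    fix J t assume J: "J \<in> good" and t: "t \<in> F J"
    have J': "J \<in> {..<n} \<rightarrow>\<^sub>E L" using J by (simp add: good_def)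
    have D: "t \<in> D J" using t FsubD by auto
    note u = uniq[OF J' D]
    show "t \<in> T"
    proof (rule T_ge)
      show "t \<in> space M" using t L by (auto simp: F_def)
      fix k assume k: "k \<in> L"
      show "m0 k \<le> real (card {i. i < n \<and> W i t \<in> A k})" using J k u[OF k] by (auto simp: good_def)
      show "(\<lambda>i\<in>{i. i < n \<and> W i t \<in> A k}. W i t) \<in> E k {i. i < n \<and> W i t \<in> A k}"
        using t k unfolding u[OF k, symmetric] F_def R_CE by auto
    qed
  qed
  finally show ?thesis .
qed

section \<open>Lower deviations of the cell counts\<close>

lemma exp_minus_le_quadratic:
  fixes \<theta> :: real assumes "0 \<le> \<theta>" shows "exp (- \<theta>) \<le> 1 - \<theta> + \<theta>\<^sup>2 / 2"
proof -
  obtain t where "exp (- \<theta>) = (\<Sum>m<3. (- \<theta>) ^ m / fact m) + exp t / fact 3 * (- \<theta>) ^ 3"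
    using Maclaurin_exp_le[of "- \<theta>" 3] by blast
  moreover have "exp t / fact 3 * (- \<theta>) ^ 3 \<le> 0" using assms by simp
  moreover have "(\<Sum>m<3. (- \<theta>) ^ m / fact m) = 1 - \<theta> + \<theta>\<^sup>2 / 2"
    by (simp add: eval_nat_numeral)
  ultimately show ?thesis by linarith
qed

text \<open>Chernoff's bound with \<theta> itself as the exponent instead of the optimal one: the
  quadratic bound for exp(-\<theta>) gives \<theta> (1 - \<theta>) n p - n p (\<theta> - \<theta>^2
  / 2) = - \<theta>^2 n p / 2.\<close>

lemma (in prob_space) count_lower_tail:
  fixes W :: "nat \<Rightarrow> 'a \<Rightarrow> 'b"
  assumes indep: "indep_vars (\<lambda>_. S) W {..<n}" and A [measurable]: "A \<in> sets S"
    and p: "\<And>i. i < n \<Longrightarrow> prob {t \<in> space M. W i t \<in> A} = p" and \<theta>: "0 \<le> \<theta>"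
  shows "prob {t \<in> space M. real (card {i. i < n \<and> W i t \<in> A}) < (1 - \<theta>) * (real n * p)} \<le> exp (- (\<theta>\<^sup>2 * (real n * p)) / 2)"
proof (cases "n = 0")
  case False
  have W [measurable]: "W i \<in> measurable M S" if "i < n" for i
    using indep that by (auto simp: indep_vars_def)
  have card: "real (card {i. i < n \<and> W i t \<in> A}) = (\<Sum>i<n. indicator A (W i t))" for t
    by (simp add: indicator_def sum.If_cases Int_def)
  let ?e = "\<lambda>i t. exp (- \<theta> * indicator A (W i t))"
  let ?a = "(1 - \<theta>) * (real n * p)"
  let ?S = "{t \<in> space M. (\<Sum>i<n. indicator A (W i t)) < ?a}"
  have S: "?S \<in> events" by measurable
  have ind: "indep_vars (\<lambda>_. borel) ?e {..<n}"
    by (rule indep_vars_compose2[OF indep]) measurable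
  have int: "integrable M (?e i)" if "i < n" for i
    by (rule integrable_const_bound[where B=1]) (use that \<theta> in auto)
  have p0: "0 \<le> p" using p[of 0] False measure_nonneg by (metis gr0I)
  have Ee: "expectation (?e i) \<le> exp (- (p * (\<theta> - \<theta>\<^sup>2 / 2)))" if i: "i < n" for i
  proof -
    have "?e i t = 1 - (1 - exp (- \<theta>)) * indicator {t \<in> space M. W i t \<in> A} t" if "t \<in> space M" for t
      using that by (auto simp: indicator_def)
    then have "expectation (?e i) = expectation (\<lambda>t. 1 - (1 - exp (- \<theta>)) * indicator {t \<in> space M. W i t \<in> A} t)"
      by (intro Bochner_Integration.integral_cong) auto
    also have "\<dots> = 1 - (1 - exp (- \<theta>)) * p"
    proof -
      have ev: "{t \<in> space M. W i t \<in> A} \<in> events" using i by measurable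
      have "integrable M (\<lambda>t. (1 - exp (- \<theta>)) * indicator {t \<in> space M. W i t \<in> A} t)"
        by (intro integrable_mult_right integrable_real_indicator) (use ev in \<open>auto simp: emeasure_eq_measure\<close>)
      moreover have "expectation (indicator {t \<in> space M. W i t \<in> A}) = p"
        using p[OF i] ev by (simp add: Int_absorb2 sets.sets_into_space Int_def conj_commute cong: conj_cong)
      ultimately show ?thesis by (simp add: prob_space)
    qed
    also have "\<dots> \<le> 1 - (\<theta> - \<theta>\<^sup>2 / 2) * p"
      using mult_right_mono[OF exp_minus_le_quadratic[OF \<theta>] p0] by (simp add: algebra_simps)
    also have "\<dots> \<le> exp (- (p * (\<theta> - \<theta>\<^sup>2 / 2)))"
      using exp_ge_add_one_self[of "- (p * (\<theta> - \<theta>\<^sup>2 / 2))"] by (simp add: algebra_simps)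
    finally show ?thesis .
  qed
  have prod: "exp (- \<theta> * (\<Sum>i<n. indicator A (W i t))) = (\<Prod>i<n. ?e i t)" for t
    by (simp add: exp_sum sum_distrib_left)
  have intp: "integrable M (\<lambda>t. \<Prod>i<n. ?e i t)"
    using int by (intro indep_vars_integrable[OF _ ind]) auto
  have "prob ?S = expectation (indicator ?S)" using S by (simp add: Int_absorb2 sets.sets_into_space)
  also have "\<dots> \<le> expectation (\<lambda>t. exp (\<theta> * ?a) * (\<Prod>i<n. ?e i t))"
  proof (rule integral_mono)
    show "integrable M (indicator ?S :: _ \<Rightarrow> real)" using S by (intro integrable_real_indicator) (auto simp: emeasure_eq_measure)
    show "integrable M (\<lambda>t. exp (\<theta> * ?a) * (\<Prod>i<n. ?e i t))" by (intro integrable_mult_right intp)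
    fix t
    show "indicator ?S t \<le> exp (\<theta> * ?a) * (\<Prod>i<n. ?e i t)"
    proof (cases "t \<in> ?S")
      case True
      then have "0 \<le> \<theta> * (?a - (\<Sum>i<n. indicator A (W i t)))" using \<theta> by (intro mult_nonneg_nonneg) auto
      then show ?thesis using True unfolding prod[symmetric] exp_add[symmetric] by (simp add: algebra_simps)
    qed (simp add: prod_nonneg)
  qed
  also have "\<dots> = exp (\<theta> * ?a) * (\<Prod>i<n. expectation (?e i))"
    using int by (subst indep_vars_lebesgue_integral[OF _ ind, symmetric]) auto
  also have "\<dots> \<le> exp (\<theta> * ?a) * (\<Prod>i<n. exp (- (p * (\<theta> - \<theta>\<^sup>2 / 2))))"
    using Ee by (intro mult_left_mono prod_mono) (auto intro!: integral_nonneg_AE)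
  also have "\<dots> = exp (\<theta> * ?a + real n * (- (p * (\<theta> - \<theta>\<^sup>2 / 2))))"
    unfolding exp_add exp_of_nat_mult by simp
  also have "\<theta> * ?a + real n * (- (p * (\<theta> - \<theta>\<^sup>2 / 2))) = - (\<theta>\<^sup>2 * (real n * p)) / 2"
    by (simp add: power2_eq_square field_simps)
  finally show ?thesis unfolding card .
qed simp

text \<open>The replacement error of \<open>walk_tail\<close>, with \<open>y\<close> for
  \<open>m * r\<close>. It is increasing in \<open>y\<close>, and \<open>y\<close> is proportional
  to \<open>1 / sqrt m\<close>, so the smallest admissible block gives the bound for all
  blocks.\<close>

definition lindeberg_err :: "real \<Rightarrow> real \<Rightarrow> real \<Rightarrow> real \<Rightarrow> real" where
  "lindeberg_err \<eta> l a y = y * (96 * (3 / \<eta>) ^ 3) * exp (l\<^sup>2 / 2 - l * a + y * (1 + l) ^ 3)"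

lemma lindeberg_err_mono:
  assumes "0 \<le> y" "y \<le> y'" "0 < \<eta>" "0 \<le> l"
  shows "lindeberg_err \<eta> l a y \<le> lindeberg_err \<eta> l a y'"
proof -
  have "y * (1 + l) ^ 3 \<le> y' * (1 + l) ^ 3" using assms by (intro mult_right_mono) auto
  then show ?thesis unfolding lindeberg_err_def using assms by (intro mult_mono) auto
qed

lemma lindeberg_err_nonneg: "0 \<le> y \<Longrightarrow> 0 < \<eta> \<Longrightarrow> 0 \<le> lindeberg_err \<eta> l a y"
  by (simp add: lindeberg_err_def)

text \<open>Division by \<open>s * sqrt m\<close> gives each step variance \<open>1 / m\<close>. The
  hypotheses are invariant under a change of sign of the errors, so \<open>\<sigma>\<close> treats
  upper and lower tail in one argument.\<close>

lemma truncated_sum_tails: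
  fixes \<mu> :: "'b measure" and e :: "'b \<Rightarrow> real"
  assumes "prob_space \<mu>" and A [measurable]: "A \<in> sets \<mu>" and e [measurable]: "e \<in> borel_measurable \<mu>"
    and P: "P = measure \<mu> A" "0 < P"
    and i3: "integrable \<mu> (\<lambda>t. \<bar>e t\<bar> ^ 3)" and s: "0 < s"
    and e1: "(\<integral>t. indicator A t * e t \<partial>\<mu>) = 0" and e2: "(\<integral>t. indicator A t * (e t)\<^sup>2 \<partial>\<mu>) = s\<^sup>2 * P"
    and e3: "(\<integral>t. indicator A t * \<bar>e t\<bar> ^ 3 \<partial>\<mu>) \<le> \<kappa> * P"
    and b: "0 < b" "b \<le> 1" and l: "0 \<le> l" "l * b \<le> 1"
    and I: "finite I" "card I = m" and m: "0 < m" and lm: "l \<le> sqrt (real m)" and \<eta>: "0 < \<eta>" "\<eta> \<le> 3"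
    and \<sigma>: "\<sigma> = 1 \<or> \<sigma> = - 1"
  shows "measure (PiM I (\<lambda>_. \<mu>)) {z \<in> space (PiM I (\<lambda>_. \<mu>)). (\<forall>i\<in>I. z i \<in> A \<and> \<bar>e (z i)\<bar> \<le> b * (s * sqrt m)) \<and> (a + \<eta>) * (s * sqrt m) \<le> \<sigma> * (\<Sum>i\<in>I. e (z i))}
     \<le> P ^ m * (normal_tail a + lindeberg_err \<eta> l a ((\<kappa> / s ^ 3 * (1 / b ^ 3 + exp 1) + 12 * exp 2) / sqrt m))"
proof -
  interpret prob_space \<mu> by fact
  define S where "S = s * sqrt m"
  have S: "0 < S" using s m by (simp add: S_def)
  define y where "y t = \<sigma> * e t / S" for t
  have y [measurable]: "y \<in> borel_measurable \<mu>" unfolding y_def by measurable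
  have \<sigma>2: "\<bar>\<sigma>\<bar> = 1" "\<sigma>\<^sup>2 = 1" using \<sigma> by auto
  have ay: "\<bar>y t\<bar> = \<bar>e t\<bar> / S" for t using S \<sigma>2 by (simp add: y_def abs_mult)
  \<comment> \<open>The sum of the constant for the truncated walk and the Gaussian one, so that the
    same \<open>r\<close> serves both walks; it satisfies \<open>m * r = Q / sqrt m\<close>.\<close>
  define Q where "Q = \<kappa> / s ^ 3 * (1 / b ^ 3 + exp 1) + 12 * exp 2"
  define r where "r = Q / sqrt m ^ 3"
  have S3: "S ^ 3 = s ^ 3 * sqrt m ^ 3" by (simp add: S_def power_mult_distrib)
  have "0 \<le> (\<integral>t. indicator A t * \<bar>e t\<bar> ^ 3 \<partial>\<mu>)" by (intro integral_nonneg_AE AE_I2) auto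
  then have "0 \<le> \<kappa> * P" using e3 by linarith
  then have \<kappa>: "0 \<le> \<kappa>" using P(2) by (simp add: zero_le_mult_iff)
  have step: "walk_step \<mu> (\<lambda>t. indicator (A \<inter> {t \<in> space \<mu>. \<bar>y t\<bar> \<le> b}) t / P) y l (1 / real m) r"
  proof (rule walk_step_truncated[OF prob_space_axioms A y P, where \<rho>="\<kappa> / S ^ 3"])
    have "integrable \<mu> (\<lambda>t. \<bar>e t\<bar> ^ 3 / S ^ 3)" using i3 by simp
    then show "integrable \<mu> (\<lambda>t. \<bar>y t\<bar> ^ 3)" by (simp add: ay power_divide)
    have "(\<integral>t. indicator A t * y t \<partial>\<mu>) = (\<integral>t. (\<sigma> / S) * (indicator A t * e t) \<partial>\<mu>)"
      by (intro Bochner_Integration.integral_cong) (auto simp: y_def)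
    then show "(\<integral>t. indicator A t * y t \<partial>\<mu>) = 0" by (simp add: e1)
    have "(\<integral>t. indicator A t * (y t)\<^sup>2 \<partial>\<mu>) = (\<integral>t. (1 / S\<^sup>2) * (indicator A t * (e t)\<^sup>2) \<partial>\<mu>)"
      by (intro Bochner_Integration.integral_cong) (auto simp: y_def power_divide power_mult_distrib \<sigma>2)
    also have "\<dots> = (1 / S\<^sup>2) * (s\<^sup>2 * P)" by (simp add: e2)
    also have "\<dots> = 1 / m * P" using s by (simp add: S_def power_mult_distrib)
    finally show "(\<integral>t. indicator A t * (y t)\<^sup>2 \<partial>\<mu>) = 1 / m * P" .
    have "(\<integral>t. indicator A t * \<bar>y t\<bar> ^ 3 \<partial>\<mu>) = (\<integral>t. (1 / S ^ 3) * (indicator A t * \<bar>e t\<bar> ^ 3) \<partial>\<mu>)"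
      by (intro Bochner_Integration.integral_cong) (auto simp: ay power_divide)
    also have "\<dots> = (1 / S ^ 3) * (\<integral>t. indicator A t * \<bar>e t\<bar> ^ 3 \<partial>\<mu>)" by simp
    also have "\<dots> \<le> (1 / S ^ 3) * (\<kappa> * P)" using S by (intro mult_left_mono e3) auto
    finally show "(\<integral>t. indicator A t * \<bar>y t\<bar> ^ 3 \<partial>\<mu>) \<le> \<kappa> / S ^ 3 * P" by simp
    have "\<kappa> / S ^ 3 * (1 / b ^ 3 + exp 1) = (\<kappa> / s ^ 3 * (1 / b ^ 3 + exp 1)) / sqrt m ^ 3"
      unfolding S3 by simp
    also have "\<dots> \<le> r" unfolding r_def Q_def using m by (intro divide_right_mono) auto
    finally show "\<kappa> / S ^ 3 * (1 / b ^ 3 + exp 1) \<le> r" .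
  qed (use b l m in auto)
  have rm: "real m * r = Q / sqrt m"
  proof -
    have "sqrt m ^ 3 = sqrt m * real m" by (simp add: power3_eq_cube)
    then show ?thesis using m by (simp add: r_def)
  qed
  have "measure (PiM I (\<lambda>_. \<mu>)) {z \<in> space (PiM I (\<lambda>_. \<mu>)). (\<forall>i\<in>I. z i \<in> A \<inter> {t \<in> space \<mu>. \<bar>y t\<bar> \<le> b}) \<and> a + \<eta> \<le> (\<Sum>i\<in>I. y (z i))}
     \<le> P ^ m * (normal_tail a + real m * r * (96 * (3 / \<eta>) ^ 3) * exp (l\<^sup>2 / 2 - l * a + real m * r * (1 + l) ^ 3))"
  proof (rule block_tail[OF step I m _ P(2) lm _ \<eta>])
    show "A \<inter> {t \<in> space \<mu>. \<bar>y t\<bar> \<le> b} \<in> sets \<mu>" by measurable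
    show "12 * exp 2 / sqrt (real m) ^ 3 \<le> r"
      unfolding r_def Q_def using \<kappa> s b m by (intro divide_right_mono) auto
  qed
  also have "{z \<in> space (PiM I (\<lambda>_. \<mu>)). (\<forall>i\<in>I. z i \<in> A \<inter> {t \<in> space \<mu>. \<bar>y t\<bar> \<le> b}) \<and> a + \<eta> \<le> (\<Sum>i\<in>I. y (z i))}
    = {z \<in> space (PiM I (\<lambda>_. \<mu>)). (\<forall>i\<in>I. z i \<in> A \<and> \<bar>e (z i)\<bar> \<le> b * S) \<and> (a + \<eta>) * S \<le> \<sigma> * (\<Sum>i\<in>I. e (z i))}"
  proof -
    have 1: "(\<Sum>i\<in>I. y (z i)) = \<sigma> * (\<Sum>i\<in>I. e (z i)) / S" for z
      by (simp add: y_def sum_divide_distrib sum_distrib_left)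
    have 2: "a + \<eta> \<le> \<sigma> * (\<Sum>i\<in>I. e (z i)) / S \<longleftrightarrow> (a + \<eta>) * S \<le> \<sigma> * (\<Sum>i\<in>I. e (z i))" for z
      using S by (rule pos_le_divide_eq)
    have 3: "\<bar>y t\<bar> \<le> b \<longleftrightarrow> \<bar>e t\<bar> \<le> b * S" for t unfolding ay using S by (rule pos_divide_le_eq)
    show ?thesis unfolding 1 2 3 by (auto simp: space_PiM PiE_def Pi_def)
  qed
  finally show ?thesis unfolding rm lindeberg_err_def S_def Q_def .
qed

text \<open>An error above the truncation level counts as success here. Only configurations with all
  errors small have to be shown rare, so no probability of large errors within the block enters;
  those are paid for once, over the whole sample, later.\<close>

lemma (in prob_space) cell_block_prob_ge:
  fixes W :: "nat \<Rightarrow> 'a \<Rightarrow> 'b" and e :: "'b \<Rightarrow> real"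
  assumes indep: "indep_vars (\<lambda>_. S) W {..<n}" and dist: "\<And>i. i < n \<Longrightarrow> distr M S (W i) = \<mu>"
    and A [measurable]: "A \<in> sets S" and e [measurable]: "e \<in> borel_measurable S"
    and P: "P = measure \<mu> A" "0 < P"
    and i3: "integrable \<mu> (\<lambda>t. \<bar>e t\<bar> ^ 3)" and s: "0 < s"
    and e1: "(\<integral>t. indicator A t * e t \<partial>\<mu>) = 0" and e2: "(\<integral>t. indicator A t * (e t)\<^sup>2 \<partial>\<mu>) = s\<^sup>2 * P"
    and e3: "(\<integral>t. indicator A t * \<bar>e t\<bar> ^ 3 \<partial>\<mu>) \<le> \<kappa> * P"
    and b: "0 < b" "b \<le> 1" and l: "0 \<le> l" "l * b \<le> 1"
    and I: "I \<subseteq> {..<n}" "card I = m" and m: "0 < m" and lm: "l \<le> sqrt (real m)" and \<eta>: "0 < \<eta>" "\<eta> \<le> 3"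
    and q: "2 * (normal_tail a + lindeberg_err \<eta> l a ((\<kappa> / s ^ 3 * (1 / b ^ 3 + exp 1) + 12 * exp 2) / sqrt m)) \<le> q"
  shows "(1 - q) * prob {t \<in> space M. \<forall>i\<in>I. W i t \<in> A}
    \<le> prob {t \<in> space M. (\<forall>i\<in>I. W i t \<in> A) \<and> (\<lambda>i\<in>I. W i t) \<in>
         {z \<in> space (PiM I (\<lambda>_. S)). (\<exists>i\<in>I. b * (s * sqrt m) < \<bar>e (z i)\<bar>) \<or> \<bar>\<Sum>i\<in>I. e (z i)\<bar> < (a + \<eta>) * (s * sqrt m)}}"
proof -
  have Ine: "I \<noteq> {}" using I m by auto
  have fI: "finite I" using I finite_subset by blast
  have W [measurable]: "W i \<in> measurable M S" if "i \<in> I" for i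
    using indep I that by (auto simp: indep_vars_def)
  obtain i0 where i0: "i0 \<in> I" "i0 < n" using Ine I by auto
  have sets\<mu> [measurable_cong]: "sets \<mu> = sets S" using dist[OF i0(2)] by auto
  interpret \<mu>: prob_space \<mu> using dist[OF i0(2)] prob_space_distr[OF W[OF i0(1)]] by simp
  let ?P = "PiM I (\<lambda>_. \<mu>)"
  interpret P: prob_space ?P by (intro prob_space_PiM) unfold_locales
  interpret PS: product_sigma_finite "\<lambda>_::nat. \<mu>" by unfold_locales
  have "distr M (PiM I (\<lambda>_. S)) (\<lambda>t. \<lambda>i\<in>I. W i t) = (\<Pi>\<^sub>M i\<in>I. distr M S (W i))"
    using indep_vars_subset[OF indep I(1)] W Ine by (subst (asm) indep_vars_iff_distr_eq_PiM') auto
  also have "\<dots> = ?P" using dist I by (intro PiM_cong) auto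
  finally have dP: "distr M (PiM I (\<lambda>_. S)) (\<lambda>t. \<lambda>i\<in>I. W i t) = ?P" .
  have setsP: "sets ?P = sets (PiM I (\<lambda>_. S))" by (intro sets_PiM_cong) (auto simp: sets\<mu>)
  then have spP: "space ?P = space (PiM I (\<lambda>_. S))" by (rule sets_eq_imp_space_eq)
  have tr: "prob {t \<in> space M. (\<lambda>i\<in>I. W i t) \<in> X} = P.prob X" if "X \<in> sets ?P" for X
  proof -
    have "P.prob X = prob ((\<lambda>t. \<lambda>i\<in>I. W i t) -` X \<inter> space M)"
      unfolding dP[symmetric] by (rule measure_distr) (use that setsP in auto)
    then show ?thesis by (simp add: vimage_def Int_def conj_commute)
  qed
  define S' where "S' = s * sqrt m"
  define CA where "CA = {z \<in> space ?P. \<forall>i\<in>I. z i \<in> A}"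
  define bad where "bad \<sigma> = {z \<in> space ?P. (\<forall>i\<in>I. z i \<in> A \<and> \<bar>e (z i)\<bar> \<le> b * S') \<and> (a + \<eta>) * S' \<le> \<sigma> * (\<Sum>i\<in>I. e (z i))}" for \<sigma> :: real
  define good where "good = {z \<in> space ?P. (\<forall>i\<in>I. z i \<in> A) \<and> ((\<exists>i\<in>I. b * S' < \<bar>e (z i)\<bar>) \<or> \<bar>\<Sum>i\<in>I. e (z i)\<bar> < (a + \<eta>) * S')}"
  have em [measurable]: "e \<in> borel_measurable \<mu>" using e by measurable
  have A' [measurable]: "A \<in> sets \<mu>" by (simp add: sets\<mu>)
  have CA: "CA \<in> sets ?P" unfolding CA_def using fI by measurable
  have bad: "bad \<sigma> \<in> sets ?P" for \<sigma> unfolding bad_def using fI by measurable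
  have good: "good \<in> sets ?P" unfolding good_def using fI by measurable
  have "CA = PiE I (\<lambda>_. A)" using sets.sets_into_space[OF A'] by (auto simp: CA_def space_PiM PiE_def Pi_def)
  then have "emeasure ?P CA = (\<Prod>i\<in>I. emeasure \<mu> A)" using PS.emeasure_PiM[OF fI, of "\<lambda>_. A"] by simp
  then have pCA: "P.prob CA = P ^ m"
    using P(2) I by (simp add: P.emeasure_eq_measure \<mu>.emeasure_eq_measure P(1)[symmetric] ennreal_power)
  have pbad: "P.prob (bad \<sigma>) \<le> P ^ m * (q / 2)" if "\<sigma> = 1 \<or> \<sigma> = - 1" for \<sigma>
  proof -
    have "P.prob (bad \<sigma>) \<le> P ^ m * (normal_tail a + lindeberg_err \<eta> l a ((\<kappa> / s ^ 3 * (1 / b ^ 3 + exp 1) + 12 * exp 2) / sqrt m))"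
      unfolding bad_def S'_def by (rule truncated_sum_tails[OF \<mu>.prob_space_axioms A' em P i3 s e1 e2 e3 b l fI I(2) m lm \<eta> that])
    also have "\<dots> \<le> P ^ m * (q / 2)" using P q by (intro mult_left_mono) auto
    finally show ?thesis .
  qed
  \<comment> \<open>A failure has all errors below the truncation level and a large positive or a
    large negative sum. Each of these has probability at most \<open>P ^ m * (q / 2)\<close>, and
    \<open>P ^ m\<close> is the probability of \<open>CA\<close>.\<close>
  have "CA \<subseteq> good \<union> (bad 1 \<union> bad (- 1))"
    unfolding CA_def good_def bad_def by (auto simp: not_less abs_less_iff)
  then have "P.prob CA \<le> P.prob (good \<union> (bad 1 \<union> bad (- 1)))"
    using good bad by (intro P.finite_measure_mono) auto
  also have "\<dots> \<le> P.prob good + P.prob (bad 1 \<union> bad (- 1))"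
    using good bad by (intro measure_Un_le) auto
  also have "P.prob (bad 1 \<union> bad (- 1)) \<le> P.prob (bad 1) + P.prob (bad (- 1))"
    using bad by (intro measure_Un_le) auto
  finally have "P.prob CA \<le> P.prob good + P ^ m * q" using pbad[of 1] pbad[of "- 1"] by simp
  then have "(1 - q) * P.prob CA \<le> P.prob good" unfolding pCA by (simp add: algebra_simps)
  moreover have "{t \<in> space M. \<forall>i\<in>I. W i t \<in> A} = {t \<in> space M. (\<lambda>i\<in>I. W i t) \<in> CA}"
    using W[THEN measurable_space] unfolding CA_def spP by (auto simp: space_PiM)
  moreover have "{t \<in> space M. (\<forall>i\<in>I. W i t \<in> A) \<and> (\<lambda>i\<in>I. W i t) \<in>
         {z \<in> space (PiM I (\<lambda>_. S)). (\<exists>i\<in>I. b * (s * sqrt m) < \<bar>e (z i)\<bar>) \<or> \<bar>\<Sum>i\<in>I. e (z i)\<bar> < (a + \<eta>) * (s * sqrt m)}}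
      = {t \<in> space M. (\<lambda>i\<in>I. W i t) \<in> good}"
    using W[THEN measurable_space] unfolding good_def spP S'_def by (auto simp: space_PiM)
  ultimately show ?thesis using tr[OF CA] tr[OF good] by simp
qed

text \<open>The lower bounds \<open>p0\<close>, \<open>s0\<close> and \<open>m0\<close> for cell
  probability, standard deviation and block size make one \<open>q\<close> valid for all cells. The
  two subtracted terms are union bounds: over the cells for small counts, over the observations for
  errors above the truncation level.\<close>

lemma (in prob_space) simultaneous_sums_prob_ge:
  fixes W :: "nat \<Rightarrow> 'a \<Rightarrow> 'b" and e :: "'b \<Rightarrow> real" and A :: "'k \<Rightarrow> 'b set"
  assumes indep: "indep_vars (\<lambda>_. S) W {..<n}" and dist: "\<And>i. i < n \<Longrightarrow> distr M S (W i) = \<mu>" and n: "0 < n"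
    and L: "finite L" "L \<noteq> {}" and A: "\<And>k. k \<in> L \<Longrightarrow> A k \<in> sets S" and disj: "disjoint_family_on A L"
    and cover: "AE t in M. \<forall>i<n. \<exists>k\<in>L. W i t \<in> A k"
    and e [measurable]: "e \<in> borel_measurable S"
    and p0: "0 < p0" "\<And>k. k \<in> L \<Longrightarrow> p0 \<le> measure \<mu> (A k)"
    and i3: "integrable \<mu> (\<lambda>t. \<bar>e t\<bar> ^ 3)" and s0: "0 < s0" "\<And>k. k \<in> L \<Longrightarrow> s0 \<le> s k"
    and e1: "\<And>k. k \<in> L \<Longrightarrow> (\<integral>t. indicator (A k) t * e t \<partial>\<mu>) = 0"
    and e2: "\<And>k. k \<in> L \<Longrightarrow> (\<integral>t. indicator (A k) t * (e t)\<^sup>2 \<partial>\<mu>) = (s k)\<^sup>2 * measure \<mu> (A k)"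
    and e3: "\<And>k. k \<in> L \<Longrightarrow> (\<integral>t. indicator (A k) t * \<bar>e t\<bar> ^ 3 \<partial>\<mu>) \<le> \<kappa> * measure \<mu> (A k)"
    and \<kappa>: "0 \<le> \<kappa>" and b: "0 < b" "b \<le> 1" and l: "0 \<le> l" "l * b \<le> 1" and \<eta>: "0 < \<eta>" "\<eta> \<le> 3"
    and \<theta>: "0 \<le> \<theta>" "\<theta> < 1" and m0: "m0 = (1 - \<theta>) * (real n * p0)" and lm: "l \<le> sqrt m0"
    and q: "2 * (normal_tail a + lindeberg_err \<eta> l a ((\<kappa> / s0 ^ 3 * (1 / b ^ 3 + exp 1) + 12 * exp 2) / sqrt m0)) \<le> q" "q \<le> 1"
    and T: "T \<in> events"
    and T_ge: "\<And>t. t \<in> space M \<Longrightarrow>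
       (\<And>k. k \<in> L \<Longrightarrow> (1 - \<theta>) * (real n * measure \<mu> (A k)) \<le> real (card {i. i < n \<and> W i t \<in> A k})) \<Longrightarrow>
       (\<And>k. k \<in> L \<Longrightarrow> \<bar>\<Sum>i\<in>{i. i < n \<and> W i t \<in> A k}. e (W i t)\<bar> < (a + \<eta>) * (s k * sqrt (card {i. i < n \<and> W i t \<in> A k}))) \<Longrightarrow> t \<in> T"
  shows "(1 - q) ^ card L - real (card L) * exp (- (\<theta>\<^sup>2 * (real n * p0)) / 2)
      - real n * measure \<mu> {z \<in> space \<mu>. b * (s0 * sqrt m0) < \<bar>e z\<bar>} \<le> prob T"
proof -
  have W [measurable]: "W i \<in> measurable M S" if "i < n" for i
    using indep that by (auto simp: indep_vars_def)
  have sets\<mu> [measurable_cong]: "sets \<mu> = sets S" using dist[OF n] by auto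
  have m0p: "0 < m0" using \<theta> n p0 by (simp add: m0)
  define N where "N k t = {i. i < n \<and> W i t \<in> A k}" for k t
  define mk where "mk k = (1 - \<theta>) * (real n * measure \<mu> (A k))" for k
  define Q where "Q s = \<kappa> / s ^ 3 * (1 / b ^ 3 + exp 1) + 12 * exp 2" for s :: real
  \<comment> \<open>\<open>all_blocks_prob_ge\<close> asks for measurability at every index set; for
    infinite \<open>I\<close> the intersection makes the event empty.\<close>
  define E where "E k I = {z \<in> space (PiM I (\<lambda>_. S)). (\<exists>i\<in>I. b * (s k * sqrt (card I)) < \<bar>e (z i)\<bar>) \<or> \<bar>\<Sum>i\<in>I. e (z i)\<bar> < (a + \<eta>) * (s k * sqrt (card I))} \<inter> {z. finite I}" for k and I :: "nat set"
  \<comment> \<open>Some error exceeds the smallest truncation level of all admissible blocks. Off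
    this event the first alternative in \<open>E\<close> is impossible, so the bound on the sum
    holds.\<close>
  define kill where "kill = (\<Union>i<n. {t \<in> space M. b * (s0 * sqrt m0) < \<bar>e (W i t)\<bar>})"
  have kill: "kill \<in> events" unfolding kill_def by measurable
  have mk_ge: "m0 \<le> mk k" if "k \<in> L" for k
    unfolding m0 mk_def using p0(2)[OF that] \<theta> by (intro mult_left_mono) auto
  have q0: "0 \<le> q"
  proof -
    have "0 \<le> lindeberg_err \<eta> l a (Q s0 / sqrt m0)"
      using \<kappa> s0 b m0p \<eta> by (intro lindeberg_err_nonneg) (auto simp: Q_def)
    then show ?thesis using normal_tail_nonneg[of a] by (intro order_trans[OF _ q(1)]) (simp add: Q_def)
  qed
  let ?G = "{t \<in> space M. \<forall>k\<in>L. mk k \<le> real (card (N k t))}"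
  have main: "(1 - q) ^ card L * prob ?G \<le> prob (T \<union> kill)"
    unfolding N_def
  proof (rule all_blocks_prob_ge[OF indep L A disj cover, where E=E])
    fix k I assume k: "k \<in> L"
    show "E k I \<in> sets (PiM I (\<lambda>_. S))"
    proof (cases "finite I")
      case True
      then show ?thesis unfolding E_def by (simp, measurable)
    qed (simp add: E_def)
  next
    fix k and I :: "nat set" assume k: "k \<in> L" and I: "I \<subseteq> {..<n}" and m: "mk k \<le> real (card I)"
    have fI: "finite I" using I finite_subset by blast
    have mm: "m0 \<le> real (card I)" using m mk_ge[OF k] by linarith
    have cI: "0 < card I" using mm m0p by linarith
    have sk: "s0 \<le> s k" "0 < s k" using s0(1) s0(2)[OF k] by auto
    have Ek: "E k I = {z \<in> space (PiM I (\<lambda>_. S)). (\<exists>i\<in>I. b * (s k * sqrt (card I)) < \<bar>e (z i)\<bar>) \<or> \<bar>\<Sum>i\<in>I. e (z i)\<bar> < (a + \<eta>) * (s k * sqrt (card I))}"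
      using fI by (simp add: E_def)
    show "(1 - q) * prob {t \<in> space M. \<forall>i\<in>I. W i t \<in> A k}
        \<le> prob {t \<in> space M. (\<forall>i\<in>I. W i t \<in> A k) \<and> (\<lambda>i\<in>I. W i t) \<in> E k I}"
      unfolding Ek
    proof (rule cell_block_prob_ge[OF indep dist A[OF k] e refl _ i3 sk(2) e1[OF k] e2[OF k] e3[OF k] b l I refl cI _ \<eta>])
      show "0 < measure \<mu> (A k)" using p0 k by fastforce
      have "sqrt m0 \<le> sqrt (card I)" using mm by simp
      then show "l \<le> sqrt (card I)" using lm by linarith
      have "Q (s k) \<le> Q s0"
        unfolding Q_def using \<kappa> s0(1) sk b by (intro add_right_mono mult_right_mono divide_left_mono power_mono) auto
      moreover have "0 \<le> Q s0" unfolding Q_def using \<kappa> s0 b by simp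
      ultimately have "Q (s k) / sqrt (card I) \<le> Q s0 / sqrt m0"
        using mm m0p by (intro frac_le) auto
      moreover have "0 \<le> Q (s k) / sqrt (card I)" unfolding Q_def using \<kappa> sk b by simp
      ultimately have "lindeberg_err \<eta> l a (Q (s k) / sqrt (card I)) \<le> lindeberg_err \<eta> l a (Q s0 / sqrt m0)"
        using \<eta> l by (intro lindeberg_err_mono) auto
      then show "2 * (normal_tail a + lindeberg_err \<eta> l a ((\<kappa> / s k ^ 3 * (1 / b ^ 3 + exp 1) + 12 * exp 2) / sqrt (card I))) \<le> q"
        by (intro order_trans[OF _ q(1)]) (simp add: Q_def)
    qed
  next
    show "T \<union> kill \<in> events" using T kill by simp
    fix t assume t: "t \<in> space M"
      and cnt: "\<And>k. k \<in> L \<Longrightarrow> mk k \<le> real (card {i. i < n \<and> W i t \<in> A k})"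
      and ok: "\<And>k. k \<in> L \<Longrightarrow> (\<lambda>i\<in>{i. i < n \<and> W i t \<in> A k}. W i t) \<in> E k {i. i < n \<and> W i t \<in> A k}"
    show "t \<in> T \<union> kill"
    proof (cases "t \<in> kill")
      case False
      have "t \<in> T"
      proof (rule T_ge[OF t])
        fix k assume k: "k \<in> L"
        show "(1 - \<theta>) * (real n * measure \<mu> (A k)) \<le> real (card {i. i < n \<and> W i t \<in> A k})"
          using cnt[OF k] by (simp add: mk_def)
        have "m0 \<le> real (card (N k t))" using cnt[OF k] mk_ge[OF k] by (simp add: N_def)
        then have "b * (s0 * sqrt m0) \<le> b * (s k * sqrt (card (N k t)))"
          using b s0(1) s0(2)[OF k] m0p by (intro mult_left_mono mult_mono) auto
        moreover have "\<bar>e (W i t)\<bar> \<le> b * (s0 * sqrt m0)" if "i \<in> N k t" for i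
          using False t that by (auto simp: kill_def N_def not_less)
        ultimately have nk: "\<not> (\<exists>i\<in>N k t. b * (s k * sqrt (card (N k t))) < \<bar>e (W i t)\<bar>)"
          by (meson not_less order_trans)
        then show "\<bar>\<Sum>i\<in>{i. i < n \<and> W i t \<in> A k}. e (W i t)\<bar> < (a + \<eta>) * (s k * sqrt (card {i. i < n \<and> W i t \<in> A k}))"
          using ok[OF k] by (auto simp: E_def N_def)
      qed
      then show ?thesis by simp
    qed simp
  qed (use q q0 in auto)
  have bad: "{t \<in> space M. real (card (N k t)) < mk k} \<in> events" if "k \<in> L" for k
  proof -
    have "real (card (N k t)) = (\<Sum>i<n. indicator (A k) (W i t))" for t
      by (simp add: N_def indicator_def sum.If_cases Int_def)
    then show ?thesis using A[OF that] by (simp, measurable)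
  qed
  have "1 - prob ?G = prob (space M - ?G)"
  proof -
    have "?G = space M - (\<Union>k\<in>L. {t \<in> space M. real (card (N k t)) < mk k})" by (auto simp: not_less)
    moreover have "\<dots> \<in> events" using bad L by auto
    ultimately have "?G \<in> events" by simp
    then show ?thesis by (simp add: prob_compl)
  qed
  also have "space M - ?G = (\<Union>k\<in>L. {t \<in> space M. real (card (N k t)) < mk k})" by (auto simp: not_le)
  also have "prob \<dots> \<le> (\<Sum>k\<in>L. prob {t \<in> space M. real (card (N k t)) < mk k})"
    using L bad by (intro finite_measure_subadditive_finite) auto
  also have "\<dots> \<le> (\<Sum>k\<in>L. exp (- (\<theta>\<^sup>2 * (real n * p0)) / 2))"
  proof (rule sum_mono)
    fix k assume k: "k \<in> L"
    have pk: "prob {t \<in> space M. W i t \<in> A k} = measure \<mu> (A k)" if "i < n" for i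
      unfolding dist[OF that, symmetric] using A[OF k] W[OF that] by (subst measure_distr) (auto simp: vimage_def Int_def conj_commute)
    have "prob {t \<in> space M. real (card (N k t)) < mk k} \<le> exp (- (\<theta>\<^sup>2 * (real n * measure \<mu> (A k))) / 2)"
      unfolding N_def mk_def by (rule count_lower_tail[OF indep A[OF k] pk \<theta>(1)])
    also have "\<dots> \<le> exp (- (\<theta>\<^sup>2 * (real n * p0)) / 2)"
      using p0(2)[OF k] by (simp add: mult_left_mono)
    finally show "prob {t \<in> space M. real (card (N k t)) < mk k} \<le> exp (- (\<theta>\<^sup>2 * (real n * p0)) / 2)" .
  qed
  finally have G: "1 - prob ?G \<le> real (card L) * exp (- (\<theta>\<^sup>2 * (real n * p0)) / 2)" by simp
  have "prob kill \<le> (\<Sum>i<n. prob {t \<in> space M. b * (s0 * sqrt m0) < \<bar>e (W i t)\<bar>})"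
    unfolding kill_def by (intro finite_measure_subadditive_finite) auto
  also have "\<dots> = (\<Sum>i<n. measure \<mu> {z \<in> space \<mu>. b * (s0 * sqrt m0) < \<bar>e z\<bar>})"
  proof (rule sum.cong[OF refl])
    fix i assume i: "i \<in> {..<n}"
    have sp: "space \<mu> = space S" by (rule sets_eq_imp_space_eq[OF sets\<mu>])
    have "measure (distr M S (W i)) {z \<in> space S. b * (s0 * sqrt m0) < \<bar>e z\<bar>} = prob (W i -` {z \<in> space S. b * (s0 * sqrt m0) < \<bar>e z\<bar>} \<inter> space M)"
      using W i by (intro measure_distr) auto
    also have "W i -` {z \<in> space S. b * (s0 * sqrt m0) < \<bar>e z\<bar>} \<inter> space M = {t \<in> space M. b * (s0 * sqrt m0) < \<bar>e (W i t)\<bar>}"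
      using W[THEN measurable_space] i by auto
    finally show "prob {t \<in> space M. b * (s0 * sqrt m0) < \<bar>e (W i t)\<bar>} = measure \<mu> {z \<in> space \<mu>. b * (s0 * sqrt m0) < \<bar>e z\<bar>}"
      using dist i by (simp add: sp)
  qed
  finally have K: "prob kill \<le> real n * measure \<mu> {z \<in> space \<mu>. b * (s0 * sqrt m0) < \<bar>e z\<bar>}" by simp
  have "prob (T \<union> kill) \<le> prob T + prob kill" using T kill by (intro measure_Un_le) auto
  \<comment> \<open>Subtracting the failure probability of the counts is weaker than multiplying by
    their success probability, since the power is at most 1.\<close>
  moreover have "(1 - q) ^ card L * (1 - prob ?G) \<le> 1 * (1 - prob ?G)"
    using q q0 by (intro mult_right_mono power_le_one) auto
  then have "(1 - q) ^ card L - (1 - prob ?G) \<le> (1 - q) ^ card L * prob ?G" by (simp add: algebra_simps)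
  ultimately show ?thesis using main G K by linarith
qed

section \<open>The regular grid\<close>

definition grid_index :: "nat \<Rightarrow> ('p \<Rightarrow> nat) set" where
  "grid_index N = {k. \<forall>i. k i < N}"

text \<open>Naming a cell by its index instead of by one of its points turns the partition into a
  finite disjoint indexed family.\<close>

definition grid_cell :: "nat \<Rightarrow> ('p::finite \<Rightarrow> nat) \<Rightarrow> (real ^ 'p) set" where
  "grid_cell N k = {y \<in> unit_cube. cell_index N y = k}"

lemma cell_eq_grid_cell: "cell N x = grid_cell N (cell_index N x)"
  by (auto simp: cell_def grid_cell_def)

lemma cell_index_in_grid: "1 \<le> N \<Longrightarrow> cell_index N x \<in> grid_index N"
  by (auto simp: grid_index_def cell_index_def)

lemma card_grid_index:
  fixes N :: nat
  shows "finite (grid_index N :: ('p::finite \<Rightarrow> nat) set)" "card (grid_index N :: ('p \<Rightarrow> nat) set) = N ^ CARD('p)"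
proof -
  have eq: "(grid_index N :: ('p \<Rightarrow> nat) set) = PiE UNIV (\<lambda>_. {..<N})"
    by (auto simp: grid_index_def PiE_def Pi_def)
  show "finite (grid_index N :: ('p \<Rightarrow> nat) set)" unfolding eq by (intro finite_PiE) auto
  show "card (grid_index N :: ('p \<Rightarrow> nat) set) = N ^ CARD('p)" unfolding eq by (subst card_PiE) auto
qed

lemma disjoint_grid_cells: "disjoint_family_on (grid_cell N) L"
  by (auto simp: disjoint_family_on_def grid_cell_def)

lemma closed_unit_cube: "closed (unit_cube :: (real ^ 'p::finite) set)"
proof -
  have "(unit_cube :: (real ^ 'p) set) = (\<Inter>i. {x. 0 \<le> x $ i} \<inter> {x. x $ i \<le> 1})" by (auto simp: unit_cube_def)
  also have "closed \<dots>" by (intro closed_INT ballI closed_Int closed_Collect_le continuous_intros)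
  finally show ?thesis .
qed

lemma grid_cell_measurable [measurable]: "grid_cell N k \<in> sets (borel :: (real ^ 'p::finite) measure)"
proof -
  have [measurable]: "(unit_cube :: (real ^ 'p) set) \<in> sets borel" using closed_unit_cube by (rule borel_closed)
  have "grid_cell N k = unit_cube \<inter> (\<Inter>i\<in>UNIV. {y :: real ^ 'p. min (nat \<lfloor>y $ i * real N\<rfloor>) (N - 1) = k i})"
    by (auto simp: grid_cell_def cell_index_def fun_eq_iff)
  moreover have "{y :: real ^ 'p. min (nat \<lfloor>y $ i * real N\<rfloor>) (N - 1) = k i} \<in> sets borel" for i
  proof -
    have "(\<lambda>y :: real ^ 'p. \<lfloor>y $ i * real N\<rfloor>) \<in> measurable borel (count_space UNIV)"
      by measurable
    then have "(\<lambda>y :: real ^ 'p. min (nat \<lfloor>y $ i * real N\<rfloor>) (N - 1)) \<in> measurable borel (count_space UNIV)"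
      by (rule measurable_compose[of _ _ _ "\<lambda>z. min (nat z) (N - 1)"]) simp
    from measurable_sets[OF this, of "{k i}"] show ?thesis by (simp add: vimage_def)
  qed
  ultimately show ?thesis by (simp only:) (intro sets.Int sets.finite_INT; simp)
qed

lemma grid_cell_bounds:
  assumes N: "1 \<le> N" and y: "y \<in> grid_cell N k"
  shows "real (k i) / real N \<le> y $ i" "y $ i \<le> (real (k i) + 1) / real N"
proof -
  have c: "0 \<le> y $ i" "y $ i \<le> 1" "min (nat \<lfloor>y $ i * real N\<rfloor>) (N - 1) = k i"
    using y by (auto simp: grid_cell_def unit_cube_def cell_index_def)
  have f: "real (nat \<lfloor>y $ i * real N\<rfloor>) = of_int \<lfloor>y $ i * real N\<rfloor>" using c by simp
  have f1: "real (nat \<lfloor>y $ i * real N\<rfloor>) \<le> y $ i * real N" "y $ i * real N < real (nat \<lfloor>y $ i * real N\<rfloor>) + 1"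
    unfolding f by linarith+
  have "real (k i) \<le> y $ i * real N" using c(3) f1 by (auto simp: min_def split: if_splits)
  then show "real (k i) / real N \<le> y $ i" using N by (simp add: pos_divide_le_eq)
  have yN: "y $ i * real N \<le> 1 * real N" using c by (intro mult_right_mono) auto
  have "y $ i * real N \<le> real (k i) + 1"
  proof (cases "nat \<lfloor>y $ i * real N\<rfloor> \<le> N - 1")
    case True
    then show ?thesis using c(3) f1(2) by simp
  next
    \<comment> \<open>The clipped case: the coordinate is 1, and the index is \<open>N - 1\<close>
      because the last cell is closed on the right.\<close>
    case False
    then have "real (k i) + 1 = real N" using c(3) N by (auto simp: min_def of_nat_diff)
    then show ?thesis using yN by simp
  qed
  then show "y $ i \<le> (real (k i) + 1) / real N" using N by (simp add: pos_le_divide_eq)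
qed

lemma box_subset_grid_cell:
  fixes k :: "'p::finite \<Rightarrow> nat"
  assumes N: "1 \<le> N" and k: "k \<in> grid_index N"
  shows "box (\<chi> i. real (k i) / real N) (\<chi> i. (real (k i) + 1) / real N) \<subseteq> grid_cell N k"
proof
  fix y assume y: "y \<in> box (\<chi> i. real (k i) / real N) (\<chi> i. (real (k i) + 1) / real N)"
  have b: "real (k i) < y $ i * real N" "y $ i * real N < real (k i) + 1" for i
    using y N by (auto simp: mem_box_cart pos_divide_less_eq pos_less_divide_eq)
  have kN: "k i < N" for i using k by (auto simp: grid_index_def)
  have "cell_index N y i = k i" for i
  proof -
    have "\<lfloor>y $ i * real N\<rfloor> = int (k i)" using b[of i] by (intro floor_unique) auto
    then show ?thesis using kN[of i] by (simp add: cell_index_def)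
  qed
  moreover have "0 \<le> y $ i \<and> y $ i \<le> 1" for i
  proof
    have "0 < y $ i * real N" using b(1)[of i] by (meson le_less_trans of_nat_0_le_iff)
    then show "0 \<le> y $ i" using N by (simp add: zero_less_mult_iff)
    have "y $ i * real N \<le> 1 * real N" using b(2)[of i] kN[of i] by linarith
    then show "y $ i \<le> 1" using N by (simp add: mult_le_cancel_right)
  qed
  ultimately show "y \<in> grid_cell N k" by (auto simp: grid_cell_def unit_cube_def)
qed

lemma grid_box_volume:
  fixes k :: "'p::finite \<Rightarrow> nat"
  assumes N: "1 \<le> N"
  shows "emeasure lborel (cbox (\<chi> i. real (k i) / real N) (\<chi> i. (real (k i) + 1) / real N) :: (real ^ 'p) set) = ennreal ((1 / real N) ^ CARD('p))"
    and "emeasure lborel (box (\<chi> i. real (k i) / real N) (\<chi> i. (real (k i) + 1) / real N) :: (real ^ 'p) set) = ennreal ((1 / real N) ^ CARD('p))"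
proof -
  let ?l = "(\<chi> i. real (k i) / real N) :: real ^ 'p" and ?u = "(\<chi> i. (real (k i) + 1) / real N) :: real ^ 'p"
  have ne: "cbox ?l ?u \<noteq> {}" using N by (auto simp: interval_ne_empty_cart divide_right_mono)
  have d: "?u $ i - ?l $ i = 1 / real N" for i by (simp add: diff_divide_distrib[symmetric])
  have "measure lborel (cbox ?l ?u) = (1 / real N) ^ CARD('p)"
    unfolding content_cbox_cart[OF ne] d by simp
  then show 1: "emeasure lborel (cbox ?l ?u) = ennreal ((1 / real N) ^ CARD('p))"
    using emeasure_lborel_cbox_finite[of ?l ?u] by (simp add: emeasure_eq_ennreal_measure)
  have "emeasure lborel (box ?l ?u) = emeasure lborel (cbox ?l ?u)"
    by (simp only: emeasure_lborel_box_eq emeasure_lborel_cbox_eq)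
  then show "emeasure lborel (box ?l ?u) = ennreal ((1 / real N) ^ CARD('p))" using 1 by simp
qed

text \<open>The cell lies between an open and a closed box of equal volume, so it does not matter
  which faces belong to it.\<close>

lemma grid_cell_volume:
  fixes k :: "'p::finite \<Rightarrow> nat"
  assumes N: "1 \<le> N" and k: "k \<in> grid_index N"
  shows "emeasure lborel (grid_cell N k) = ennreal ((1 / real N) ^ CARD('p))"
proof (rule antisym)
  have "grid_cell N k \<subseteq> cbox (\<chi> i. real (k i) / real N) (\<chi> i. (real (k i) + 1) / real N)"
    using grid_cell_bounds[OF N] by (auto simp: mem_box_cart)
  then show "emeasure lborel (grid_cell N k) \<le> ennreal ((1 / real N) ^ CARD('p))"
    unfolding grid_box_volume(1)[OF N, of k, symmetric] by (intro emeasure_mono) auto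
  show "ennreal ((1 / real N) ^ CARD('p)) \<le> emeasure lborel (grid_cell N k)"
    unfolding grid_box_volume(2)[OF N, of k, symmetric]
    using box_subset_grid_cell[OF N k] by (intro emeasure_mono) auto
qed

text \<open>The Euclidean norm is bounded by the sum of the coordinates; the resulting factor p in
  place of sqrt p only enlarges \<open>bias_const\<close>.\<close>

lemma grid_cell_diameter:
  fixes x y :: "real ^ 'p::finite"
  assumes N: "1 \<le> N" and "x \<in> grid_cell N k" "y \<in> grid_cell N k"
  shows "norm (x - y) \<le> real CARD('p) / real N"
proof -
  have "\<bar>(x - y) $ i\<bar> \<le> 1 / real N" for i
    using grid_cell_bounds[OF N assms(2), of i] grid_cell_bounds[OF N assms(3), of i]
    by (auto simp: abs_le_iff add_divide_distrib)
  then have "(\<Sum>i\<in>UNIV. \<bar>(x - y) $ i\<bar>) \<le> (\<Sum>i\<in>(UNIV :: 'p set). 1 / real N)" by (intro sum_mono)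
  then show ?thesis using norm_le_l1_cart[of "x - y"] by simp
qed

section \<open>Cell probabilities and error moments over a cell\<close>

lemma (in prob_space) grid_cell_prob_bounds:
  fixes X :: "'a \<Rightarrow> real ^ 'p::finite"
  assumes dens: "distributed M lborel X (\<lambda>x. ennreal (fX x))"
    and bnd: "\<And>x. x \<in> unit_cube \<Longrightarrow> cX \<le> fX x \<and> fX x \<le> CX" and c: "0 < cX" "0 < CX"
    and N: "1 \<le> N" and k: "k \<in> grid_index N"
  shows "cX * (1 / real N) ^ CARD('p) \<le> prob {t \<in> space M. X t \<in> grid_cell N k}"
    and "prob {t \<in> space M. X t \<in> grid_cell N k} \<le> CX * (1 / real N) ^ CARD('p)"
proof -
  let ?v = "(1 / real N) ^ CARD('p)"
  have "{t \<in> space M. X t \<in> grid_cell N k} = X -` grid_cell N k \<inter> space M" by auto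
  then have eq: "ennreal (prob {t \<in> space M. X t \<in> grid_cell N k}) = (\<integral>\<^sup>+x. ennreal (fX x) * indicator (grid_cell N k) x \<partial>lborel)"
    using distributed_emeasure[OF dens, of "grid_cell N k"] by (simp add: emeasure_eq_measure)
  have "ennreal (cX * ?v) = (\<integral>\<^sup>+x. ennreal cX * indicator (grid_cell N k) x \<partial>lborel)"
    using c grid_cell_volume[OF N k] by (subst nn_integral_cmult_indicator) (auto simp: ennreal_mult)
  also have "\<dots> \<le> (\<integral>\<^sup>+x. ennreal (fX x) * indicator (grid_cell N k) x \<partial>lborel)"
    using bnd by (intro nn_integral_mono) (auto simp: indicator_def grid_cell_def intro!: ennreal_leI)
  finally show "cX * ?v \<le> prob {t \<in> space M. X t \<in> grid_cell N k}"
    unfolding eq[symmetric] by simp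
  have "(\<integral>\<^sup>+x. ennreal (fX x) * indicator (grid_cell N k) x \<partial>lborel) \<le> (\<integral>\<^sup>+x. ennreal CX * indicator (grid_cell N k) x \<partial>lborel)"
    using bnd by (intro nn_integral_mono) (auto simp: indicator_def grid_cell_def intro!: ennreal_leI)
  also have "\<dots> = ennreal (CX * ?v)"
    using c grid_cell_volume[OF N k] by (subst nn_integral_cmult_indicator) (auto simp: ennreal_mult)
  finally show "prob {t \<in> space M. X t \<in> grid_cell N k} \<le> CX * ?v"
    unfolding eq[symmetric] using c by simp
qed

text \<open>The extension by 0 may jump at the boundary of the cube, but it is a continuous function
  on a closed set times the indicator of that set.\<close>

lemma holder_class_borel:
  assumes m: "m \<in> holder_class \<alpha> CH" and \<alpha>: "0 < \<alpha>"
  shows "m \<in> borel_measurable borel"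
proof -
  have H: "\<bar>m x - m y\<bar> \<le> CH * norm (x - y) powr \<alpha>" if "x \<in> unit_cube" "y \<in> unit_cube" for x y
    using m that by (auto simp: holder_class_def)
  have "continuous_on unit_cube m"
    unfolding continuous_on_def
  proof
    fix x :: "real ^ 'a" assume x: "x \<in> unit_cube"
    have "((\<lambda>y. CH * norm (y - x) powr \<alpha>) \<longlongrightarrow> CH * norm (x - x) powr \<alpha>) (at x within unit_cube)"
      using \<alpha> by (intro tendsto_intros) auto
    then have "((\<lambda>y. CH * norm (y - x) powr \<alpha>) \<longlongrightarrow> 0) (at x within unit_cube)" using \<alpha> by simp
    moreover have "\<forall>\<^sub>F y in at x within unit_cube. norm (m y - m x) \<le> CH * norm (y - x) powr \<alpha>"
      using H x by (auto simp: eventually_at_filter)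
    ultimately have "((\<lambda>y. m y - m x) \<longlongrightarrow> 0) (at x within unit_cube)" by (rule Lim_null_comparison[rotated])
    then show "(m \<longlongrightarrow> m x) (at x within unit_cube)" by (simp add: LIM_zero_iff)
  qed
  then have "(\<lambda>x. indicator unit_cube x *\<^sub>R m x) \<in> borel_measurable borel"
    by (intro borel_measurable_continuous_on_indicator borel_closed closed_unit_cube)
  moreover have "(\<lambda>x. indicator unit_cube x *\<^sub>R m x) = m"
    using m by (auto simp: holder_class_def indicator_def fun_eq_iff)
  ultimately show ?thesis by simp
qed

text \<open>The event that \<open>X\<close> lies in \<open>B\<close> belongs to the sigma-algebra
  generated by \<open>X\<close>, so conditional moments may be integrated over it. This supplies
  exact centring, the variance and a third moment bound proportional to the cell
  probability.\<close>

lemma (in prob_space) cell_moments: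
  fixes X :: "'a \<Rightarrow> real ^ 'p::finite" and \<epsilon> :: "'a \<Rightarrow> real"
  defines "FX \<equiv> vimage_algebra (space M) X borel"
  assumes X [measurable]: "X \<in> borel_measurable M" and \<epsilon> [measurable]: "\<epsilon> \<in> borel_measurable M"
    and B [measurable]: "B \<in> sets borel"
    and i1: "integrable M \<epsilon>" and i2: "integrable M (\<lambda>t. (\<epsilon> t)\<^sup>2)" and i3: "integrable M (\<lambda>t. \<bar>\<epsilon> t\<bar> ^ 3)"
    and c1: "AE t in M. real_cond_exp M FX \<epsilon> t = 0"
    and c2: "AE t in M. real_cond_exp M FX (\<lambda>t. (\<epsilon> t)\<^sup>2) t = \<sigma>2 (X t)" and \<sigma>2 [measurable]: "\<sigma>2 \<in> borel_measurable borel"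
    and c3: "AE t in M. real_cond_exp M FX (\<lambda>t. \<bar>\<epsilon> t\<bar> ^ 3) t \<le> \<kappa>"
  shows "expectation (\<lambda>t. indicator B (X t) * \<epsilon> t) = 0"
    and "expectation (\<lambda>t. indicator B (X t) * (\<epsilon> t)\<^sup>2) = expectation (\<lambda>t. \<sigma>2 (X t) * indicator B (X t))"
    and "expectation (\<lambda>t. indicator B (X t) * \<bar>\<epsilon> t\<bar> ^ 3) \<le> \<kappa> * prob {t \<in> space M. X t \<in> B}"
proof -
  have sub: "subalgebra M FX"
    unfolding subalgebra_def FX_def using measurable_sets[OF X] by (auto simp: sets_vimage_algebra2)
  interpret sigma_finite_subalgebra M FX
    by (rule finite_measure_subalgebra_is_sigma_finite) (unfold_locales, rule sub)
  define G where "G = {t \<in> space M. X t \<in> B}"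
  have G: "G \<in> sets FX" unfolding FX_def G_def by (subst sets_vimage_algebra2) auto
  have G' [measurable]: "G \<in> events" unfolding G_def by measurable
  have ind: "indicator B (X t) = (indicator G t :: real)" if "t \<in> space M" for t
    using that by (auto simp: G_def indicator_def)
  have red: "expectation (\<lambda>t. indicator B (X t) * g t) = expectation (\<lambda>t. indicator G t * real_cond_exp M FX g t)"
    if "integrable M g" for g
  proof -
    have "expectation (\<lambda>t. indicator B (X t) * g t) = expectation (\<lambda>t. indicator G t * g t)"
      using ind by (intro Bochner_Integration.integral_cong) auto
    also have "\<dots> = expectation (\<lambda>t. indicator G t * real_cond_exp M FX g t)"
      using real_cond_exp_intA[OF that G] by (simp add: set_lebesgue_integral_def)
    finally show ?thesis .
  qed
  have [measurable]: "real_cond_exp M FX g \<in> borel_measurable M" for g by (rule borel_measurable_cond_exp2)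
  show "expectation (\<lambda>t. indicator B (X t) * \<epsilon> t) = 0"
    unfolding red[OF i1] using c1 by (intro integral_eq_zero_AE) auto
  have "expectation (\<lambda>t. indicator G t * real_cond_exp M FX (\<lambda>t. (\<epsilon> t)\<^sup>2) t) = expectation (\<lambda>t. \<sigma>2 (X t) * indicator B (X t))"
    using c2 AE_space by (intro integral_cong_AE) (auto simp: ind)
  then show "expectation (\<lambda>t. indicator B (X t) * (\<epsilon> t)\<^sup>2) = expectation (\<lambda>t. \<sigma>2 (X t) * indicator B (X t))"
    unfolding red[OF i2] .
  have "expectation (\<lambda>t. indicator G t * real_cond_exp M FX (\<lambda>t. \<bar>\<epsilon> t\<bar> ^ 3) t) \<le> expectation (\<lambda>t. \<kappa> * indicator G t)"
  proof (rule integral_mono_AE)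
    show "integrable M (\<lambda>t. indicator G t * real_cond_exp M FX (\<lambda>t. \<bar>\<epsilon> t\<bar> ^ 3) t)"
      using integrable_mult_indicator[OF G' real_cond_exp_int(1)[OF i3]] by simp
    show "integrable M (\<lambda>t. \<kappa> * indicator G t)"
      by (intro integrable_mult_right integrable_real_indicator) (auto simp: emeasure_eq_measure)
    show "AE t in M. indicator G t * real_cond_exp M FX (\<lambda>t. \<bar>\<epsilon> t\<bar> ^ 3) t \<le> \<kappa> * indicator G t"
      using c3 by eventually_elim (auto simp: indicator_def)
  qed
  also have "\<dots> = \<kappa> * prob G" using sets.sets_into_space[OF G'] by (simp add: Int_absorb2)
  finally show "expectation (\<lambda>t. indicator B (X t) * \<bar>\<epsilon> t\<bar> ^ 3) \<le> \<kappa> * prob {t \<in> space M. X t \<in> B}"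
    unfolding red[OF i3] G_def .
qed

section \<open>The confidence band\<close>

text \<open>The deterministic core. \<open>D\<close> bounds the bias, \<open>S\<close> is the error
  sum of a cell, \<open>cnt\<close> its count and \<open>np\<close> the expected count. The band is
  scaled by \<open>np\<close>, whereas the noise is controlled on the scale of the random
  \<open>cnt\<close>; lowering the level from \<open>c\<close> to
  \<open>c - \<theta> * c - d\<close> absorbs this mismatch and the bias.\<close>

lemma band_halfwidth_ge:
  fixes D S c d s \<theta> np cnt :: real
  assumes s: "0 < s" and np: "0 < np" and cnt: "0 < cnt" "(1 - \<theta>) * np \<le> cnt" and \<theta>: "0 \<le> \<theta>" "\<theta> < 1"
    and d: "D * sqrt np / s \<le> d" "0 \<le> d" "d \<le> c" and S: "\<bar>S\<bar> < (c - \<theta> * c - d) * (s * sqrt cnt)"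
  shows "D + \<bar>S\<bar> / cnt \<le> c * (s / sqrt np)"
proof -
  define \<rho> where "\<rho> = sqrt cnt / sqrt np"
  have \<rho>0: "0 < \<rho>" using np cnt by (simp add: \<rho>_def)
  have "1 - \<theta> \<le> \<rho>"
  proof -
    \<comment> \<open>A lower deviation of the count by the fraction \<theta> changes its square
      root by at most the same fraction.\<close>
    have "(1 - \<theta>)\<^sup>2 \<le> 1 - \<theta>" using \<theta> by (simp add: power2_eq_square mult_left_le_one_le)
    also have "\<dots> \<le> cnt / np" using cnt np by (simp add: pos_le_divide_eq)
    finally have "1 - \<theta> \<le> sqrt (cnt / np)" by (rule real_le_rsqrt)
    then show ?thesis by (simp add: \<rho>_def real_sqrt_divide)
  qed
  have "c - \<theta> * c - d \<le> (1 - \<theta>) * (c - d)" using \<theta> d by (simp add: algebra_simps)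
  also have "\<dots> \<le> \<rho> * (c - d)" using \<open>1 - \<theta> \<le> \<rho>\<close> d by (intro mult_right_mono) auto
  finally have 1: "c - \<theta> * c - d \<le> \<rho> * (c - d)" .
  have "\<bar>S\<bar> \<le> (\<rho> * (c - d)) * (s * sqrt cnt)"
  proof -
    have "0 \<le> s * sqrt cnt" using s cnt by simp
    from mult_right_mono[OF 1 this] show ?thesis using S by linarith
  qed
  then have "\<bar>S\<bar> / cnt \<le> (\<rho> * (c - d)) * (s * sqrt cnt) / cnt" using cnt by (intro divide_right_mono) auto
  also have "\<dots> = (c - d) * (s / sqrt np)"
  proof -
    have "sqrt cnt * sqrt cnt = cnt" using cnt by simp
    then show ?thesis using cnt np by (simp add: \<rho>_def field_simps)
  qed
  finally have 2: "\<bar>S\<bar> / cnt \<le> (c - d) * (s / sqrt np)" .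
  have "D \<le> d * (s / sqrt np)" using d(1) s np by (simp add: field_simps)
  moreover have "(c - d) * (s / sqrt np) = c * (s / sqrt np) - d * (s / sqrt np)" by (rule left_diff_distrib)
  ultimately show ?thesis using 2 by linarith
qed

locale histogram_model = prob_space M for M :: "'w measure" +
  fixes X :: "'w \<Rightarrow> real ^ 'p::finite" and \<epsilon> :: "'w \<Rightarrow> real"
    and Xs :: "nat \<Rightarrow> 'w \<Rightarrow> real ^ 'p" and eps :: "nat \<Rightarrow> 'w \<Rightarrow> real"
    and fX \<sigma>2 :: "real ^ 'p \<Rightarrow> real" and cX CX c\<sigma> C\<sigma> \<alpha> CH \<kappa> :: real
  assumes rvX [measurable]: "X \<in> borel_measurable M" and rv\<epsilon> [measurable]: "\<epsilon> \<in> borel_measurable M"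
    and rvXs [measurable]: "\<And>i. Xs i \<in> borel_measurable M" and rveps [measurable]: "\<And>i. eps i \<in> borel_measurable M"
    and indep: "indep_vars (\<lambda>_. borel) (\<lambda>i \<omega>. (Xs i \<omega>, eps i \<omega>)) UNIV"
    and ident: "\<And>i. distr M borel (\<lambda>\<omega>. (Xs i \<omega>, eps i \<omega>)) = distr M borel (\<lambda>\<omega>. (X \<omega>, \<epsilon> \<omega>))"
    and X_cube: "AE \<omega> in M. X \<omega> \<in> unit_cube"
    and dens: "distributed M lborel X (\<lambda>x. ennreal (fX x))"
    and consts_pos: "0 < cX" "0 < CX" "0 < c\<sigma>" "0 < C\<sigma>"
    and dens_bounds: "\<And>x. x \<in> unit_cube \<Longrightarrow> cX \<le> fX x \<and> fX x \<le> CX"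
    and cond_mean: "AE \<omega> in M. real_cond_exp M (vimage_algebra (space M) X borel) \<epsilon> \<omega> = 0"
    and \<sigma>2_meas [measurable]: "\<sigma>2 \<in> borel_measurable borel"
    and cond_var: "AE \<omega> in M. real_cond_exp M (vimage_algebra (space M) X borel) (\<lambda>\<omega>. (\<epsilon> \<omega>)\<^sup>2) \<omega> = \<sigma>2 (X \<omega>)"
    and \<sigma>2_bounds: "\<And>x. x \<in> unit_cube \<Longrightarrow> c\<sigma> \<le> \<sigma>2 x \<and> \<sigma>2 x \<le> C\<sigma>"
    and \<alpha>: "0 < \<alpha>" and CH: "0 < CH" and \<kappa>_nonneg: "0 \<le> \<kappa>"
    and int3: "integrable M (\<lambda>\<omega>. \<bar>\<epsilon> \<omega>\<bar> ^ 3)"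
    and third: "AE \<omega> in M. real_cond_exp M (vimage_algebra (space M) X borel) (\<lambda>\<omega>. \<bar>\<epsilon> \<omega>\<bar> ^ 3) \<omega> \<le> \<kappa>"
begin

definition P :: "nat \<Rightarrow> ('p \<Rightarrow> nat) \<Rightarrow> real" where
  "P N k = prob {\<omega> \<in> space M. X \<omega> \<in> grid_cell N k}"

definition V :: "nat \<Rightarrow> ('p \<Rightarrow> nat) \<Rightarrow> real" where
  "V N k = expectation (\<lambda>\<omega>. \<sigma>2 (X \<omega>) * indicator (grid_cell N k) (X \<omega>))"

definition band_event :: "nat \<Rightarrow> nat \<Rightarrow> real \<Rightarrow> (real ^ 'p \<Rightarrow> real) \<Rightarrow> 'w set" where
  "band_event N n c m = {\<omega> \<in> space M. \<forall>x \<in> unit_cube.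
     \<bar>m x - hist_est N n (\<lambda>j. Xs j \<omega>) (\<lambda>j. m (Xs j \<omega>) + eps j \<omega>) x\<bar>
       \<le> c * ((P N (cell_index N x))\<^sup>2 / V N (cell_index N x) * real n) powr (- 1 / 2)}"

lemma P_bounds:
  assumes "1 \<le> N" "k \<in> grid_index N"
  shows "cX * (1 / real N) ^ CARD('p) \<le> P N k" "P N k \<le> CX * (1 / real N) ^ CARD('p)" "0 < P N k"
proof -
  show 1: "cX * (1 / real N) ^ CARD('p) \<le> P N k" "P N k \<le> CX * (1 / real N) ^ CARD('p)"
    unfolding P_def using grid_cell_prob_bounds[OF dens dens_bounds consts_pos(1,2) assms] by simp_all
  have "0 < cX * (1 / real N) ^ CARD('p)" using assms consts_pos by simp
  then show "0 < P N k" using 1 by linarith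
qed

lemma V_ge: "c\<sigma> * P N k \<le> V N k"
proof -
  have ev: "{\<omega> \<in> space M. X \<omega> \<in> grid_cell N k} \<in> events" by measurable
  have "c\<sigma> * P N k = expectation (\<lambda>\<omega>. c\<sigma> * indicator {\<omega> \<in> space M. X \<omega> \<in> grid_cell N k} \<omega>)"
    using sets.sets_into_space[OF ev] by (simp add: P_def Int_absorb2)
  also have "\<dots> \<le> V N k" unfolding V_def
  proof (rule integral_mono)
    show "integrable M (\<lambda>\<omega>. c\<sigma> * indicator {\<omega> \<in> space M. X \<omega> \<in> grid_cell N k} \<omega>)"
      using ev by (intro integrable_mult_right integrable_real_indicator) (auto simp: emeasure_eq_measure)
    show "integrable M (\<lambda>\<omega>. \<sigma>2 (X \<omega>) * indicator (grid_cell N k) (X \<omega>))"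
    proof (rule integrable_const_bound[where B=C\<sigma>])
      show "AE \<omega> in M. norm (\<sigma>2 (X \<omega>) * indicator (grid_cell N k) (X \<omega>)) \<le> C\<sigma>"
      proof (rule AE_I2)
        fix \<omega> show "norm (\<sigma>2 (X \<omega>) * indicator (grid_cell N k) (X \<omega>)) \<le> C\<sigma>"
          using \<sigma>2_bounds[of "X \<omega>"] consts_pos by (auto simp: indicator_def grid_cell_def)
      qed
    qed measurable
    fix \<omega> assume "\<omega> \<in> space M"
    then show "c\<sigma> * indicator {\<omega> \<in> space M. X \<omega> \<in> grid_cell N k} \<omega> \<le> \<sigma>2 (X \<omega>) * indicator (grid_cell N k) (X \<omega>)"
      using \<sigma>2_bounds[of "X \<omega>"] by (auto simp: indicator_def grid_cell_def)
  qed
  finally show ?thesis .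
qed

lemma int1: "integrable M \<epsilon>" and int2: "integrable M (\<lambda>\<omega>. (\<epsilon> \<omega>)\<^sup>2)"
proof -
  have i: "integrable M (\<lambda>\<omega>. 1 + \<bar>\<epsilon> \<omega>\<bar> ^ 3)" using int3 by simp
  show "integrable M \<epsilon>"
    by (rule integrable_of_abs_le[OF i]) (use abs_power_le_one_plus[of 1 3] in auto)
  show "integrable M (\<lambda>\<omega>. (\<epsilon> \<omega>)\<^sup>2)"
    by (rule integrable_of_abs_le[OF i]) (use abs_power_le_one_plus[of 2 3] in auto)
qed

text \<open>Uncountably many \<open>x\<close> are involved, but the estimator is constant on each
  cell. The condition on a cell thus says that one random variable lies in an intersection of closed
  intervals, which is closed whatever \<open>m\<close> is.\<close>

lemma band_event_measurable:
  assumes m: "m \<in> holder_class \<alpha> CH" and N: "1 \<le> N"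
  shows "band_event N n c m \<in> events"
proof -
  have mb [measurable]: "m \<in> borel_measurable borel" by (rule holder_class_borel[OF m \<alpha>])
  define H where "H k \<omega> = (if (\<Sum>i<n. indicator (grid_cell N k) (Xs i \<omega>)) = (0::real) then 0
     else (\<Sum>j<n. (m (Xs j \<omega>) + eps j \<omega>) * indicator (grid_cell N k) (Xs j \<omega>)) / (\<Sum>i<n. indicator (grid_cell N k) (Xs i \<omega>)))" for k \<omega>
  define w where "w k = c * ((P N k)\<^sup>2 / V N k * real n) powr (- 1 / 2)" for k
  have Hm [measurable]: "H k \<in> borel_measurable M" for k unfolding H_def by measurable
  have cnt: "(\<Sum>i<n. indicator (grid_cell N k) (Xs i \<omega>)) = real (card {i. i < n \<and> Xs i \<omega> \<in> grid_cell N k})" for k \<omega>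
    by (simp add: indicator_def sum.If_cases Int_def)
  have Heq: "hist_est N n (\<lambda>j. Xs j \<omega>) (\<lambda>j. m (Xs j \<omega>) + eps j \<omega>) x = H (cell_index N x) \<omega>" for \<omega> x
    unfolding hist_est_def H_def Let_def cell_eq_grid_cell cnt of_nat_eq_0_iff ..
  have "(\<forall>x\<in>unit_cube. \<bar>m x - H (cell_index N x) \<omega>\<bar> \<le> w (cell_index N x))
      \<longleftrightarrow> (\<forall>k\<in>grid_index N. \<forall>x\<in>grid_cell N k. \<bar>m x - H k \<omega>\<bar> \<le> w k)" for \<omega>
    using cell_index_in_grid[OF N] by (auto simp: grid_cell_def)
  then have "band_event N n c m = {\<omega> \<in> space M. \<forall>k\<in>grid_index N. \<forall>x\<in>grid_cell N k. \<bar>m x - H k \<omega>\<bar> \<le> w k}"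
    unfolding band_event_def Heq w_def[symmetric] by simp
  also have "\<dots> = (\<Inter>k\<in>grid_index N. H k -` (\<Inter>x\<in>grid_cell N k. cball (m x) (w k)) \<inter> space M)"
    using cell_index_in_grid[OF N] by (auto simp: dist_real_def)
  finally have eq: "band_event N n c m = \<dots>" .
  have cl: "closed (\<Inter>x\<in>grid_cell N k. cball (m x) (w k))" for k by (intro closed_INT ballI closed_cball)
  have ev: "H k -` (\<Inter>x\<in>grid_cell N k. cball (m x) (w k)) \<inter> space M \<in> events" for k
    by (rule measurable_sets[OF Hm borel_closed[OF cl]])
  have ne: "grid_index N \<noteq> ({} :: ('p \<Rightarrow> nat) set)" using cell_index_in_grid[OF N] by blast
  have "(\<Inter>k\<in>grid_index N. H k -` (\<Inter>x\<in>grid_cell N k. cball (m x) (w k)) \<inter> space M) \<in> events"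
    by (rule sets.finite_INT[OF card_grid_index(1) ne ev])
  then show ?thesis by (simp only: eq)
qed

lemma band_prob_ge:
  fixes c \<theta> d \<eta> b q :: real
  defines "v \<equiv> \<lambda>N. (1 / real N) ^ CARD('p)"
  assumes m: "m \<in> holder_class \<alpha> CH" and N: "1 \<le> N" and n: "0 < n"
    and d: "CH * (real CARD('p) / real N) powr \<alpha> * sqrt (real n * (CX * v N)) / sqrt c\<sigma> \<le> d" "d \<le> c"
    and b: "0 < b" "b \<le> 1" and c: "0 < c" "c * b \<le> 1" and \<eta>: "0 < \<eta>" "\<eta> \<le> 3" and \<theta>: "0 \<le> \<theta>" "\<theta> < 1"
    and m0: "m0 = (1 - \<theta>) * (real n * (cX * v N))" and cm: "c \<le> sqrt m0"
    and a: "a = c - \<theta> * c - d - \<eta>"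
    and q: "2 * (normal_tail a + lindeberg_err \<eta> c a ((\<kappa> / sqrt c\<sigma> ^ 3 * (1 / b ^ 3 + exp 1) + 12 * exp 2) / sqrt m0)) \<le> q" "q \<le> 1"
  shows "(1 - q) ^ (N ^ CARD('p)) - real (N ^ CARD('p)) * exp (- (\<theta>\<^sup>2 * (real n * (cX * v N))) / 2)
     - real n * prob {\<omega> \<in> space M. b * (sqrt c\<sigma> * sqrt m0) < \<bar>\<epsilon> \<omega>\<bar>} \<le> prob (band_event N n c m)"
proof -
  define \<mu> where "\<mu> = distr M borel (\<lambda>\<omega>. (X \<omega>, \<epsilon> \<omega>))"
  define W where "W i \<omega> = (Xs i \<omega>, eps i \<omega>)" for i \<omega>
  define A where "A k = grid_cell N k \<times> (UNIV :: real set)" for k :: "'p \<Rightarrow> nat"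
  define L where "L = (grid_index N :: ('p \<Rightarrow> nat) set)"
  \<comment> \<open>The standard deviation of an error given that its design point lies in cell
    \<open>k\<close>.\<close>
  define s where "s k = sqrt (V N k / P N k)" for k
  have XE [measurable]: "(\<lambda>\<omega>. (X \<omega>, \<epsilon> \<omega>)) \<in> measurable M borel" unfolding borel_prod[symmetric] by measurable
  have A [measurable]: "A k \<in> sets borel" for k
    unfolding A_def borel_prod[symmetric] by (intro pair_measureI) auto
  have snd [measurable]: "(snd :: (real ^ 'p) \<times> real \<Rightarrow> real) \<in> borel_measurable borel" by (simp add: borel_prod[symmetric])
  have mu: "measure \<mu> (A k) = P N k" for k
  proof -
    have "measure \<mu> (A k) = prob ((\<lambda>\<omega>. (X \<omega>, \<epsilon> \<omega>)) -` A k \<inter> space M)"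
      unfolding \<mu>_def by (rule measure_distr) measurable
    also have "(\<lambda>\<omega>. (X \<omega>, \<epsilon> \<omega>)) -` A k \<inter> space M = {\<omega> \<in> space M. X \<omega> \<in> grid_cell N k}" by (auto simp: A_def)
    finally show ?thesis by (simp add: P_def)
  qed
  have intmu: "(\<integral>z. indicator (A k) z * g (snd z) \<partial>\<mu>) = expectation (\<lambda>\<omega>. indicator (grid_cell N k) (X \<omega>) * g (\<epsilon> \<omega>))"
    if [measurable]: "g \<in> borel_measurable borel" for g :: "real \<Rightarrow> real" and k
  proof -
    have "(\<integral>z. indicator (A k) z * g (snd z) \<partial>\<mu>) = expectation (\<lambda>\<omega>. indicator (A k) (X \<omega>, \<epsilon> \<omega>) * g (snd (X \<omega>, \<epsilon> \<omega>)))"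
      unfolding \<mu>_def by (rule integral_distr) measurable
    also have "\<dots> = expectation (\<lambda>\<omega>. indicator (grid_cell N k) (X \<omega>) * g (\<epsilon> \<omega>))"
      by (intro Bochner_Integration.integral_cong) (auto simp: A_def indicator_def)
    finally show ?thesis .
  qed
  note cmom = cell_moments[OF rvX rv\<epsilon> _ int1 int2 int3 cond_mean cond_var \<sigma>2_meas third]
  have Pp: "0 < P N k" if "k \<in> L" for k using P_bounds(3)[OF N] that by (simp add: L_def)
  have s2: "(s k)\<^sup>2 = V N k / P N k" "sqrt c\<sigma> \<le> s k" "0 < s k" if "k \<in> L" for k
  proof -
    have "c\<sigma> \<le> V N k / P N k" using V_ge[of N k] Pp[OF that] by (simp add: pos_le_divide_eq)
    then show "(s k)\<^sup>2 = V N k / P N k" "sqrt c\<sigma> \<le> s k" "0 < s k" using consts_pos by (auto simp: s_def)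
  qed
  define D where "D = CH * (real CARD('p) / real N) powr \<alpha>"
  have D0: "0 \<le> D" using CH by (simp add: D_def)
  have main: "(1 - q) ^ card L - real (card L) * exp (- (\<theta>\<^sup>2 * (real n * (cX * v N))) / 2)
     - real n * measure \<mu> {z \<in> space \<mu>. b * (sqrt c\<sigma> * sqrt m0) < \<bar>snd z\<bar>} \<le> prob (band_event N n c m)"
  proof (rule simultaneous_sums_prob_ge[where W=W and S=borel and A=A and s=s and \<kappa>=\<kappa> and l=c and a=a])
    show "indep_vars (\<lambda>_. borel) W {..<n}" unfolding W_def by (rule indep_vars_subset[OF indep]) simp
    show "distr M borel (W i) = \<mu>" for i unfolding W_def \<mu>_def by (rule ident)
    show "finite L" unfolding L_def by (rule card_grid_index)
    show "L \<noteq> {}" using cell_index_in_grid[OF N] by (auto simp: L_def)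
    show "disjoint_family_on A L" using disjoint_grid_cells[of N L] by (auto simp: A_def disjoint_family_on_def)
    have Xi: "AE \<omega> in M. Xs i \<omega> \<in> unit_cube" for i
    proof -
      have cl: "{z \<in> space borel. fst z \<in> (unit_cube :: (real ^ 'p) set)} \<in> sets (borel :: ((real ^ 'p) \<times> real) measure)"
      proof -
        have "unit_cube \<times> UNIV \<in> sets (borel \<Otimes>\<^sub>M borel :: ((real ^ 'p) \<times> real) measure)"
          using borel_closed[OF closed_unit_cube] by (intro pair_measureI) auto
        also have "unit_cube \<times> (UNIV :: real set) = {z \<in> space borel. fst z \<in> (unit_cube :: (real ^ 'p) set)}" by auto
        finally show ?thesis unfolding borel_prod .
      qed
      have "AE z in distr M borel (\<lambda>\<omega>. (X \<omega>, \<epsilon> \<omega>)). fst z \<in> unit_cube"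
        unfolding AE_distr_iff[OF XE cl] using X_cube by simp
      then have "AE z in distr M borel (W i). fst z \<in> unit_cube" unfolding W_def ident .
      moreover have "W i \<in> measurable M borel" unfolding W_def borel_prod[symmetric] by measurable
      ultimately show ?thesis using AE_distr_iff[OF _ cl, of "W i" M] by (simp add: W_def)
    qed
    then have "AE \<omega> in M. \<forall>i\<in>{..<n}. Xs i \<omega> \<in> unit_cube" by (intro AE_finite_allI) auto
    then show "AE \<omega> in M. \<forall>i<n. \<exists>k\<in>L. W i \<omega> \<in> A k"
    proof eventually_elim
      case (elim \<omega>)
      show ?case
      proof (intro allI impI)
        fix i assume "i < n"
        then have "W i \<omega> \<in> A (cell_index N (Xs i \<omega>))" using elim by (simp add: W_def A_def grid_cell_def)
        then show "\<exists>k\<in>L. W i \<omega> \<in> A k" unfolding L_def using cell_index_in_grid[OF N] by blast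
      qed
    qed
    show "0 < cX * v N" using consts_pos N by (simp add: v_def)
    show "cX * v N \<le> measure \<mu> (A k)" if "k \<in> L" for k
      unfolding mu v_def using P_bounds(1)[OF N] that by (simp add: L_def)
    show "integrable \<mu> (\<lambda>z. \<bar>snd z\<bar> ^ 3)"
      unfolding \<mu>_def using int3 by (subst integrable_distr_eq) auto
    show "sqrt c\<sigma> \<le> s k" if "k \<in> L" for k by (rule s2[OF that])
    show "(\<integral>z. indicator (A k) z * snd z \<partial>\<mu>) = 0" for k
      using intmu[of "\<lambda>x. x" k] cmom(1)[of "grid_cell N k"] by simp
    show "(\<integral>z. indicator (A k) z * (snd z)\<^sup>2 \<partial>\<mu>) = (s k)\<^sup>2 * measure \<mu> (A k)" if "k \<in> L" for k
      using intmu[of "\<lambda>x. x\<^sup>2" k] cmom(2)[of "grid_cell N k"] s2(1)[OF that] Pp[OF that] unfolding mu by (simp add: V_def)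
    show "(\<integral>z. indicator (A k) z * \<bar>snd z\<bar> ^ 3 \<partial>\<mu>) \<le> \<kappa> * measure \<mu> (A k)" for k
      using intmu[of "\<lambda>x. \<bar>x\<bar> ^ 3" k] cmom(3)[of "grid_cell N k"] unfolding mu by (simp add: P_def)
    show "band_event N n c m \<in> events" by (rule band_event_measurable[OF m N])
  next
    fix \<omega> assume \<omega>: "\<omega> \<in> space M"
      and cnt: "\<And>k. k \<in> L \<Longrightarrow> (1 - \<theta>) * (real n * measure \<mu> (A k)) \<le> real (card {i. i < n \<and> W i \<omega> \<in> A k})"
      and sums: "\<And>k. k \<in> L \<Longrightarrow> \<bar>\<Sum>i\<in>{i. i < n \<and> W i \<omega> \<in> A k}. snd (W i \<omega>)\<bar> < (a + \<eta>) * (s k * sqrt (card {i. i < n \<and> W i \<omega> \<in> A k}))"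
    show "\<omega> \<in> band_event N n c m"
      unfolding band_event_def
    proof (intro CollectI conjI ballI \<omega>)
      fix x :: "real ^ 'p" assume x: "x \<in> unit_cube"
      define k where "k = cell_index N x"
      have k: "k \<in> L" unfolding k_def L_def by (rule cell_index_in_grid[OF N])
      have xk: "x \<in> grid_cell N k" using x by (simp add: grid_cell_def k_def)
      have cellx: "cell N x = grid_cell N k" by (simp add: cell_eq_grid_cell k_def)
      define I where "I = {i. i < n \<and> Xs i \<omega> \<in> grid_cell N k}"
      have I: "{i. i < n \<and> W i \<omega> \<in> A k} = I" by (auto simp: W_def A_def I_def)
      have fI: "finite I" by (simp add: I_def)
      have np: "0 < real n * P N k" using n Pp[OF k] by simp
      have c1: "(1 - \<theta>) * (real n * P N k) \<le> real (card I)" using cnt[OF k] unfolding I mu .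
      have c0: "0 < real (card I)" using c1 np \<theta> by (smt (verit) mult_pos_pos)
      define E where "E = (\<Sum>i\<in>I. eps i \<omega>)"
      have E: "\<bar>E\<bar> < (c - \<theta> * c - d) * (s k * sqrt (card I))"
        using sums[OF k] unfolding I a by (simp add: W_def E_def)
      define mh where "mh = hist_est N n (\<lambda>j. Xs j \<omega>) (\<lambda>j. m (Xs j \<omega>) + eps j \<omega>) x"
      have mh: "mh = ((\<Sum>i\<in>I. m (Xs i \<omega>)) + E) / real (card I)"
      proof -
        have "(\<Sum>j<n. (m (Xs j \<omega>) + eps j \<omega>) * indicator (grid_cell N k) (Xs j \<omega>)) = (\<Sum>j\<in>I. m (Xs j \<omega>) + eps j \<omega>)"
          by (simp add: indicator_def if_distrib sum.If_cases I_def Int_def cong: if_cong)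
        then show ?thesis using c0 unfolding mh_def hist_est_def cellx Let_def I_def[symmetric]
          by (simp add: sum.distrib E_def)
      qed
      have "\<bar>m x - mh\<bar> \<le> D + \<bar>E\<bar> / real (card I)"
      proof -
        have "(m x - mh) * card I = (\<Sum>i\<in>I. m x - m (Xs i \<omega>)) - E"
          using c0 unfolding mh by (simp add: field_simps sum_subtractf)
        then have "\<bar>m x - mh\<bar> * card I \<le> \<bar>\<Sum>i\<in>I. m x - m (Xs i \<omega>)\<bar> + \<bar>E\<bar>"
          by (metis abs_mult abs_of_nat abs_triangle_ineq4)
        also have "\<bar>\<Sum>i\<in>I. m x - m (Xs i \<omega>)\<bar> \<le> (\<Sum>i\<in>I. D)"
        proof (rule order_trans[OF sum_abs], rule sum_mono)
          fix i assume i: "i \<in> I"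
          then have xi: "Xs i \<omega> \<in> grid_cell N k" by (simp add: I_def)
          then have "Xs i \<omega> \<in> unit_cube" by (simp add: grid_cell_def)
          then have "\<bar>m x - m (Xs i \<omega>)\<bar> \<le> CH * norm (x - Xs i \<omega>) powr \<alpha>" using m x by (auto simp: holder_class_def)
          also have "\<dots> \<le> D" unfolding D_def
            using grid_cell_diameter[OF N xk xi] \<alpha> CH by (intro mult_left_mono powr_mono2) auto
          finally show "\<bar>m x - m (Xs i \<omega>)\<bar> \<le> D" .
        qed
        finally have "\<bar>m x - mh\<bar> * card I \<le> D * card I + \<bar>E\<bar>" by (simp add: mult.commute)
        then show ?thesis using c0 by (simp add: field_simps)
      qed
      also have "\<dots> \<le> c * (s k / sqrt (real n * P N k))"
      proof (rule band_halfwidth_ge[OF s2(3)[OF k] np c0 c1 \<theta> _ _ d(2) E])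
        have "real n * P N k \<le> real n * (CX * v N)"
          using P_bounds(2)[OF N, of k] k by (intro mult_left_mono) (auto simp: v_def L_def)
        then have "D * sqrt (real n * P N k) / s k \<le> D * sqrt (real n * (CX * v N)) / sqrt c\<sigma>"
          using s2[OF k] consts_pos D0 by (intro frac_le mult_left_mono) (auto simp: v_def)
        then show "D * sqrt (real n * P N k) / s k \<le> d" using d(1) unfolding D_def by linarith
        have "0 \<le> CH * (real CARD('p) / real N) powr \<alpha> * sqrt (real n * (CX * v N)) / sqrt c\<sigma>"
          using CH consts_pos by (simp add: v_def)
        then show "0 \<le> d" using d(1) by linarith
      qed
      \<comment> \<open>The scale in the band is the standard deviation of the mean of
        \<open>n * P N k\<close> errors of the cell: P^2 n / V = n P / (V / P).\<close>
      also have "s k / sqrt (real n * P N k) = ((P N k)\<^sup>2 / V N k * real n) powr (- 1 / 2)"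
      proof -
        have V0: "0 < V N k" using s2(3)[OF k] Pp[OF k] by (simp add: s_def zero_less_divide_iff)
        have 1: "((P N k)\<^sup>2 / V N k * real n) powr (- 1 / 2) = 1 / sqrt ((P N k)\<^sup>2 / V N k * real n)"
          using V0 Pp[OF k] n by (simp add: powr_minus_divide powr_half_sqrt)
        have 2: "(P N k)\<^sup>2 / V N k * real n = real n * P N k / (V N k / P N k)"
          using V0 Pp[OF k] by (simp add: power2_eq_square)
        have "1 / sqrt (real n * P N k / (V N k / P N k)) = s k / sqrt (real n * P N k)"
          unfolding s_def real_sqrt_divide[of "real n * P N k"] by simp
        then show ?thesis unfolding 1 unfolding 2 by simp
      qed
      finally show "\<bar>m x - hist_est N n (\<lambda>j. Xs j \<omega>) (\<lambda>j. m (Xs j \<omega>) + eps j \<omega>) x\<bar>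
          \<le> c * ((P N (cell_index N x))\<^sup>2 / V N (cell_index N x) * real n) powr (- 1 / 2)"
        unfolding mh_def k_def .
    qed
  qed (use n b c \<eta> \<theta> m0 cm q consts_pos \<kappa>_nonneg A snd in auto)
  have kl: "measure \<mu> {z \<in> space \<mu>. b * (sqrt c\<sigma> * sqrt m0) < \<bar>snd z\<bar>} = prob {\<omega> \<in> space M. b * (sqrt c\<sigma> * sqrt m0) < \<bar>\<epsilon> \<omega>\<bar>}"
  proof -
    have "{z \<in> space borel. b * (sqrt c\<sigma> * sqrt m0) < \<bar>snd z\<bar>} \<in> sets (borel :: ((real ^ 'p) \<times> real) measure)" by measurable
    then show ?thesis unfolding \<mu>_def by (subst measure_distr) (auto simp: vimage_def Int_def conj_commute)
  qed
  have cL: "card L = N ^ CARD('p)" unfolding L_def by (rule card_grid_index)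
  show ?thesis using main unfolding cL kl .
qed

end

section \<open>Quantitative coverage with all parameters chosen\<close>

context histogram_model
begin

text \<open>Multiplied by \<delta>^\<alpha> sqrt(n \<delta>^p) it bounds the bias in units of the
  standard deviation of a cell mean: Hoelder constant and cell diameter, \<open>CX\<close> for the
  cell count, \<open>c\<sigma>\<close> for the variance.\<close>

definition bias_const :: real where
  "bias_const = CH * real CARD('p) powr \<alpha> * sqrt CX / sqrt c\<sigma>"

definition err_const :: real where
  "err_const = (\<kappa> / sqrt c\<sigma> ^ 3 * (1 + exp 1) + 12 * exp 2) / sqrt (cX / 2)"

text \<open>Here \<open>l\<close> stands for \<open>ln n\<close> and \<open>x\<close> for \<open>2 / l + l d\<close>, where \<open>d\<close> is the normalized bias.\<close>
definition coverage_err :: "real \<Rightarrow> nat \<Rightarrow> real \<Rightarrow> real \<Rightarrow> real" where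
  "coverage_err C1 \<nu> l x = 4 * C1 * x * exp x + 10368 * sqrt (2 * pi) * C1 * err_const * exp (x + 8 * err_const) / l
     + exp (l - cX * l\<^sup>2 / 2)
     + expectation (\<lambda>\<omega>. \<bar>\<epsilon> \<omega>\<bar> ^ \<nu>) / ((sqrt c\<sigma> * sqrt (cX / 2)) ^ \<nu> * l)"

lemma err_const_nonneg: "0 \<le> err_const"
  unfolding err_const_def using \<kappa>_nonneg consts_pos by auto

lemma coverage_ge:
  fixes c C1 l M0 :: real and N n K :: nat
  defines "K \<equiv> N ^ CARD('p)" and "M0 \<equiv> real n * (1 / real N) ^ CARD('p)" and "l \<equiv> ln (real n)"
  defines "d \<equiv> bias_const * (1 / real N) powr \<alpha> * sqrt M0"
  assumes m: "m \<in> holder_class \<alpha> CH" and N: "1 \<le> N" and n: "0 < n" and l2: "2 \<le> l"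
    and c: "0 < c" "c \<le> l" "d \<le> c" and crit: "(1 - 2 * normal_tail c) ^ K = 1 - \<beta>"
    and C1: "0 \<le> C1" "real K * std_normal_density c \<le> C1 * (1 + c)"
    and M0: "l ^ 11 \<le> sqrt M0" "l\<^sup>2 * real n powr (1 / real \<nu>) \<le> sqrt M0" and Kn: "K \<le> n"
    and l10: "1 \<le> sqrt (cX / 2) * l ^ 10" and \<nu>: "1 \<le> \<nu>" and mom: "integrable M (\<lambda>\<omega>. \<bar>\<epsilon> \<omega>\<bar> ^ \<nu>)"
  shows "1 - \<beta> - coverage_err C1 \<nu> l (2 / l + l * d) \<le> prob (band_event N n c m)"
proof -
  define v where "v = (1 / real N) ^ CARD('p)"
  \<comment> \<open>Since \<open>c \<le> l\<close>, these choices give \<open>c * b \<le> 1\<close>,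
    while the two shifts \<theta> c and \<eta> contribute at most 1 / l each after multiplication by
    \<open>l\<close>. The power 11 in the hypothesis on \<open>M0\<close> is 3 + 6 + 1 + 1: b^(-3) =
    l^3, \<eta>^(-3) = l^6, a factor \<open>l\<close> from K times the density at \<open>c\<close>,
    and one more to leave 1 / l.\<close>
  define b where "b = 1 / l"
  define \<theta> where "\<theta> = 1 / l ^ 3"
  define \<eta> where "\<eta> = 1 / l\<^sup>2"
  define m0 where "m0 = (1 - \<theta>) * (real n * (cX * v))"
  define u where "u = \<theta> * c + d + \<eta>"
  define a where "a = c - \<theta> * c - d - \<eta>"
  define x where "x = 2 / l + l * d"
  define Q where "Q = \<kappa> / sqrt c\<sigma> ^ 3 * (1 / b ^ 3 + exp 1) + 12 * exp 2"
  define y where "y = Q / sqrt m0"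
  define G where "G = err_const"
  have l0: "0 < l" "1 \<le> l" using l2 by auto
  have N0: "0 < real N" using N by simp
  have v0: "0 < v" using N by (simp add: v_def)
  have M0p: "0 < M0" using n v0 by (simp add: M0_def v_def)
  have M0v: "M0 = real n * v" by (simp add: M0_def v_def)
  have G0: "0 \<le> G" unfolding G_def by (rule err_const_nonneg)
  have d0: "0 \<le> d" unfolding d_def bias_const_def using CH consts_pos M0p by simp
  have l3: "8 \<le> l ^ 3" using power_mono[OF l2, of 3] by simp
  have \<theta>: "0 \<le> \<theta>" "\<theta> \<le> 1 / 2" "\<theta> < 1" unfolding \<theta>_def using l3 l0 by (auto simp: field_simps)
  have "\<eta> \<le> 1" unfolding \<eta>_def using l0 by simp
  moreover have "0 < \<eta>" unfolding \<eta>_def using l0 by simp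
  ultimately have \<eta>: "0 < \<eta>" "\<eta> \<le> 3" by linarith+
  have m0: "cX / 2 * M0 \<le> m0"
    unfolding m0_def M0v using \<theta> consts_pos v0 mult_right_mono[of "1 / 2" "1 - \<theta>" "real n * (cX * v)"] by (simp add: mult_ac)
  have sm0: "sqrt (cX / 2) * sqrt M0 \<le> sqrt m0"
    using m0 unfolding real_sqrt_mult[symmetric] by simp
  have s2: "0 < sqrt (cX / 2)" using consts_pos by simp
  have sm0p: "0 < sqrt m0" using sm0 s2 M0p by (meson mult_pos_pos order_less_le_trans real_sqrt_gt_zero)
  have cm: "c \<le> sqrt m0"
  proof -
    have "l = 1 * l" by simp
    also have "\<dots> \<le> (sqrt (cX / 2) * l ^ 10) * l" using l10 l0 by (intro mult_right_mono) auto
    also have "\<dots> = sqrt (cX / 2) * l ^ 11" by (simp add: eval_nat_numeral)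
    also have "\<dots> \<le> sqrt (cX / 2) * sqrt M0" using M0 s2 by (intro mult_left_mono) auto
    finally show ?thesis using c sm0 by linarith
  qed
  have lu: "l * u \<le> x"
  proof -
    have "l * (\<theta> * c) \<le> l * (\<theta> * l)" using c l0 \<theta> by (intro mult_left_mono) auto
    also have "\<dots> = 1 / l" using l0 by (simp add: \<theta>_def power3_eq_cube)
    finally have "l * (\<theta> * c) \<le> 1 / l" .
    moreover have "l * \<eta> = 1 / l" using l0 by (simp add: \<eta>_def power2_eq_square)
    ultimately show ?thesis unfolding u_def x_def by (simp add: algebra_simps)
  qed
  have u0: "0 \<le> u" unfolding u_def using \<theta> c d0 \<eta> by simp
  have cu: "c * u \<le> x" using mult_right_mono[OF c(2) u0] lu by linarith
  have au: "a = c - u" by (simp add: a_def u_def)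
  have Q: "0 \<le> Q" "Q \<le> G * sqrt (cX / 2) * l ^ 3"
  proof -
    have k0: "0 \<le> \<kappa> / sqrt c\<sigma> ^ 3" using \<kappa>_nonneg consts_pos by simp
    show "0 \<le> Q" unfolding Q_def b_def using l0 by (intro add_nonneg_nonneg mult_nonneg_nonneg k0) auto
    have "1 / b ^ 3 + exp 1 \<le> (1 + exp 1) * l ^ 3"
      using l3 by (simp add: b_def power_divide algebra_simps)
    then have "Q \<le> \<kappa> / sqrt c\<sigma> ^ 3 * ((1 + exp 1) * l ^ 3) + 12 * exp 2 * l ^ 3"
      unfolding Q_def using k0 l3 by (intro add_mono mult_left_mono) auto
    also have "\<dots> = (\<kappa> / sqrt c\<sigma> ^ 3 * (1 + exp 1) + 12 * exp 2) * l ^ 3"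
      by (simp only: distrib_right mult.assoc)
    also have "\<kappa> / sqrt c\<sigma> ^ 3 * (1 + exp 1) + 12 * exp 2 = G * sqrt (cX / 2)" using s2 by (simp add: G_def err_const_def)
    finally show "Q \<le> G * sqrt (cX / 2) * l ^ 3" .
  qed
  have y: "0 \<le> y" "y \<le> G / l ^ 8"
  proof -
    show "0 \<le> y" unfolding y_def using Q sm0p by simp
    have "y \<le> (G * sqrt (cX / 2) * l ^ 3) / (sqrt (cX / 2) * l ^ 11)"
      unfolding y_def
    proof (rule frac_le)
      show "sqrt (cX / 2) * l ^ 11 \<le> sqrt m0"
        using mult_left_mono[OF M0(1), of "sqrt (cX / 2)"] s2 sm0 by linarith
    qed (use Q G0 s2 l0 in auto)
    also have "\<dots> = G / l ^ 8"
      using s2 l0 by (simp add: field_simps)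
    finally show "y \<le> G / l ^ 8" .
  qed
  have y3: "y * (1 + c) ^ 3 \<le> 8 * G"
  proof -
    have "(1 + c) ^ 3 \<le> (2 * l) ^ 3" using c l0 by (intro power_mono) auto
    then have "y * (1 + c) ^ 3 \<le> G / l ^ 8 * (2 * l) ^ 3" using y l0 G0 c by (intro mult_mono) auto
    also have "\<dots> = 8 * G / l ^ 5"
      using l0 by (simp add: field_simps)
    also have "\<dots> \<le> 8 * G" using G0 l0 one_le_power[OF l0(2), of 5] by (simp add: divide_le_eq mult_le_cancel_left1)
    finally show ?thesis .
  qed
  have dens: "exp (- c\<^sup>2 / 2) = sqrt (2 * pi) * std_normal_density c" by (simp add: std_normal_density_def)
  have Kd: "real K * std_normal_density c \<le> C1 * (2 * l)"
    using C1 c l0 mult_left_mono[of "1 + c" "2 * l" C1] by linarith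
  define err where "err = lindeberg_err \<eta> c a y"
  \<comment> \<open>With tilt \<open>c\<close> and \<open>a = c - u\<close> the exponent c^2/2 - c a
    equals - c^2/2 + c u, so the normal density at \<open>c\<close> splits off and absorbs
    \<open>K\<close> up to the factor 2 C1 l. The constants are 96 * 27 = 2592 and 4 * 2592 =
    10368.\<close>
  have Kerr: "2 * (real K * err) \<le> 10368 * sqrt (2 * pi) * C1 * G * exp (x + 8 * G) / l"
  proof -
    have "c\<^sup>2 / 2 - c * a = - c\<^sup>2 / 2 + c * u" unfolding au by (simp add: power2_eq_square algebra_simps)
    then have "exp (c\<^sup>2 / 2 - c * a + y * (1 + c) ^ 3) = exp (- c\<^sup>2 / 2) * exp (c * u + y * (1 + c) ^ 3)"
      by (simp add: exp_add[symmetric] add_ac)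
    also have "\<dots> \<le> exp (- c\<^sup>2 / 2) * exp (x + 8 * G)"
      using cu y3 by (intro mult_left_mono) auto
    finally have "err \<le> (G / l ^ 8) * (96 * (3 / \<eta>) ^ 3) * (exp (- c\<^sup>2 / 2) * exp (x + 8 * G))"
      unfolding err_def lindeberg_err_def using y G0 l0 \<eta> by (intro mult_mono) auto
    also have "(3 / \<eta>) ^ 3 = 27 * l ^ 6" using l0 by (simp add: \<eta>_def power_mult_distrib flip: power_mult)
    also have "(G / l ^ 8) * (96 * (27 * l ^ 6)) = 2592 * G / l\<^sup>2"
      using l0 by (simp add: field_simps)
    finally have "real K * err \<le> real K * (2592 * G / l\<^sup>2 * (exp (- c\<^sup>2 / 2) * exp (x + 8 * G)))"
      by (intro mult_left_mono) auto
    also have "\<dots> = (real K * std_normal_density c) * (2592 * G / l\<^sup>2 * sqrt (2 * pi) * exp (x + 8 * G))"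
      unfolding dens by simp
    also have "\<dots> \<le> (C1 * (2 * l)) * (2592 * G / l\<^sup>2 * sqrt (2 * pi) * exp (x + 8 * G))"
      using G0 by (intro mult_right_mono Kd) auto
    also have "\<dots> = 5184 * sqrt (2 * pi) * C1 * G * exp (x + 8 * G) / l"
      using l0 by (simp add: power2_eq_square field_simps)
    finally show ?thesis by simp
  qed
  define q where "q = 2 * (normal_tail a + err)"
  \<comment> \<open>If \<open>q\<close> exceeds 1, the block argument says nothing. Capping keeps
    the base of the power between 0 and 1, and the bound for \<open>q' - q0\<close> then shows that
    the claimed lower bound is not positive.\<close>
  define q' where "q' = min 1 q"
  define q0 where "q0 = 2 * normal_tail c"
  have err0: "0 \<le> err" unfolding err_def using y \<eta> by (intro lindeberg_err_nonneg) auto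
  have q00: "0 \<le> q0" "q0 \<le> 1" unfolding q0_def using normal_tail_nonneg[of c] normal_tail_le_half[of c] c by auto
  have q0q: "q0 \<le> q" unfolding q_def q0_def using err0 normal_tail_lipschitz(1)[of a c] au u0 by simp
  have q': "0 \<le> q'" "q' \<le> 1" "q0 \<le> q'" "q' \<le> q" unfolding q'_def using q0q q00 by auto
  have Kq: "real K * (q' - q0) \<le> 4 * C1 * x * exp x + 10368 * sqrt (2 * pi) * C1 * G * exp (x + 8 * G) / l"
  proof -
    have "q' - q0 \<le> q - q0" using q' by simp
    also have "\<dots> \<le> 2 * (u * (std_normal_density c * exp (c * u))) + 2 * err"
      unfolding q_def q0_def using normal_tail_shift_le[OF u0, of c] c au by simp
    finally have "real K * (q' - q0) \<le> real K * (2 * (u * (std_normal_density c * exp (c * u))) + 2 * err)"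
      by (intro mult_left_mono) auto
    also have "\<dots> = 2 * ((real K * std_normal_density c) * (u * exp (c * u))) + 2 * (real K * err)"
      by (simp add: algebra_simps)
    finally have 1: "real K * (q' - q0) \<le> 2 * ((real K * std_normal_density c) * (u * exp (c * u))) + 2 * (real K * err)" .
    have "(real K * std_normal_density c) * (u * exp (c * u)) \<le> (C1 * (2 * l)) * (u * exp x)"
      by (rule mult_mono[OF Kd]) (use u0 cu C1 l0 in \<open>auto intro!: mult_left_mono\<close>)
    also have "\<dots> = 2 * C1 * exp x * (l * u)" by simp
    also have "\<dots> \<le> 2 * C1 * exp x * x" using C1 by (intro mult_left_mono lu) auto
    finally have "2 * ((real K * std_normal_density c) * (u * exp (c * u))) \<le> 2 * (2 * C1 * exp x * x)" by (intro mult_left_mono) auto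
    also have "\<dots> = 4 * C1 * x * exp x" by simp
    finally have "2 * ((real K * std_normal_density c) * (u * exp (c * u))) \<le> 4 * C1 * x * exp x" .
    then show ?thesis using Kerr 1 by linarith
  qed
  \<comment> \<open>On the unit interval the K-th power is Lipschitz with constant \<open>K\<close>:
    this is where an error o(1 / K) per cell is required.\<close>
  have "(1 - q0) ^ K - (1 - q') ^ K \<le> real K * \<bar>(1 - q0) - (1 - q')\<bar>"
    using norm_power_diff[of "1 - q0" "1 - q'" K] q' q00 by simp
  then have pw: "1 - \<beta> - real K * (q' - q0) \<le> (1 - q') ^ K"
    using crit q'(3) unfolding q0_def by simp
  \<comment> \<open>As \<theta>^2 = l^(-6), already \<open>M0 \<ge> l ^ 8\<close> makes the Chernoff
    exponent of order l^2, which beats the logarithm \<open>l\<close> of the bound \<open>n\<close>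
    for the number of cells.\<close>
  have cnt: "real K * exp (- (\<theta>\<^sup>2 * (real n * (cX * v))) / 2) \<le> exp (l - cX * l\<^sup>2 / 2)"
  proof -
    have "l ^ 22 \<le> M0"
    proof -
      have "(l ^ 11)\<^sup>2 \<le> (sqrt M0)\<^sup>2" using M0 l0 by (intro power_mono) auto
      then show ?thesis using M0p by (simp flip: power_mult)
    qed
    moreover have "l ^ 8 \<le> l ^ 22" using l0 by (intro power_increasing) auto
    ultimately have "l ^ 8 \<le> M0" by linarith
    then have "\<theta>\<^sup>2 * l ^ 8 \<le> \<theta>\<^sup>2 * M0" by (intro mult_left_mono) auto
    moreover have "\<theta>\<^sup>2 * l ^ 8 = l\<^sup>2"
      using l0 by (simp add: \<theta>_def field_simps flip: power_mult)
    ultimately have "cX * l\<^sup>2 \<le> cX * (\<theta>\<^sup>2 * M0)" using consts_pos by (intro mult_left_mono) auto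
    then have "exp (- (\<theta>\<^sup>2 * (real n * (cX * v))) / 2) \<le> exp (- (cX * l\<^sup>2) / 2)"
      unfolding M0v by (simp add: mult_ac)
    then have "real K * exp (- (\<theta>\<^sup>2 * (real n * (cX * v))) / 2) \<le> real n * exp (- (cX * l\<^sup>2) / 2)"
      using Kn by (intro mult_mono) auto
    also have "\<dots> = exp l * exp (- (cX * l\<^sup>2) / 2)" using n by (simp add: l_def)
    also have "\<dots> = exp (l - cX * l\<^sup>2 / 2)" by (simp add: exp_add[symmetric])
    finally show ?thesis .
  qed
  define B where "B = b * (sqrt c\<sigma> * sqrt m0)"
  define E where "E = expectation (\<lambda>\<omega>. \<bar>\<epsilon> \<omega>\<bar> ^ \<nu>)"
  have E0: "0 \<le> E" unfolding E_def by (intro integral_nonneg_AE) auto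
  \<comment> \<open>The truncation level is at least a constant times l n^(1/\<nu>), so Markov's
    inequality of order \<nu> compensates the union over \<open>n\<close> observations and leaves
    l^(-\<nu>), hence at most 1 / l.\<close>
  have kill: "real n * prob {\<omega> \<in> space M. B < \<bar>\<epsilon> \<omega>\<bar>} \<le> E / ((sqrt c\<sigma> * sqrt (cX / 2)) ^ \<nu> * l)"
  proof -
    let ?g = "sqrt c\<sigma> * sqrt (cX / 2)"
    have g0: "0 < ?g" using consts_pos by simp
    have np: "(real n powr (1 / real \<nu>)) ^ \<nu> = real n" using n \<nu> by (simp add: powr_powr flip: powr_realpow)
    have "?g * (l * real n powr (1 / real \<nu>)) = b * (sqrt c\<sigma> * (sqrt (cX / 2) * (l\<^sup>2 * real n powr (1 / real \<nu>))))"
      using l0 by (simp add: b_def power2_eq_square)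
    also have "\<dots> \<le> B" unfolding B_def
      using l0 consts_pos M0(2) s2 order_trans[OF mult_left_mono[OF M0(2)] sm0]
      by (intro mult_left_mono) (auto simp: b_def)
    finally have B: "?g * (l * real n powr (1 / real \<nu>)) \<le> B" .
    have Bp: "0 < B" unfolding B_def b_def using l0 consts_pos sm0p by simp
    have "(?g * (l * real n powr (1 / real \<nu>))) ^ \<nu> \<le> B ^ \<nu>" using B g0 l0 by (intro power_mono) auto
    then have Bn: "?g ^ \<nu> * (l ^ \<nu> * real n) \<le> B ^ \<nu>" by (simp only: power_mult_distrib np)
    have lv: "l \<le> l ^ \<nu>" using power_increasing[OF \<nu> l0(2)] by simp
    have "prob {\<omega> \<in> space M. B < \<bar>\<epsilon> \<omega>\<bar>} \<le> prob {\<omega> \<in> space M. B ^ \<nu> \<le> \<bar>\<epsilon> \<omega>\<bar> ^ \<nu>}"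
    proof (rule finite_measure_mono)
      show "{\<omega> \<in> space M. B < \<bar>\<epsilon> \<omega>\<bar>} \<subseteq> {\<omega> \<in> space M. B ^ \<nu> \<le> \<bar>\<epsilon> \<omega>\<bar> ^ \<nu>}"
        using Bp by (auto intro!: power_mono)
    qed measurable
    also have "\<dots> \<le> E / B ^ \<nu>"
      unfolding E_def using mom Bp by (intro integral_Markov_inequality_measure[where A="space M"]) auto
    finally have "real n * prob {\<omega> \<in> space M. B < \<bar>\<epsilon> \<omega>\<bar>} \<le> real n * (E / B ^ \<nu>)"
      by (intro mult_left_mono) auto
    also have "\<dots> \<le> real n * (E / (?g ^ \<nu> * (l ^ \<nu> * real n)))"
      using Bn E0 by (rule_tac mult_left_mono, rule_tac divide_left_mono)
        (use g0 l0 n Bp in \<open>auto intro!: mult_pos_pos zero_less_power\<close>)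
    also have "\<dots> = E / (?g ^ \<nu> * l ^ \<nu>)" using n by simp
    also have "\<dots> \<le> E / (?g ^ \<nu> * l)"
      using lv E0 g0 l0 by (intro divide_left_mono mult_left_mono) auto
    finally show ?thesis .
  qed
  have main: "(1 - q) ^ (N ^ CARD('p)) - real (N ^ CARD('p)) * exp (- (\<theta>\<^sup>2 * (real n * (cX * (1 / real N) ^ CARD('p)))) / 2)
     - real n * prob {\<omega> \<in> space M. b * (sqrt c\<sigma> * sqrt m0) < \<bar>\<epsilon> \<omega>\<bar>} \<le> prob (band_event N n c m)" if "q \<le> 1"
  proof (rule band_prob_ge[OF m N n _ c(3) _ _ c(1) _ \<eta> \<theta>(1,3) _ cm a_def])
    have "CH * (real CARD('p) / real N) powr \<alpha> * sqrt (real n * (CX * (1 / real N) ^ CARD('p))) / sqrt c\<sigma> = d"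
    proof -
      have "(real CARD('p) / real N) powr \<alpha> = real CARD('p) powr \<alpha> * (1 / real N) powr \<alpha>"
        using N0 by (simp add: powr_divide)
      moreover have "sqrt (real n * (CX * (1 / real N) ^ CARD('p))) = sqrt CX * sqrt M0"
        unfolding real_sqrt_mult[symmetric] M0_def by (simp add: mult_ac)
      ultimately show ?thesis unfolding d_def bias_const_def by simp
    qed
    then show "CH * (real CARD('p) / real N) powr \<alpha> * sqrt (real n * (CX * (1 / real N) ^ CARD('p))) / sqrt c\<sigma> \<le> d" by simp
    show "0 < b" "b \<le> 1" "c * b \<le> 1" unfolding b_def using l0 c by auto
    show "m0 = (1 - \<theta>) * (real n * (cX * (1 / real N) ^ CARD('p)))" by (simp add: m0_def v_def)
    show "q \<le> 1" by fact
    show "2 * (normal_tail a + lindeberg_err \<eta> c a ((\<kappa> / sqrt c\<sigma> ^ 3 * (1 / b ^ 3 + exp 1) + 12 * exp 2) / sqrt m0)) \<le> q"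
      by (simp add: q_def err_def y_def Q_def)
  qed
  have ce: "coverage_err C1 \<nu> l x = 4 * C1 * x * exp x + 10368 * sqrt (2 * pi) * C1 * G * exp (x + 8 * G) / l
      + exp (l - cX * l\<^sup>2 / 2) + E / ((sqrt c\<sigma> * sqrt (cX / 2)) ^ \<nu> * l)"
    by (simp add: coverage_err_def G_def E_def)
  show ?thesis
  proof (cases "q \<le> 1")
    case True
    then have qq: "q' = q" by (simp add: q'_def)
    show ?thesis
      using pw Kq cnt kill main[OF True] unfolding qq x_def[symmetric] ce K_def v_def B_def by linarith
  next
    case False
    have "0 < K" using N by (simp add: K_def)
    then have "(1 - q') ^ K = 0" using False by (simp add: q'_def)
    moreover have "0 \<le> E / ((sqrt c\<sigma> * sqrt (cX / 2)) ^ \<nu> * l)" using E0 consts_pos l0 by simp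
    moreover have "0 \<le> prob (band_event N n c m)" "0 < exp (l - cX * l\<^sup>2 / 2)" by simp_all
    ultimately show ?thesis using pw Kq unfolding x_def[symmetric] ce by linarith
  qed
qed

end

section \<open>The limit statement\<close>

theorem theorem1:
  fixes M :: "'w measure"
    and X :: "'w \<Rightarrow> real ^ 'p::finite" and \<epsilon> :: "'w \<Rightarrow> real"
    and Xs :: "nat \<Rightarrow> 'w \<Rightarrow> real ^ 'p" and eps :: "nat \<Rightarrow> 'w \<Rightarrow> real"
    and fX :: "real ^ 'p \<Rightarrow> real" and \<sigma>2 :: "real ^ 'p \<Rightarrow> real"
    and cX CX c\<sigma> C\<sigma> \<alpha> CH \<beta> :: real
    and N :: "nat \<Rightarrow> nat" and \<nu> :: nat
  defines "FX \<equiv> vimage_algebra (space M) X borel"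
    and "p \<equiv> CARD('p)"
  assumes prob: "prob_space M"
    and rvX: "X \<in> borel_measurable M" and rv\<epsilon>: "\<epsilon> \<in> borel_measurable M"
    and rvXs: "\<And>i. Xs i \<in> borel_measurable M" and rveps: "\<And>i. eps i \<in> borel_measurable M"
    and indep: "prob_space.indep_vars M (\<lambda>_. borel) (\<lambda>i \<omega>. (Xs i \<omega>, eps i \<omega>)) UNIV"
    and ident: "\<And>i. distr M borel (\<lambda>\<omega>. (Xs i \<omega>, eps i \<omega>)) = distr M borel (\<lambda>\<omega>. (X \<omega>, \<epsilon> \<omega>))"
    and X_cube: "AE \<omega> in M. X \<omega> \<in> unit_cube"
    and dens: "distributed M lborel X (\<lambda>x. ennreal (fX x))"
    and consts_pos: "0 < cX" "0 < CX" "0 < c\<sigma>" "0 < C\<sigma>"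
    and dens_bounds: "\<And>x. x \<in> unit_cube \<Longrightarrow> cX \<le> fX x \<and> fX x \<le> CX"
    and cond_mean: "AE \<omega> in M. real_cond_exp M FX \<epsilon> \<omega> = 0"
    and \<sigma>2_meas: "\<sigma>2 \<in> borel_measurable borel"
    and cond_var: "AE \<omega> in M. real_cond_exp M FX (\<lambda>\<omega>. (\<epsilon> \<omega>)\<^sup>2) \<omega> = \<sigma>2 (X \<omega>)"
    and \<sigma>2_bounds: "\<And>x. x \<in> unit_cube \<Longrightarrow> c\<sigma> \<le> \<sigma>2 x \<and> \<sigma>2 x \<le> C\<sigma>"
    and \<alpha>: "0 < \<alpha>" "\<alpha> \<le> 1" and CH: "0 < CH"
    and N_pos: "\<And>n. N n \<ge> 1" and \<delta>_to_0: "(\<lambda>n. 1 / real (N n)) \<longlonglongrightarrow> 0"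
    and rate1: "(\<lambda>n. real n * (1 / real (N n)) powr (2 * \<alpha> + real p) * (ln (real n))\<^sup>2) \<longlonglongrightarrow> 0"
    and \<nu>: "4 \<le> \<nu>" and moment: "integrable M (\<lambda>\<omega>. \<bar>\<epsilon> \<omega>\<bar> ^ \<nu>)"
    and rate2: "(\<lambda>n. (ln (real n)) ^ 5 / ((1 / real (N n)) ^ p * real n powr (1 - 2 / real \<nu>))) \<longlonglongrightarrow> 0"
    and third: "\<exists>K. AE \<omega> in M. real_cond_exp M FX (\<lambda>\<omega>. \<bar>\<epsilon> \<omega>\<bar> ^ 3) \<omega> \<le> K"
    and \<beta>: "0 < \<beta>" "\<beta> < 1"
  shows "liminf (\<lambda>n. ereal (INF m \<in> holder_class \<alpha> CH.
            measure M {\<omega> \<in> space M. \<forall>x \<in> unit_cube.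
              (let \<tau> = (measure M {\<omega>'\<in>space M. X \<omega>' \<in> cell (N n) x})\<^sup>2
                        / integral\<^sup>L M (\<lambda>\<omega>'. \<sigma>2 (X \<omega>') * indicator (cell (N n) x) (X \<omega>'));
                   mh = hist_est (N n) n (\<lambda>j. Xs j \<omega>) (\<lambda>j. m (Xs j \<omega>) + eps j \<omega>) x;
                   w = crit_val (N n ^ p) \<beta> * (\<tau> * real n) powr (- 1 / 2)
               in m x \<in> {mh - w .. mh + w})}))
         \<ge> ereal (1 - \<beta>)"
proof -
  interpret prob_space M by (rule prob)
  obtain K3 where K3: "AE \<omega> in M. real_cond_exp M FX (\<lambda>\<omega>. \<bar>\<epsilon> \<omega>\<bar> ^ 3) \<omega> \<le> K3" using third by blast
  have int3: "integrable M (\<lambda>\<omega>. \<bar>\<epsilon> \<omega>\<bar> ^ 3)"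
  proof (rule integrable_of_abs_le)
    show "integrable M (\<lambda>\<omega>. 1 + \<bar>\<epsilon> \<omega>\<bar> ^ \<nu>)" using moment by simp
    show "\<bar>\<bar>\<epsilon> \<omega>\<bar> ^ 3\<bar> \<le> 1 + \<bar>\<epsilon> \<omega>\<bar> ^ \<nu>" for \<omega> using abs_power_le_one_plus[of 3 \<nu> "\<epsilon> \<omega>"] \<nu> by simp
  qed (use rv\<epsilon> in measurable)
  \<comment> \<open>The locale wants a nonnegative bound for the third conditional moment, and
    \<open>K3\<close> comes without a sign.\<close>
  interpret histogram_model M X \<epsilon> Xs eps fX \<sigma>2 cX CX c\<sigma> C\<sigma> \<alpha> CH "max 0 K3"
  proof unfold_locales
    show "AE \<omega> in M. real_cond_exp M (vimage_algebra (space M) X borel) (\<lambda>\<omega>. \<bar>\<epsilon> \<omega>\<bar> ^ 3) \<omega> \<le> max 0 K3"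
      using K3 unfolding FX_def by eventually_elim simp
  qed (use assms int3 in \<open>simp_all add: FX_def\<close>)
  define l where "l n = ln (real n)" for n
  define v where "v n = (1 / real (N n)) ^ p" for n
  define M0 where "M0 n = real n * v n" for n
  define d where "d n = bias_const * (1 / real (N n)) powr \<alpha> * sqrt (M0 n)" for n
  define c where "c n = crit_val (N n ^ p) \<beta>" for n
  define C1 where "C1 = exp (3 / 2) * ln (1 / (1 - \<beta>))"
  define x where "x n = 2 / l n + l n * d n" for n
  have e0: "0 < 2 / real \<nu>" using \<nu> by simp
  have v0: "0 < v n" for n using N_pos[of n] by (simp add: v_def)
  have v_K: "v n = 1 / real (N n ^ p)" for n by (simp add: v_def power_divide)
  have K1: "1 \<le> N n ^ p" for n using N_pos[of n] by simp
  have C1: "0 \<le> C1" unfolding C1_def using \<beta> by (intro mult_nonneg_nonneg ln_ge_zero) auto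
  have bc: "0 \<le> bias_const" unfolding bias_const_def using CH consts_pos by simp
  have d0: "0 \<le> d n" for n unfolding d_def using bc v0[of n] by (simp add: M0_def)
  have l_top: "filterlim l at_top sequentially" unfolding l_def by real_asymp
  have l2: "\<forall>\<^sub>F n in sequentially. 2 \<le> l n" using l_top by (simp add: filterlim_at_top)
  have n0: "\<forall>\<^sub>F n :: nat in sequentially. 0 < n" by (rule eventually_gt_at_top)
  \<comment> \<open>The second rate condition, with n written as n^(1 - 2/\<nu>)
    n^(2/\<nu>).\<close>
  have M0_ge: "\<forall>\<^sub>F n in sequentially. l n ^ 5 * real n powr (2 / real \<nu>) \<le> M0 n"
  proof -
    have "\<forall>\<^sub>F n in sequentially. ln (real n) ^ 5 / ((1 / real (N n)) ^ p * real n powr (1 - 2 / real \<nu>)) < 1"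
      using rate2 by (rule order_tendstoD) simp
    then show ?thesis using n0
    proof eventually_elim
      case (elim n)
      have pos: "0 < v n * real n powr (1 - 2 / real \<nu>)" using v0[of n] elim(2) by simp
      have "l n ^ 5 < v n * real n powr (1 - 2 / real \<nu>)"
        using elim(1) pos unfolding l_def v_def by (simp add: pos_divide_less_eq)
      then have "l n ^ 5 * real n powr (2 / real \<nu>) \<le> v n * real n powr (1 - 2 / real \<nu>) * real n powr (2 / real \<nu>)"
        by (intro mult_right_mono) auto
      also have "\<dots> = M0 n" using elim(2) by (simp add: M0_def mult.assoc flip: powr_add)
      finally show ?case .
    qed
  qed
  \<comment> \<open>A positive power of n beats any power of its logarithm; 17 complements the 5 of
    the rate condition to 22, twice the 11 demanded by \<open>coverage_ge\<close>.\<close>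
  have l17: "\<forall>\<^sub>F n in sequentially. l n ^ 17 \<le> real n powr (2 / real \<nu>)"
    unfolding l_def using e0 by real_asymp
  have "\<forall>\<^sub>F n in sequentially. l n ^ 22 \<le> M0 n"
    using M0_ge l17 l2
  proof eventually_elim
    case (elim n)
    have "l n ^ 22 = l n ^ 5 * l n ^ 17" by (simp flip: power_add)
    also have "\<dots> \<le> l n ^ 5 * real n powr (2 / real \<nu>)" using elim by (intro mult_left_mono) auto
    finally show ?case using elim by linarith
  qed
  then have M0_1: "\<forall>\<^sub>F n in sequentially. l n ^ 11 \<le> sqrt (M0 n)"
    by eventually_elim (auto intro!: real_le_rsqrt simp flip: power_mult)
  \<comment> \<open>Squared, this asks for l^4 n^(2/\<nu>). It places the truncation level above the
    largest of \<open>n\<close> errors by a margin of order \<open>l\<close>.\<close>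
  have M0_2: "\<forall>\<^sub>F n in sequentially. (l n)\<^sup>2 * real n powr (1 / real \<nu>) \<le> sqrt (M0 n)"
    using M0_ge l2 n0
  proof eventually_elim
    case (elim n)
    have "((l n)\<^sup>2 * real n powr (1 / real \<nu>))\<^sup>2 = l n ^ 4 * real n powr (2 / real \<nu>)"
      using elim(3) by (simp add: power_mult_distrib power2_eq_square[of "real n powr _"] flip: powr_add power_mult)
    also have "\<dots> \<le> l n ^ 5 * real n powr (2 / real \<nu>)"
      using elim by (intro mult_right_mono power_increasing) auto
    finally show ?case using elim by (intro real_le_rsqrt) linarith
  qed
  have Kn: "\<forall>\<^sub>F n in sequentially. N n ^ p \<le> n"
    using M0_1 l2
  proof eventually_elim
    case (elim n)
    have "1 \<le> l n ^ 11" using elim(2) by (intro one_le_power) simp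
    then have "1 \<le> M0 n" using elim(1) by (metis order_trans real_sqrt_ge_1_iff)
    then have "1 \<le> real n / real (N n ^ p)" unfolding M0_def v_K by simp
    moreover have "0 < real (N n ^ p)" using K1[of n] by linarith
    ultimately have "real (N n ^ p) \<le> real n" unfolding pos_le_divide_eq[OF \<open>0 < real (N n ^ p)\<close>] by linarith
    then show ?case by linarith
  qed
  have l10: "\<forall>\<^sub>F n in sequentially. 1 \<le> sqrt (cX / 2) * l n ^ 10"
  proof -
    have "0 < sqrt (cX / 2)" using consts_pos by simp
    then show ?thesis unfolding l_def by real_asymp
  qed
  note crit = crit_val_eq[OF K1 \<beta>] crit_val_bounds[OF K1 \<beta>]
  \<comment> \<open>The critical value is of order sqrt(log K), and \<open>K \<le> n\<close>
    eventually.\<close>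
  have c_l: "\<forall>\<^sub>F n in sequentially. c n \<le> l n"
  proof -
    have "\<forall>\<^sub>F n in sequentially. 2 * (ln (2 / \<beta>) + ln (real n)) \<le> (ln (real n))\<^sup>2" by real_asymp
    then show ?thesis using Kn n0 l2
    proof eventually_elim
      case (elim n)
      have "(c n)\<^sup>2 \<le> 2 * ln (2 * real (N n ^ p) / \<beta>)" unfolding c_def by (rule crit)
      also have "\<dots> \<le> 2 * ln (2 / \<beta> * real n)"
        using elim(2) K1[of n] N_pos[of n] \<beta> by (intro mult_left_mono ln_mono) (auto simp: field_simps simp flip: of_nat_power)
      also have "\<dots> = 2 * (ln (2 / \<beta>) + ln (real n))" using \<beta> elim(3) by (subst ln_mult) auto
      also have "\<dots> \<le> (l n)\<^sup>2" using elim(1) by (simp add: l_def)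
      finally show ?case by (rule power2_le_imp_le) (use elim(4) in simp)
    qed
  qed
  \<comment> \<open>The expression in the first rate condition is the square of
    \<open>l n * d n\<close> up to the factor \<open>bias_const ^ 2\<close>. The factor
    \<open>l n\<close> is needed because shifting the level by d changes \<open>K\<close> tails by
    about c d times \<open>K\<close> tails.\<close>
  have ld: "(\<lambda>n. l n * d n) \<longlonglongrightarrow> 0"
  proof -
    have "(\<lambda>n. bias_const * sqrt (real n * (1 / real (N n)) powr (2 * \<alpha> + real p) * (ln (real n))\<^sup>2)) \<longlonglongrightarrow> bias_const * sqrt 0"
      by (intro tendsto_mult tendsto_const tendsto_real_sqrt rate1)
    then have "(\<lambda>n. bias_const * sqrt (real n * (1 / real (N n)) powr (2 * \<alpha> + real p) * (ln (real n))\<^sup>2)) \<longlonglongrightarrow> 0" by simp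
    then show ?thesis
    proof (rule Lim_transform_eventually)
      show "\<forall>\<^sub>F n in sequentially. bias_const * sqrt (real n * (1 / real (N n)) powr (2 * \<alpha> + real p) * (ln (real n))\<^sup>2) = l n * d n"
        using l2
      proof eventually_elim
        case (elim n)
        have N0: "0 < 1 / real (N n)" using N_pos[of n] by simp
        have "((1 / real (N n)) powr \<alpha>)\<^sup>2 = (1 / real (N n)) powr (2 * \<alpha>)"
          unfolding power2_eq_square powr_add[symmetric] by simp
        then have "(1 / real (N n)) powr (2 * \<alpha> + real p) = ((1 / real (N n)) powr \<alpha>)\<^sup>2 * v n"
          unfolding powr_add v_def powr_realpow[OF N0] by simp
        then have "sqrt (real n * (1 / real (N n)) powr (2 * \<alpha> + real p) * (ln (real n))\<^sup>2)
            = sqrt (((1 / real (N n)) powr \<alpha>)\<^sup>2 * M0 n * (l n)\<^sup>2)" by (simp add: M0_def l_def mult_ac)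
        also have "\<dots> = (1 / real (N n)) powr \<alpha> * sqrt (M0 n) * l n"
          using elim by (simp add: real_sqrt_mult)
        finally show ?case by (simp add: d_def)
      qed
    qed
  qed
  \<comment> \<open>The bias tends to 0, while \<open>c n\<close> is at least
    \<open>1 - \<beta>\<close>.\<close>
  have d_c: "\<forall>\<^sub>F n in sequentially. d n \<le> c n"
  proof -
    have "\<forall>\<^sub>F n in sequentially. l n * d n < 1 - \<beta>" using ld by (rule order_tendstoD) (use \<beta> in simp)
    then show ?thesis using l2
    proof eventually_elim
      case (elim n)
      have "1 * d n \<le> l n * d n" using elim d0 by (intro mult_right_mono) auto
      then show ?case using elim crit(3)[of n] unfolding c_def by linarith
    qed
  qed
  have x0: "x \<longlonglongrightarrow> 0"
  proof -
    have "(\<lambda>n. 2 / l n) \<longlonglongrightarrow> 0" unfolding l_def by real_asymp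
    from tendsto_add[OF this ld] show ?thesis unfolding x_def by simp
  qed
  let ?B = "\<lambda>n m. prob (band_event (N n) n (c n) m)"
  \<comment> \<open>The lower bound does not mention \<open>m\<close>, which makes it a bound for
    the infimum; nonemptiness of the class is what the real infimum requires.\<close>
  have ev: "\<forall>\<^sub>F n in sequentially. 1 - \<beta> - coverage_err C1 \<nu> (l n) (x n) \<le> (INF m\<in>holder_class \<alpha> CH. ?B n m)"
    using l2 n0 c_l d_c M0_1 M0_2 Kn l10
  proof eventually_elim
    case (elim n)
    have "(\<lambda>_. 0) \<in> (holder_class \<alpha> CH :: (real ^ 'p \<Rightarrow> real) set)" using CH by (simp add: holder_class_def)
    then have "(holder_class \<alpha> CH :: (real ^ 'p \<Rightarrow> real) set) \<noteq> {}" by blast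
    then show ?case
    proof (rule cINF_greatest)
      fix m :: "real ^ 'p \<Rightarrow> real" assume m: "m \<in> holder_class \<alpha> CH"
      show "1 - \<beta> - coverage_err C1 \<nu> (l n) (x n) \<le> ?B n m"
        unfolding x_def l_def d_def M0_def v_def p_def
      proof (rule coverage_ge[OF m N_pos elim(2)])
        show "0 < c n" unfolding c_def by (rule crit)
        show "(1 - 2 * normal_tail (c n)) ^ (N n ^ CARD('p)) = 1 - \<beta>" unfolding c_def p_def[symmetric] by (rule crit)
        show "real (N n ^ CARD('p)) * std_normal_density (c n) \<le> C1 * (1 + c n)"
          unfolding c_def C1_def p_def[symmetric] by (rule crit)
        show "1 \<le> \<nu>" using \<nu> by simp
      qed (use elim C1 moment in \<open>simp_all add: l_def d_def M0_def v_def p_def\<close>)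
    qed
  qed
  have "(\<lambda>n. 1 - \<beta> - coverage_err C1 \<nu> (l n) (x n)) \<longlonglongrightarrow> 1 - \<beta>"
  proof -
    have 1: "(\<lambda>n. 4 * C1 * x n * exp (x n)) \<longlonglongrightarrow> 4 * C1 * 0 * exp 0" by (intro tendsto_intros x0)
    have 2: "(\<lambda>n. 10368 * sqrt (2 * pi) * C1 * err_const * exp (x n + 8 * err_const) / l n) \<longlonglongrightarrow> 0"
      by (rule tendsto_divide_0[where c="10368 * sqrt (2 * pi) * C1 * err_const * exp (0 + 8 * err_const)"])
         (intro tendsto_intros x0 filterlim_at_top_imp_at_infinity l_top)+
    have 3: "(\<lambda>n. exp (l n - cX * (l n)\<^sup>2 / 2)) \<longlonglongrightarrow> 0" unfolding l_def using consts_pos(1) by real_asymp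
    have 4: "(\<lambda>n. expectation (\<lambda>\<omega>. \<bar>\<epsilon> \<omega>\<bar> ^ \<nu>) / ((sqrt c\<sigma> * sqrt (cX / 2)) ^ \<nu> * l n)) \<longlonglongrightarrow> 0"
    proof -
      have "(\<lambda>n. expectation (\<lambda>\<omega>. \<bar>\<epsilon> \<omega>\<bar> ^ \<nu>) / (sqrt c\<sigma> * sqrt (cX / 2)) ^ \<nu> / l n) \<longlonglongrightarrow> 0"
        by (rule tendsto_divide_0[OF tendsto_const]) (intro filterlim_at_top_imp_at_infinity l_top)
      then show ?thesis by simp
    qed
    have "(\<lambda>n. coverage_err C1 \<nu> (l n) (x n)) \<longlonglongrightarrow> 4 * C1 * 0 * exp 0 + 0 + 0 + 0"
      unfolding coverage_err_def by (intro tendsto_add 1 2 3 4)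
    from tendsto_diff[OF tendsto_const this, of "1 - \<beta>"] show ?thesis by simp
  qed
  then have lim: "liminf (\<lambda>n. ereal (1 - \<beta> - coverage_err C1 \<nu> (l n) (x n))) = ereal (1 - \<beta>)"
    by (intro lim_imp_Liminf) auto
  have "liminf (\<lambda>n. ereal (1 - \<beta> - coverage_err C1 \<nu> (l n) (x n))) \<le> liminf (\<lambda>n. ereal (INF m\<in>holder_class \<alpha> CH. ?B n m))"
    using ev by (intro Liminf_mono) simp
  moreover have abs: "\<bar>y - z\<bar> \<le> w \<longleftrightarrow> y \<in> {z - w..z + w}" for y z w :: real by (auto simp: abs_le_iff)
  ultimately show ?thesis
    unfolding lim unfolding band_event_def c_def P_def V_def Let_def cell_eq_grid_cell abs by blast
qed

end
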